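(* Let $\mu$ be a non-zero integer. Then for all real $x>0$ $$P_{\mu}(x)=(-1)^{\mu}\left(-f_{\mu}(x)+\mu^2\int_x^{\infty}\frac{f_{\mu}(t)}{t}\,dt+(1-\mu^2)\,x\int_x^{\infty}\frac{f_{\mu}(t)}{t^2}\,dt\right).$$
   Context: $J_p(x)$ and $Y_p(x)$ are the Bessel functions of the first and second kind of order $p$. A hat denotes the derivative with respect to the order: for an integer $k$ and $x>0$, $\hat{J}_k(x)=\left.\frac{\partial}{\partial p}J_p(x)\right|_{p=k}$. For an integer $\mu$ and $x>0$ define $$P_{\mu}(x)=\sum_{n=1}^{\infty}n\left[\left(\hat{J}_{n-\mu}(x)J_{n}(x)+J_{n-\mu}(x)\hat{J}_{n}(x)\right)+(-1)^{\mu}\left(\hat{J}_{n+\mu}(x)J_{n}(x)+J_{n+\mu}(x)\hat{J}_{n}(x)\right)\right]$$ and $$f_{\mu}(x)=\frac{\pi}{4}\left(Y_{\mu}(x)J_0(x)+J_{\mu}(x)Y_0(x)\right).$$ *)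

theory Defs
  imports "HOL-Analysis.Analysis"
begin

text \<open>
  Bessel functions of real order and positive real argument. The reciprocal Gamma function
  vanishes at the non-positive integers, so the power series covers negative integer orders too.
\<close>

definition bessel_J :: "real \<Rightarrow> real \<Rightarrow> real" where
  "bessel_J p x = (\<Sum>m. (- 1) ^ m * rGamma (p + real m + 1) / fact m * (x / 2) powr (p + 2 * real m))"

definition bessel_Y :: "real \<Rightarrow> real \<Rightarrow> real" where
  "bessel_Y p x =
     (let quot = (\<lambda>q. (bessel_J q x * cos (q * pi) - bessel_J (- q) x) / sin (q * pi))
      in if p \<in> \<int> then Lim (at p) quot else quot p)"

definition bessel_J_hat :: "int \<Rightarrow> real \<Rightarrow> real" where
  "bessel_J_hat k x = deriv (\<lambda>p. bessel_J p x) (of_int k)"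

definition bessel_P_term :: "int \<Rightarrow> real \<Rightarrow> nat \<Rightarrow> real" where
  "bessel_P_term \<mu> x n = real n *
     ((bessel_J_hat (int n - \<mu>) x * bessel_J (of_nat n) x
         + bessel_J (of_int (int n - \<mu>)) x * bessel_J_hat (int n) x)
      + (- 1) powi \<mu> *
        (bessel_J_hat (int n + \<mu>) x * bessel_J (of_nat n) x
         + bessel_J (of_int (int n + \<mu>)) x * bessel_J_hat (int n) x))"

definition bessel_P :: "int \<Rightarrow> real \<Rightarrow> real" where
  "bessel_P \<mu> x = (\<Sum>n. bessel_P_term \<mu> x (Suc n))"

definition bessel_f :: "int \<Rightarrow> real \<Rightarrow> real" where
  "bessel_f \<mu> x = pi / 4 *
     (bessel_Y (of_int \<mu>) x * bessel_J 0 x + bessel_J (of_int \<mu>) x * bessel_Y 0 x)"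

end

(*
  Write D(k,l) for the derivative at s = 0 of J_(k+s)(x) J_(l+s)(x) and <k,l> for Y_k J_l + J_k Y_l.
  By the recurrence 2 p J_p = x (J_(p-1) + J_(p+1)), the sum of D(n-k,n) over n telescopes for k <> 0,
  and n J_n can be replaced by x/2 (J_(n-1) + J_(n+1)) up to a product of Bessel functions, so the
  weighted series telescopes too.  The reflection Y_k = (Jhat_k + (-1)^k Jhat_(-k)) / pi turns the
  boundary terms into a finite combination of brackets <k,l>.  Up to constants, the same combinations
  are antiderivatives of f/t and f/t^2.

  It remains to see that these antiderivatives vanish at infinity.  This holds because the Hankel
  functions H_k = J_k + i Y_k satisfy H_(k+1) = -i H_k + O(x^(-3/2)), which by the recurrence need
  only be shown for k = 0.  There it is read off from
    H_0(x) = (2/pi) e^(ix) \<integral>_0^\<infinity> e^(-xu) / sqrt (u (2i - u)) du,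
  which holds because both sides solve Bessel's equation and agree to leading orders as x tends to 0.
*)
theory Submission
  imports Defs
begin

subsection \<open>Exponential generating functions\<close>

text \<open>The unweighted telescoping divides by the difference k of the two orders. Replacing n
  J_n by its neighbours turns the difference mu into mu - 1 and mu + 1, so mu = 1 and mu = -1
  degenerate. For mu = 1 the two halves of a term have to be telescoped together, and negative mu is
  reached by reflection, under which both sides pick up the factor (-1)^mu. The antiderivatives are
  found among the four brackets with orders in {mu, mu - 1} x {0, 1}, which are closed under
  differentiation. They contain terms t * <k,l>, while a single bracket decays only like 1/t. Decay
  alone therefore does not fix the constants of integration: leading terms must cancel. Since a
  bracket is Im (H_k H_l), this cancellation needs only the ratio of consecutive Hankel functions,
  not their phase, and so absolute estimates of a Laplace integral suffice. The identification of
  H_0 has to be done at the origin, where Y_0 is logarithmic. Hence the limits there must be exact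
  up to the constant term, which is where Euler's constant enters on both sides.\<close>

definition egf :: "(nat \<Rightarrow> real) \<Rightarrow> real \<Rightarrow> real" where
  "egf a y = (\<Sum>m. a m / fact m * y ^ m)"

text \<open>The growth proved below for the reciprocal Gamma function and its derivative along p + m
  + 1. It survives shifting the sequence, which is what differentiating \<open>egf\<close>
  does.\<close>

definition lin_bounded :: "(nat \<Rightarrow> real) \<Rightarrow> bool" where
  "lin_bounded a \<longleftrightarrow> (\<exists>C. \<forall>m. \<bar>a m\<bar> \<le> C * (1 + real m))"

lemma lin_boundedI: "(\<And>m. \<bar>a m\<bar> \<le> C * (1 + real m)) \<Longrightarrow> lin_bounded a"
  unfolding lin_bounded_def by blast

lemma succ_over_fact_le: "(1 + real m) / fact m \<le> 2"
proof -
  have "(1::real) \<le> fact m" by (rule fact_ge_1)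
  have "real m \<le> fact m" using fact_ge_self[of m] of_nat_mono[of m "fact m"] by simp
  hence "1 + real m \<le> 2 * fact m" using \<open>1 \<le> fact m\<close> by linarith
  thus ?thesis by (simp add: divide_le_eq)
qed

lemma summable_lin_exp: "summable (\<lambda>m. (1 + real m) / fact m * (y::real) ^ m)"
proof (rule summable_comparison_test')
  show "summable (\<lambda>m. inverse (fact m) * (2 * \<bar>y\<bar>) ^ m)"
    using summable_exp[of "2 * \<bar>y\<bar>"] by simp
  fix m :: nat assume "m \<ge> 0"
  have "real (1 + m) \<le> real (2 ^ m)"
    by (intro of_nat_mono) (metis add.commute Suc_leI less_exp plus_1_eq_Suc)
  hence "(1 + real m) * \<bar>y\<bar> ^ m \<le> 2 ^ m * \<bar>y\<bar> ^ m"
    by (intro mult_right_mono) auto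
  hence "(1 + real m) * \<bar>y\<bar> ^ m / fact m \<le> 2 ^ m * \<bar>y\<bar> ^ m / fact m"
    by (intro divide_right_mono) auto
  thus "norm ((1 + real m) / fact m * y ^ m) \<le> inverse (fact m) * (2 * \<bar>y\<bar>) ^ m"
    by (simp add: abs_mult power_abs power_mult_distrib divide_inverse mult_ac)
qed

lemma summable_egf:
  assumes "lin_bounded a"
  shows "summable (\<lambda>m. a m / fact m * (y::real) ^ m)"
proof -
  from assms obtain C where C: "\<And>m. \<bar>a m\<bar> \<le> C * (1 + real m)"
    unfolding lin_bounded_def by blast
  show ?thesis
  proof (rule summable_comparison_test')
    show "summable (\<lambda>m. C * ((1 + real m) / fact m * \<bar>y\<bar> ^ m))"
      by (intro summable_mult summable_lin_exp)
    fix m :: nat assume "m \<ge> 0"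
    have "\<bar>a m\<bar> * (\<bar>y\<bar> ^ m / fact m) \<le> C * (1 + real m) * (\<bar>y\<bar> ^ m / fact m)"
      by (intro mult_right_mono C) auto
    thus "norm (a m / fact m * y ^ m) \<le> C * ((1 + real m) / fact m * \<bar>y\<bar> ^ m)"
      by (simp add: abs_mult power_abs field_simps)
  qed
qed

lemma lin_bounded_Suc:
  assumes "lin_bounded a"
  shows "lin_bounded (\<lambda>m. a (Suc m))"
proof -
  from assms obtain C where C: "\<And>m. \<bar>a m\<bar> \<le> C * (1 + real m)"
    unfolding lin_bounded_def by blast
  have "0 \<le> C" using C[of 0] by simp
  have "\<bar>a (Suc m)\<bar> \<le> (2 * C) * (1 + real m)" for m
  proof -
    have "C * (2 + real m) \<le> C * (2 * (1 + real m))"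
      using \<open>0 \<le> C\<close> by (intro mult_left_mono) auto
    thus ?thesis using C[of "Suc m"] by (simp add: algebra_simps)
  qed
  thus ?thesis by (rule lin_boundedI)
qed

lemma DERIV_egf:
  assumes "lin_bounded a"
  shows "(egf a has_real_derivative egf (\<lambda>m. a (Suc m)) y) (at y)"
proof -
  have "((\<lambda>y. \<Sum>m. a m / fact m * y ^ m) has_real_derivative
          (\<Sum>m. diffs (\<lambda>m. a m / fact m) m * y ^ m)) (at y)"
    by (intro termdiffs_strong_converges_everywhere summable_egf assms)
  moreover have "diffs (\<lambda>m. a m / fact m) m = a (Suc m) / fact m" for m
    by (simp add: diffs_def del: of_nat_Suc)
  ultimately show ?thesis by (simp add: egf_def[abs_def])
qed

lemma egf_0 [simp]: "egf a 0 = a 0"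
  unfolding egf_def by (subst powser_zero) simp

text \<open>As (1 + m) / m! <= 2, the exponential series dominates. B enters linearly: with B = (1 +
  n) / n! the estimate hands factorial decay on to the Bessel functions of order n.\<close>

lemma abs_egf_le:
  assumes "\<And>m. \<bar>a m\<bar> \<le> B * (1 + real m) / fact m"
  shows "\<bar>egf a y\<bar> \<le> 2 * B * exp \<bar>y\<bar>"
proof -
  have B: "0 \<le> B" using assms[of 0] by simp
  have le: "norm (a m / fact m * y ^ m) \<le> 2 * B * (\<bar>y\<bar> ^ m /\<^sub>R fact m)" for m
  proof -
    have "\<bar>a m\<bar> \<le> B * 2"
      using assms[of m] mult_left_mono[OF succ_over_fact_le[of m] B] by simp
    hence "\<bar>a m\<bar> * (\<bar>y\<bar> ^ m / fact m) \<le> B * 2 * (\<bar>y\<bar> ^ m / fact m)"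
      by (intro mult_right_mono) auto
    thus ?thesis by (simp add: abs_mult power_abs field_simps)
  qed
  have s: "(\<lambda>m. 2 * B * (\<bar>y\<bar> ^ m /\<^sub>R fact m)) sums (2 * B * exp \<bar>y\<bar>)"
    by (intro sums_mult exp_converges)
  have "norm (egf a y) \<le> (\<Sum>m. 2 * B * (\<bar>y\<bar> ^ m /\<^sub>R fact m))"
    unfolding egf_def by (rule norm_suminf_le[OF le sums_summable[OF s]])
  thus ?thesis using sums_unique[OF s] by simp
qed

subsection \<open>The reciprocal Gamma function and its derivative\<close>

lemma DERIV_rGamma: "(rGamma has_real_derivative deriv rGamma z) (at z)"
  using has_field_derivative_rGamma[of z UNIV] DERIV_imp_deriv by (metis)

text \<open>This is the derivative of rGamma z = z * rGamma (z + 1). Being free of Digamma, it holds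
  at the poles of Gamma too, where negative integer orders are differentiated.\<close>

lemma deriv_rGamma_rec: "deriv rGamma z = rGamma (z + 1) + z * deriv rGamma (z + (1::real))"
proof -
  have "((\<lambda>z. z * rGamma (z + 1)) has_real_derivative
          (1 * rGamma (z + 1) + (deriv rGamma (z + 1) * (1 + 0)) * z)) (at z)"
    by (intro DERIV_mult DERIV_ident DERIV_chain2[OF DERIV_rGamma] DERIV_add DERIV_const)
  hence "(rGamma has_real_derivative (rGamma (z + 1) + z * deriv rGamma (z + 1))) (at z)"
    by (simp add: rGamma_plus1 algebra_simps)
  thus ?thesis by (rule DERIV_imp_deriv)
qed

lemma deriv_rGamma_1: "deriv rGamma (1::real) = euler_mascheroni"
  using has_field_derivative_rGamma_no_nonpos_int[of "1::real" UNIV]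
  by (intro DERIV_imp_deriv) auto

text \<open>Compactness gives a constant on [1, 2]. A step from w >= 1 to w + 1 divides by w, so
  \<open>rGamma\<close> does not grow, and its derivative grows by at most C, whence the linear
  factor.\<close>

lemma rGamma_bounds_ge_1:
  "\<exists>C. \<forall>z\<ge>1. \<bar>rGamma z\<bar> \<le> C \<and> \<bar>deriv rGamma z\<bar> \<le> C * (1 + \<bar>z::real\<bar>)"
proof -
  have "compact ((\<lambda>z::real. rGamma z) ` {1..2})"
    by (intro compact_continuous_image continuous_on_rGamma) auto
  then obtain R where R: "\<And>z. z \<in> {1..2} \<Longrightarrow> \<bar>rGamma z\<bar> \<le> (R::real)"
    by (metis compact_imp_bounded bounded_iff imageI real_norm_def)
  have "compact ((\<lambda>z::real. - rGamma z * Digamma z) ` {1..2})"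
    by (intro compact_continuous_image continuous_on_rGamma continuous_intros
         continuous_on_Polygamma) (auto elim!: nonpos_Ints_cases)
  moreover have "deriv rGamma z = - rGamma z * Digamma z" if "z \<in> {1..2}" for z :: real
    using that by (intro DERIV_imp_deriv has_field_derivative_rGamma_no_nonpos_int)
      (auto elim!: nonpos_Ints_cases)
  ultimately obtain D where D: "\<And>z. z \<in> {1..2} \<Longrightarrow> \<bar>deriv rGamma z\<bar> \<le> (D::real)"
    by (metis (no_types, lifting) compact_imp_bounded bounded_iff imageI real_norm_def)
  define C where "C = max R D"
  have C0: "C \<ge> 0" using R[of 1] unfolding C_def by simp
  have "\<forall>z::real. 1 \<le> z \<and> z \<le> 2 + real n \<longrightarrow> \<bar>rGamma z\<bar> \<le> C \<and> \<bar>deriv rGamma z\<bar> \<le> C * (1 + z)" for n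
  proof (induction n)
    case 0
    have "C \<le> C * (1 + z)" if "z \<ge> 1" for z using C0 that by (simp add: algebra_simps)
    thus ?case using R D unfolding C_def by (fastforce)
  next
    case (Suc n)
    show ?case
    proof (intro allI impI, elim conjE)
      fix z :: real assume z: "1 \<le> z" "z \<le> 2 + real (Suc n)"
      show "\<bar>rGamma z\<bar> \<le> C \<and> \<bar>deriv rGamma z\<bar> \<le> C * (1 + z)"
      proof (cases "z \<le> 2 + real n")
        case True thus ?thesis using Suc z by blast
      next
        case False
        define w where "w = z - 1"
        have w: "w \<ge> 1" "w \<le> 2 + real n" "z = w + 1" using False z unfolding w_def by auto
        have IH: "\<bar>rGamma w\<bar> \<le> C" "\<bar>deriv rGamma w\<bar> \<le> C * (1 + w)" using Suc w by auto
        have r: "rGamma z = rGamma w / w" using rGamma_plus1[of w] w by (simp add: field_simps)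
        have "\<bar>rGamma z\<bar> = \<bar>rGamma w\<bar> / w" using w r by simp
        also have "\<dots> \<le> \<bar>rGamma w\<bar> / 1" using w by (intro divide_left_mono) auto
        finally have a: "\<bar>rGamma z\<bar> \<le> C" using IH by simp
        have "deriv rGamma z = (deriv rGamma w - rGamma z) / w"
          using deriv_rGamma_rec[of w] w by (simp add: field_simps)
        hence "\<bar>deriv rGamma z\<bar> = \<bar>deriv rGamma w - rGamma z\<bar> / w" using w by simp
        also have "\<dots> \<le> \<bar>deriv rGamma w - rGamma z\<bar> / 1" using w by (intro divide_left_mono) auto
        also have "\<dots> \<le> C * (1 + w) + C" using IH(2) a abs_triangle_ineq4[of "deriv rGamma w" "rGamma z"] by simp
        finally show ?thesis using a w by (simp add: algebra_simps)
      qed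
    qed
  qed
  hence "\<bar>rGamma z\<bar> \<le> C \<and> \<bar>deriv rGamma z\<bar> \<le> C * (1 + \<bar>z\<bar>)" if "z \<ge> 1" for z :: real
    using that real_arch_simple[of z] by (smt (verit) of_nat_0_le_iff)
  thus ?thesis by blast
qed

lemma rGamma_bounds:
  "\<exists>C. \<forall>z\<ge>1 - real k. \<bar>rGamma z\<bar> \<le> C \<and> \<bar>deriv rGamma z\<bar> \<le> C * (1 + \<bar>z\<bar>)"
proof (induction k)
  case 0 thus ?case using rGamma_bounds_ge_1 by simp
next
  case (Suc k)
  then obtain C where C: "\<And>z. z \<ge> 1 - real k \<Longrightarrow> \<bar>rGamma z\<bar> \<le> C"
     "\<And>z. z \<ge> 1 - real k \<Longrightarrow> \<bar>deriv rGamma z\<bar> \<le> C * (1 + \<bar>z\<bar>)" by blast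
  have C0: "C \<ge> 0" using C(1)[of "1 - real k"] by simp
  \<comment> \<open>The second summand bounds \<open>z * rGamma (z + 1)\<close> for |z| <= k + 2,
    the third the product \<open>z * deriv rGamma (z + 1)\<close> in the recursion.\<close>
  define B where "B = C + C * (real k + 2) + C * (real k + 2) * (real k + 3)"
  have CB: "C \<le> B" using C0 unfolding B_def by simp
  have "\<bar>rGamma z\<bar> \<le> B \<and> \<bar>deriv rGamma z\<bar> \<le> B * (1 + \<bar>z\<bar>)" if z: "z \<ge> 1 - real (Suc k)" for z
  proof (cases "z \<ge> 1 - real k")
    case True
    have "C * (1 + \<bar>z\<bar>) \<le> B * (1 + \<bar>z\<bar>)" using CB by (intro mult_right_mono) auto
    thus ?thesis using C(1)[OF True] C(2)[OF True] CB by linarith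
  next
    case False
    have w: "z + 1 \<ge> 1 - real k" using z by simp
    have az: "\<bar>z\<bar> \<le> real k + 2" "\<bar>z + 1\<bar> \<le> real k + 2" using False z by auto
    have "\<bar>rGamma z\<bar> = \<bar>z\<bar> * \<bar>rGamma (z + 1)\<bar>" by (metis abs_mult rGamma_plus1)
    also have "\<dots> \<le> (real k + 2) * C" using az C(1)[OF w] by (intro mult_mono) auto
    also have "\<dots> \<le> B"
    proof -
      have "0 \<le> C * (real k + 2) * (real k + 3)" using C0 by simp
      thus ?thesis using C0 unfolding B_def by (simp add: mult.commute)
    qed
    finally have 1: "\<bar>rGamma z\<bar> \<le> B" .
    have "C * (1 + \<bar>z + 1\<bar>) \<le> C * (real k + 3)" using C0 az by (intro mult_left_mono) auto
    hence "\<bar>deriv rGamma (z + 1)\<bar> \<le> C * (real k + 3)" using C(2)[OF w] by linarith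
    hence "\<bar>z\<bar> * \<bar>deriv rGamma (z + 1)\<bar> \<le> (real k + 2) * (C * (real k + 3))"
      using az by (intro mult_mono) auto
    moreover have "\<bar>deriv rGamma z\<bar> \<le> \<bar>rGamma (z + 1)\<bar> + \<bar>z\<bar> * \<bar>deriv rGamma (z + 1)\<bar>"
      by (subst deriv_rGamma_rec) (simp flip: abs_mult)
    moreover have "0 \<le> C * (real k + 2)" using C0 by simp
    ultimately have "\<bar>deriv rGamma z\<bar> \<le> C + C * (real k + 2) + (real k + 2) * (C * (real k + 3))"
      using C(1)[OF w] by linarith
    hence "\<bar>deriv rGamma z\<bar> \<le> B" unfolding B_def by (simp add: mult_ac)
    moreover have "B * 1 \<le> B * (1 + \<bar>z\<bar>)" using C0 CB by (intro mult_left_mono) auto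
    ultimately show ?thesis using 1 by simp
  qed
  thus ?case by blast
qed

text \<open>Uniformity over |p| <= K is the point: it provides the majorant for differentiating the
  power series in the order.\<close>

lemma rGamma_shift_bounds:
  "\<exists>C. \<forall>p m. \<bar>p\<bar> \<le> K \<longrightarrow> \<bar>rGamma (p + real m + 1)\<bar> \<le> C * (1 + real m) \<and>
     \<bar>deriv rGamma (p + real m + 1)\<bar> \<le> C * (1 + real m)"
proof -
  obtain k where k: "K \<le> real k" using real_arch_simple by blast
  obtain C where C: "\<And>z. z \<ge> 1 - real k \<Longrightarrow> \<bar>rGamma z\<bar> \<le> C"
     "\<And>z. z \<ge> 1 - real k \<Longrightarrow> \<bar>deriv rGamma z\<bar> \<le> C * (1 + \<bar>z\<bar>)" using rGamma_bounds[of k] by blast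
  have C0: "C \<ge> 0" using C(1)[of "1 - real k"] by simp
  define B where "B = C * (real k + 2)"
  have "\<bar>rGamma (p + real m + 1)\<bar> \<le> B * (1 + real m) \<and> \<bar>deriv rGamma (p + real m + 1)\<bar> \<le> B * (1 + real m)"
    if p: "\<bar>p\<bar> \<le> K" for p m
  proof
    have z: "p + real m + 1 \<ge> 1 - real k" using k p by linarith
    have "C * 1 \<le> C * ((real k + 2) * (1 + real m))"
      using C0 by (intro mult_left_mono) (auto simp: algebra_simps)
    thus "\<bar>rGamma (p + real m + 1)\<bar> \<le> B * (1 + real m)"
      using C(1)[OF z] unfolding B_def by (simp add: mult.assoc)
    have "1 + \<bar>p + real m + 1\<bar> \<le> (real k + 2) + real m" using p k by linarith
    also have "\<dots> \<le> (real k + 2) * (1 + real m)" by (simp add: algebra_simps)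
    finally have "C * (1 + \<bar>p + real m + 1\<bar>) \<le> C * ((real k + 2) * (1 + real m))"
      using C0 by (intro mult_left_mono) auto
    thus "\<bar>deriv rGamma (p + real m + 1)\<bar> \<le> B * (1 + real m)"
      using C(2)[OF z] unfolding B_def by (simp add: algebra_simps)
  qed
  thus ?thesis by blast
qed

lemma rGamma_nat: "rGamma (real n + 1) = 1 / fact n"
  using Gamma_fact[of n, where 'a = real] by (simp add: rGamma_inverse_Gamma field_simps)

text \<open>The derivative at n + 1 equals (gamma - H_n) / n! with H_n the harmonic number. Unlike
  the general bounds this one decays factorially, which the limit n -> infinity in the order
  requires.\<close>

lemma abs_deriv_rGamma_nat: "\<bar>deriv rGamma (real n + 1)\<bar> \<le> (1 + real n) / fact n"
proof (induction n)
  case 0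
  show ?case using euler_mascheroni_less_13_over_22 euler_mascheroni_pos
    by (simp add: deriv_rGamma_1)
next
  case (Suc n)
  have "deriv rGamma (real n + 1 + 1) = (deriv rGamma (real n + 1) - rGamma (real (Suc n) + 1)) / (real n + 1)"
    using deriv_rGamma_rec[of "real n + 1"] by (simp add: field_simps)
  hence "\<bar>deriv rGamma (real n + 1 + 1)\<bar> = \<bar>deriv rGamma (real n + 1) - 1 / fact (Suc n)\<bar> / (real n + 1)"
    unfolding rGamma_nat by simp
  also have "\<dots> \<le> ((1 + real n) / fact n + 1 / fact (Suc n)) / (real n + 1)"
    using Suc abs_triangle_ineq4[of "deriv rGamma (real n + 1)" "1 / fact (Suc n)"]
    by (intro divide_right_mono) (auto simp del: fact_Suc)
  also have "\<dots> \<le> (2 + real n) / fact (Suc n)"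
  proof -
    have "((1 + real n) / fact n + 1 / fact (Suc n)) / (real n + 1)
       = ((1 + real n) ^ 2 + 1) / ((1 + real n) * fact (Suc n))"
      by (simp add: divide_simps power2_eq_square)
    also have "\<dots> \<le> ((2 + real n) * (1 + real n)) / ((1 + real n) * fact (Suc n))"
      by (intro divide_right_mono) (auto simp: power2_eq_square algebra_simps)
    also have "\<dots> = (2 + real n) / fact (Suc n)" by (simp add: divide_simps)
    finally show ?thesis .
  qed
  finally show ?case by (simp add: add_ac)
qed

subsection \<open>Bessel functions of the first kind and their derivative in the order\<close>

definition rGamma_seq :: "real \<Rightarrow> nat \<Rightarrow> real" where
  "rGamma_seq p m = rGamma (p + real m + 1)"

definition deriv_rGamma_seq :: "real \<Rightarrow> nat \<Rightarrow> real" where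
  "deriv_rGamma_seq p m = deriv rGamma (p + real m + 1)"

text \<open>The Bessel-Clifford function at -(x/2)^2, the entire factor left of J_p once (x/2)^p is
  split off.\<close>

definition bessel_E :: "real \<Rightarrow> real \<Rightarrow> real" where
  "bessel_E p x = egf (rGamma_seq p) (- ((x / 2)\<^sup>2))"

definition bessel_E_order :: "real \<Rightarrow> real \<Rightarrow> real" where
  "bessel_E_order p x = egf (deriv_rGamma_seq p) (- ((x / 2)\<^sup>2))"

lemma lin_bounded_rGamma_seq: "lin_bounded (rGamma_seq p)" "lin_bounded (deriv_rGamma_seq p)"
proof -
  obtain C where "\<forall>q m. \<bar>q\<bar> \<le> \<bar>p\<bar> \<longrightarrow> \<bar>rGamma (q + real m + 1)\<bar> \<le> C * (1 + real m) \<and>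
    \<bar>deriv rGamma (q + real m + 1)\<bar> \<le> C * (1 + real m)"
    using rGamma_shift_bounds by blast
  thus "lin_bounded (rGamma_seq p)" "lin_bounded (deriv_rGamma_seq p)"
    by (auto intro!: lin_boundedI[of _ C] simp: rGamma_seq_def deriv_rGamma_seq_def)
qed

lemma rGamma_seq_Suc: "rGamma_seq p (Suc m) = rGamma_seq (p + 1) m"
  "deriv_rGamma_seq p (Suc m) = deriv_rGamma_seq (p + 1) m"
  by (simp_all add: add_ac rGamma_seq_def deriv_rGamma_seq_def)

text \<open>Termwise differentiation in the order; the Weierstrass test applies on the unit ball
  around p by \<open>rGamma_shift_bounds\<close>.\<close>

lemma DERIV_egf_rGamma_order:
  "((\<lambda>p. egf (rGamma_seq p) y) has_real_derivative egf (deriv_rGamma_seq p) y) (at p)"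
proof -
  obtain C where C: "\<forall>q m. \<bar>q\<bar> \<le> \<bar>p\<bar> + 1 \<longrightarrow> \<bar>rGamma (q + real m + 1)\<bar> \<le> C * (1 + real m) \<and>
    \<bar>deriv rGamma (q + real m + 1)\<bar> \<le> C * (1 + real m)"
    using rGamma_shift_bounds by blast
  have "((\<lambda>p. \<Sum>m. rGamma (p + real m + 1) / fact m * y ^ m) has_real_derivative
          (\<Sum>m. deriv rGamma (p + real m + 1) / fact m * y ^ m)) (at p)"
  proof (rule has_field_derivative_series'(2)[of "ball p 1" _ _ p])
    fix m :: nat and q :: real assume "q \<in> ball p 1"
    have "((\<lambda>p. rGamma (p + real m + 1)) has_real_derivative deriv rGamma (q + real m + 1) * (1 + 0 + 0)) (at q)"
      by (intro DERIV_chain2[OF DERIV_rGamma] DERIV_add DERIV_const DERIV_ident)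
    from DERIV_cmult_right[OF DERIV_cdivide[OF this, of "fact m"], of "y ^ m"]
    show "((\<lambda>p. rGamma (p + real m + 1) / fact m * y ^ m) has_real_derivative
           deriv rGamma (q + real m + 1) / fact m * y ^ m) (at q within ball p 1)"
      by (simp add: has_field_derivative_at_within)
  next
    show "uniformly_convergent_on (ball p 1) (\<lambda>n q. \<Sum>m<n. deriv rGamma (q + real m + 1) / fact m * y ^ m)"
    proof (rule Weierstrass_m_test')
      show "summable (\<lambda>m. C * ((1 + real m) / fact m * \<bar>y\<bar> ^ m))"
        by (intro summable_mult summable_lin_exp)
      fix m :: nat and q :: real assume "q \<in> ball p 1"
      hence "\<bar>q\<bar> \<le> \<bar>p\<bar> + 1" by (auto simp: dist_real_def)
      with C have "\<bar>deriv rGamma (q + real m + 1)\<bar> \<le> C * (1 + real m)" by blast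
      hence "\<bar>deriv rGamma (q + real m + 1)\<bar> * (\<bar>y\<bar> ^ m / fact m) \<le> C * (1 + real m) * (\<bar>y\<bar> ^ m / fact m)"
        by (intro mult_right_mono) auto
      thus "norm (deriv rGamma (q + real m + 1) / fact m * y ^ m) \<le> C * ((1 + real m) / fact m * \<bar>y\<bar> ^ m)"
        by (simp add: abs_mult power_abs mult_ac)
    qed
  next
    show "summable (\<lambda>m. rGamma (p + real m + 1) / fact m * y ^ m)"
      using summable_egf[OF lin_bounded_rGamma_seq(1)] by (simp add: rGamma_seq_def)
  qed auto
  thus ?thesis by (simp add: egf_def rGamma_seq_def deriv_rGamma_seq_def)
qed

lemma bessel_J_eq:
  assumes "x > 0"
  shows "bessel_J p x = (x / 2) powr p * bessel_E p x"
proof -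
  have "(- 1) ^ m * rGamma (p + real m + 1) / fact m * (x / 2) powr (p + 2 * real m)
      = (x / 2) powr p * (rGamma (p + real m + 1) / fact m * (- ((x / 2)\<^sup>2)) ^ m)" for m
  proof -
    have "(x / 2) powr (2 * real m) = ((x / 2)\<^sup>2) ^ m"
      using assms powr_realpow[of "x / 2" "2 * m"] by (simp add: power_mult)
    moreover have "(- ((x / 2)\<^sup>2)) ^ m = (- 1) ^ m * ((x / 2)\<^sup>2) ^ m"
      by (rule power_minus)
    ultimately show ?thesis by (simp add: powr_add)
  qed
  thus ?thesis unfolding bessel_J_def bessel_E_def egf_def rGamma_seq_def
    by (simp only: suminf_mult[OF summable_egf[OF lin_bounded_rGamma_seq(1), unfolded rGamma_seq_def]])
qed

text \<open>The derivative of J_p in p, by the product rule for (x/2)^p E_p. It is available at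
  every real order, so its recurrence can again come from differentiating in p.\<close>

definition bessel_J_order :: "real \<Rightarrow> real \<Rightarrow> real" where
  "bessel_J_order p x = (x / 2) powr p * (ln (x / 2) * bessel_E p x + bessel_E_order p x)"

lemma DERIV_bessel_J_order:
  assumes "x > 0"
  shows "((\<lambda>p. bessel_J p x) has_real_derivative bessel_J_order p x) (at p)"
proof -
  have "((\<lambda>p. bessel_E p x) has_real_derivative bessel_E_order p x) (at p)"
    unfolding bessel_E_def bessel_E_order_def by (rule DERIV_egf_rGamma_order)
  hence "((\<lambda>p. (x / 2) powr p * bessel_E p x) has_real_derivative bessel_J_order p x) (at p)"
    unfolding bessel_J_order_def using assms
    by (auto intro!: derivative_eq_intros simp: algebra_simps)
  thus ?thesis using bessel_J_eq[OF assms] by simp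
qed

lemma bessel_J_hat_eq: "x > 0 \<Longrightarrow> bessel_J_hat k x = bessel_J_order (of_int k) x"
  unfolding bessel_J_hat_def by (intro DERIV_imp_deriv DERIV_bessel_J_order)

lemma DERIV_egf_sq:
  assumes "lin_bounded a"
  shows "((\<lambda>x. egf a (- ((x / 2)\<^sup>2))) has_real_derivative
           - (x / 2) * egf (\<lambda>m. a (Suc m)) (- ((x / 2)\<^sup>2))) (at x)"
proof -
  have "((\<lambda>x. - ((x / 2)\<^sup>2)) has_real_derivative - (x / 2)) (at x)"
    by (auto intro!: derivative_eq_intros)
  from DERIV_chain2[OF DERIV_egf[OF assms] this] show ?thesis by (simp add: mult.commute)
qed

lemma DERIV_bessel_E: "(bessel_E p has_real_derivative - (x / 2) * bessel_E (p + 1) x) (at x)"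
  "(bessel_E_order p has_real_derivative - (x / 2) * bessel_E_order (p + 1) x) (at x)"
  unfolding bessel_E_def[abs_def] bessel_E_order_def[abs_def]
  using DERIV_egf_sq[OF lin_bounded_rGamma_seq(1)] DERIV_egf_sq[OF lin_bounded_rGamma_seq(2)]
  by (simp_all only: rGamma_seq_Suc)

lemma powr_succ_pred:
  assumes "x > 0"
  shows "(x / 2) powr (p + 1) = (x / 2) powr p * (x / 2)"
    "(x / 2) powr (p - 1) = (x / 2) powr p * 2 / (x::real)"
  using assms by (simp_all add: powr_add powr_diff)

lemma DERIV_bessel_J:
  assumes "x > 0"
  shows "(bessel_J p has_real_derivative p / x * bessel_J p x - bessel_J (p + 1) x) (at x)"
proof -
  note p1 = powr_succ_pred[OF assms]
  have "((\<lambda>x. (x / 2) powr p * bessel_E p x) has_real_derivative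
          p / x * bessel_J p x - bessel_J (p + 1) x) (at x)"
    using assms
    by (auto intro!: derivative_eq_intros DERIV_bessel_E
        simp: bessel_J_eq bessel_J_order_def p1) (simp add: field_simps)
  moreover have "eventually (\<lambda>x. x \<in> {0<..}) (nhds x)"
    using assms by (intro eventually_nhds_in_open) auto
  ultimately show ?thesis
    by (subst DERIV_cong_ev[OF refl _ refl]) (auto simp: bessel_J_eq elim!: eventually_mono)
qed

lemma DERIV_bessel_J_order_arg:
  assumes "x > 0"
  shows "(bessel_J_order p has_real_derivative
     p / x * bessel_J_order p x + bessel_J p x / x - bessel_J_order (p + 1) x) (at x)"
proof -
  note p1 = powr_succ_pred[OF assms]
  show ?thesis
    unfolding bessel_J_order_def[abs_def] using assms
    by (auto intro!: derivative_eq_intros DERIV_bessel_E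
        simp: bessel_J_eq bessel_J_order_def p1) (simp add: field_simps)
qed

text \<open>Coefficientwise this is rGamma z = z * rGamma (z + 1) at z = (p + 1) + m: the part p + 1
  gives the first summand, and the part m is y d/dy, which raises the order once more.\<close>

lemma egf_rGamma_rec: "egf (rGamma_seq p) y = (p + 1) * egf (rGamma_seq (p + 1)) y + y * egf (rGamma_seq (p + 2)) y"
proof -
  let ?a = "rGamma_seq (p + 1)"
  have lb: "lin_bounded ?a" by (rule lin_bounded_rGamma_seq)
  have s1: "(\<lambda>m. ?a m / fact m * y ^ m) sums egf ?a y"
    unfolding egf_def by (intro summable_sums summable_egf lb)
  have "(\<lambda>m. ?a (Suc m) / fact m * y ^ m) sums egf (\<lambda>m. ?a (Suc m)) y"
    unfolding egf_def by (intro summable_sums summable_egf lin_bounded_Suc lb)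
  hence "(\<lambda>m. y * (?a (Suc m) / fact m * y ^ m)) sums (y * egf (\<lambda>m. ?a (Suc m)) y)"
    by (rule sums_mult)
  \<comment> \<open>Multiplication by y moves the shifted series to the exponents m + 1, with weight
    m + 1. The series with weight m then has no term at m = 0.\<close>
  moreover have eq: "y * (?a (Suc m) / fact m * y ^ m) = real (Suc m) * ?a (Suc m) / fact (Suc m) * y ^ Suc m" for m
    by (simp add: field_simps del: of_nat_Suc)
  ultimately have "(\<lambda>m. real (Suc m) * ?a (Suc m) / fact (Suc m) * y ^ Suc m) sums (y * egf (\<lambda>m. ?a (Suc m)) y)"
    by (simp only: eq)
  hence s2: "(\<lambda>m. real m * ?a m / fact m * y ^ m) sums (y * egf (\<lambda>m. ?a (Suc m)) y)"
    by (subst (asm) sums_Suc_iff) simp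
  have "(\<lambda>m. (p + 1) * (?a m / fact m * y ^ m) + real m * ?a m / fact m * y ^ m) sums
      ((p + 1) * egf ?a y + y * egf (\<lambda>m. ?a (Suc m)) y)"
    by (intro sums_add sums_mult s1 s2)
  moreover have "(p + 1) * (?a m / fact m * y ^ m) + real m * ?a m / fact m * y ^ m
      = rGamma_seq p m / fact m * y ^ m" for m
  proof -
    have "rGamma_seq p m = (p + 1 + real m) * ?a m"
      using rGamma_plus1[of "p + real m + 1"] by (simp add: add_ac rGamma_seq_def)
    thus ?thesis by (simp add: field_simps)
  qed
  ultimately have "(\<lambda>m. rGamma_seq p m / fact m * y ^ m) sums
      ((p + 1) * egf ?a y + y * egf (\<lambda>m. ?a (Suc m)) y)" by simp
  thus ?thesis unfolding egf_def[of "rGamma_seq p"] rGamma_seq_Suc by (simp add: sums_iff add.commute)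
qed

lemma bessel_J_rec:
  assumes "x > 0"
  shows "bessel_J (p - 1) x + bessel_J (p + 1) x = 2 * p / x * bessel_J p x"
proof -
  note p1 = powr_succ_pred[OF assms]
  have E: "bessel_E (p - 1) x = p * bessel_E p x - (x / 2)\<^sup>2 * bessel_E (p + 1) x"
    using egf_rGamma_rec[of "p - 1" "- ((x / 2)\<^sup>2)"] by (simp add: bessel_E_def add.commute)
  show ?thesis using assms
    by (simp add: bessel_J_eq p1 E) (simp add: field_simps power2_eq_square)
qed

text \<open>Both sides of \<open>bessel_J_rec\<close> are differentiated in p. The inhomogeneous
  term comes from the factor 2 p / x.\<close>

lemma bessel_J_order_rec:
  assumes "x > 0"
  shows "bessel_J_order (p - 1) x + bessel_J_order (p + 1) x
     = 2 * p / x * bessel_J_order p x + 2 / x * bessel_J p x"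
proof -
  have d1: "((\<lambda>p. bessel_J (p - 1) x + bessel_J (p + 1) x) has_real_derivative
      bessel_J_order (p - 1) x * (1 - 0) + bessel_J_order (p + 1) x * (1 + 0)) (at p)"
    by (intro DERIV_add DERIV_chain2[OF DERIV_bessel_J_order[OF assms]] DERIV_diff DERIV_ident DERIV_const)
  have d2: "((\<lambda>p. 2 * p / x * bessel_J p x) has_real_derivative
      2 * p / x * bessel_J_order p x + 2 / x * bessel_J p x) (at p)"
    using assms by (auto intro!: derivative_eq_intros DERIV_bessel_J_order simp: field_simps)
  show ?thesis
    using DERIV_unique[OF d1[unfolded bessel_J_rec[OF assms]] d2] by simp
qed

subsection \<open>Integer orders\<close>

definition J_int :: "int \<Rightarrow> real \<Rightarrow> real" where
  "J_int k x = bessel_J (of_int k) x"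

definition J_ord :: "int \<Rightarrow> real \<Rightarrow> real" where
  "J_ord k x = bessel_J_order (of_int k) x"

definition Y_int :: "int \<Rightarrow> real \<Rightarrow> real" where
  "Y_int k x = bessel_Y (of_int k) x"

lemma minus_one_powi: "(-1::real) powi k = (if even k then 1 else - 1)"
  by (cases "even k") (auto simp: power_int_minus_left)

lemma J_int_rec: "x > 0 \<Longrightarrow> J_int (k - 1) x + J_int (k + 1) x = 2 * of_int k / x * J_int k x"
  using bessel_J_rec[of x "of_int k"] by (simp add: J_int_def)

lemma J_ord_rec: "x > 0 \<Longrightarrow>
    J_ord (k - 1) x + J_ord (k + 1) x = 2 * of_int k / x * J_ord k x + 2 / x * J_int k x"
  using bessel_J_order_rec[of x "of_int k"] by (simp add: J_int_def J_ord_def)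

lemma DERIV_J_int:
  "x > 0 \<Longrightarrow> (J_int k has_real_derivative of_int k / x * J_int k x - J_int (k + 1) x) (at x)"
  using DERIV_bessel_J[of x "of_int k"] by (simp add: J_int_def[abs_def])

lemma DERIV_J_ord:
  "x > 0 \<Longrightarrow> (J_ord k has_real_derivative
     of_int k / x * J_ord k x + J_int k x / x - J_ord (k + 1) x) (at x)"
  using DERIV_bessel_J_order_arg[of x "of_int k"] by (simp add: J_int_def[abs_def] J_ord_def[abs_def])

text \<open>The recurrence has second order, so two consecutive orders go through the induction. At
  order 0 it gives J_(-1) = - J_1.\<close>

lemma J_int_neg_nat:
  assumes "x > 0"
  shows "J_int (- int n) x = (-1) ^ n * J_int (int n) x \<and>
         J_int (- int (Suc n)) x = (-1) ^ Suc n * J_int (int (Suc n)) x"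
proof (induction n)
  case 0
  show ?case using J_int_rec[OF assms, of 0] by simp
next
  case (Suc n)
  have "J_int (- int (Suc (Suc n))) x + J_int (- int n) x = 2 * - (real n + 1) / x * J_int (- int (Suc n)) x"
    using J_int_rec[OF assms, of "- int (Suc n)"] by (simp add: algebra_simps)
  moreover have "J_int (int n) x + J_int (int (Suc (Suc n))) x = 2 * (real n + 1) / x * J_int (int (Suc n)) x"
    using J_int_rec[OF assms, of "int (Suc n)"] by (simp add: algebra_simps)
  hence *: "J_int (int (Suc (Suc n))) x = 2 * (real n + 1) / x * J_int (int (Suc n)) x - J_int (int n) x"
    by simp
  ultimately have "J_int (- int (Suc (Suc n))) x
      = (-1) ^ n * (2 * (real n + 1) / x * J_int (int (Suc n)) x - J_int (int n) x)"
    using Suc by (simp add: algebra_simps del: of_nat_Suc)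
  with * show ?case using Suc by simp
qed

lemma J_int_neg:
  assumes "x > 0"
  shows "J_int (- k) x = (-1) powi k * J_int k x"
proof (cases k)
  case (nonneg n)
  thus ?thesis using J_int_neg_nat[OF assms, of n] by (simp add: minus_one_powi)
next
  case (neg n)
  thus ?thesis using J_int_neg_nat[OF assms, of "Suc n"] by (auto simp: minus_one_powi add.commute)
qed

text \<open>At an integer the quotient defining Y is 0/0, the numerator vanishing by
  \<open>J_int_neg\<close>. Dividing numerator and denominator by q - k turns both into difference
  quotients, whose limits are the derivatives in the order.\<close>

lemma Y_int_eq:
  assumes "x > 0"
  shows "Y_int k x = (J_ord k x + (-1) powi k * J_ord (- k) x) / pi"
proof -
  define c where "c = ((-1::real) powi k)"
  have cc: "cos (of_int k * pi) = c" "sin (of_int k * pi) = 0"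
    using cos_npi_int[of k] sin_npi_int[of k]
    by (auto simp: c_def minus_one_powi mult.commute)
  have c2: "c = 1 \<or> c = - 1" by (simp add: c_def minus_one_powi)
  define N where "N = (\<lambda>q. bessel_J q x * cos (q * pi) - bessel_J (- q) x)"
  have "(N has_real_derivative (J_ord k x * c + J_ord (- k) x)) (at (of_int k))"
  proof -
    have "((\<lambda>q. bessel_J (- q) x) has_real_derivative bessel_J_order (- of_int k) x * (- 1)) (at (of_int k))"
      by (intro DERIV_chain2[OF DERIV_bessel_J_order[OF assms]] DERIV_minus DERIV_ident)
    thus ?thesis unfolding N_def
      by (auto intro!: derivative_eq_intros DERIV_bessel_J_order assms simp: cc J_ord_def)
  qed
  moreover have "N (of_int k) = 0"
    using J_int_neg[OF assms, of k] by (simp add: N_def cc J_int_def c_def)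
  ultimately have 1: "((\<lambda>q. N q / (q - of_int k)) \<longlongrightarrow> J_ord k x * c + J_ord (- k) x) (at (of_int k))"
    by (simp add: has_field_derivative_iff)
  have "((\<lambda>q. sin (q * pi)) has_real_derivative c * pi) (at (of_int k))"
    by (auto intro!: derivative_eq_intros simp: cc)
  hence 2: "((\<lambda>q. sin (q * pi) / (q - of_int k)) \<longlongrightarrow> c * pi) (at (of_int k))"
    by (simp add: has_field_derivative_iff cc)
  have "((\<lambda>q. (N q / (q - of_int k)) / (sin (q * pi) / (q - of_int k))) \<longlongrightarrow>
     (J_ord k x * c + J_ord (- k) x) / (c * pi)) (at (of_int k))"
    using c2 by (intro tendsto_divide 1 2) auto
  moreover have "(J_ord k x * c + J_ord (- k) x) / (c * pi) = (J_ord k x + c * J_ord (- k) x) / pi"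
    using c2 by (auto simp: field_simps)
  moreover have "eventually (\<lambda>q. (N q / (q - of_int k)) / (sin (q * pi) / (q - of_int k)) = N q / sin (q * pi)) (at (of_int k))"
    by (auto simp: eventually_at_filter)
  ultimately have "((\<lambda>q. N q / sin (q * pi)) \<longlongrightarrow> (J_ord k x + c * J_ord (- k) x) / pi) (at (of_int k))"
    by (auto intro: Lim_transform_eventually)
  thus ?thesis unfolding Y_int_def bessel_Y_def Let_def N_def c_def
    by (simp add: tendsto_Lim)
qed

lemma Y_int_neg: "x > 0 \<Longrightarrow> Y_int (- k) x = (-1) powi k * Y_int k x"
  by (simp add: Y_int_eq minus_one_powi field_simps)

text \<open>The inhomogeneous terms 2/x J of \<open>J_ord_rec\<close> at k and at -k cancel, so Y
  satisfies the same homogeneous recurrence as J.\<close>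

lemma Y_int_rec:
  assumes "x > 0"
  shows "Y_int (k - 1) x + Y_int (k + 1) x = 2 * of_int k / x * Y_int k x"
proof -
  define c where "c = ((-1::real) powi k)"
  have c2: "c * (c * z) = z" for z by (simp add: c_def minus_one_powi)
  have c': "(-1) powi (k + 1) = - c" "(-1) powi (k - 1) = - c" by (auto simp: c_def minus_one_powi)
  have "pi * (Y_int (k - 1) x + Y_int (k + 1) x) =
     (J_ord (k - 1) x + J_ord (k + 1) x) - c * (J_ord (- k - 1) x + J_ord (- k + 1) x)"
    using assms by (simp add: Y_int_eq c' c_def[symmetric] add_divide_distrib[symmetric]) (simp add: algebra_simps)
  also have "\<dots> = 2 * of_int k / x * (J_ord k x + c * J_ord (- k) x)"
    unfolding J_ord_rec[OF assms] J_int_neg[OF assms, of k] c_def[symmetric]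
    by (simp add: c2 algebra_simps)
  also have "\<dots> = pi * (2 * of_int k / x * Y_int k x)"
    using assms by (simp add: Y_int_eq c_def)
  finally show ?thesis by (simp only: mult_cancel_left pi_neq_zero simp_thms)
qed

lemma DERIV_Y_int:
  assumes "x > 0"
  shows "(Y_int k has_real_derivative of_int k / x * Y_int k x - Y_int (k + 1) x) (at x)"
proof -
  define c where "c = ((-1::real) powi k)"
  have c2: "c * (c * z) = z" for z by (simp add: c_def minus_one_powi)
  have c': "(-1) powi (k + 1) = - c" "(-1) powi (k - 1) = - c" by (auto simp: c_def minus_one_powi)
  \<comment> \<open>Y_(k+1) involves the order -k - 1, whereas differentiation at order -k produces
    -k + 1; the recurrence trades one for the other.\<close>
  have r: "J_ord (- k + 1) x = 2 * - of_int k / x * J_ord (- k) x + 2 / x * (c * J_int k x) - J_ord (- k - 1) x"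
    using J_ord_rec[OF assms, of "- k"] J_int_neg[OF assms, of k] by (simp add: c_def)
  have "((\<lambda>x. (J_ord k x + c * J_ord (- k) x) / pi) has_real_derivative
     ((of_int k / x * J_ord k x + J_int k x / x - J_ord (k + 1) x)
      + c * (of_int (- k) / x * J_ord (- k) x + J_int (- k) x / x - J_ord (- k + 1) x)) / pi) (at x)"
    by (intro DERIV_cdivide DERIV_add DERIV_cmult DERIV_J_ord assms)
  also have "((of_int k / x * J_ord k x + J_int k x / x - J_ord (k + 1) x)
      + c * (of_int (- k) / x * J_ord (- k) x + J_int (- k) x / x - J_ord (- k + 1) x)) / pi
     = of_int k / x * Y_int k x - Y_int (k + 1) x"
  proof -
    have "(of_int k / x * J_ord k x + J_int k x / x - J_ord (k + 1) x)
      + c * (of_int (- k) / x * J_ord (- k) x + J_int (- k) x / x - J_ord (- k + 1) x)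
      = of_int k / x * (J_ord k x + c * J_ord (- k) x) - (J_ord (k + 1) x - c * J_ord (- k - 1) x)"
      unfolding r J_int_neg[OF assms, of k] c_def[symmetric]
      using assms c2[of "J_int k x"] by (simp add: field_simps)
    thus ?thesis using assms
      by (simp only: Y_int_eq c' c_def[symmetric]) (simp add: diff_divide_distrib add_divide_distrib distrib_left)
  qed
  finally have "((\<lambda>x. (J_ord k x + c * J_ord (- k) x) / pi) has_real_derivative
     of_int k / x * Y_int k x - Y_int (k + 1) x) (at x)" .
  thus ?thesis
    by (rule has_field_derivative_transform_within_open[of _ _ _ "{0<..}"])
       (use assms in \<open>auto simp: Y_int_eq c_def\<close>)
qed

subsection \<open>Telescoping the series\<close>

text \<open>From n! m! <= (n + m)! the coefficients split into a factor in n and a factor in m. The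
  resulting factorial decay in the order removes all boundary terms at infinity when the series
  telescope.\<close>

lemma J_int_J_ord_bounds:
  assumes "x > 0"
  shows "\<exists>K. \<forall>n::nat. \<bar>J_int n x\<bar> \<le> K * ((1 + real n) / fact n * (x / 2) ^ n) \<and>
    \<bar>J_ord n x\<bar> \<le> K * ((1 + real n) / fact n * (x / 2) ^ n)"
proof -
  define e where "e = exp ((x / 2)\<^sup>2)"
  define K where "K = 2 * e * (1 + \<bar>ln (x / 2)\<bar>)"
  have ff: "fact n * fact m \<le> (fact (n + m) :: real)" for n m :: nat
  proof -
    have "fact n * fact m \<le> (fact (n + m) :: nat)"
      by (intro dvd_imp_le fact_fact_dvd_fact) auto
    thus ?thesis by (metis of_nat_fact of_nat_le_iff of_nat_mult)
  qed
  have ff': "1 / fact (n + m) \<le> 1 / (fact n * fact m :: real)" for n m :: nat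
    by (intro divide_left_mono ff) auto
  have E1: "\<bar>bessel_E n x\<bar> \<le> 2 * ((1 + real n) / fact n) * e" for n :: nat
  proof -
    have "\<bar>rGamma_seq n m\<bar> \<le> (1 + real n) / fact n * (1 + real m) / fact m" for m
    proof -
      have "\<bar>rGamma_seq n m\<bar> = 1 / fact (n + m)"
        using rGamma_nat[of "n + m"] by (simp add: rGamma_seq_def)
      also have "\<dots> \<le> 1 / (fact n * fact m)" by (rule ff')
      also have "\<dots> \<le> ((1 + real n) * (1 + real m)) / (fact n * fact m)"
        by (intro divide_right_mono) (auto simp: algebra_simps)
      finally show ?thesis by simp
    qed
    from abs_egf_le[OF this, of "- ((x / 2)\<^sup>2)"] show ?thesis
      unfolding bessel_E_def e_def by simp
  qed
  have E2: "\<bar>bessel_E_order n x\<bar> \<le> 2 * ((1 + real n) / fact n) * e" for n :: nat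
  proof -
    have "\<bar>deriv_rGamma_seq n m\<bar> \<le> (1 + real n) / fact n * (1 + real m) / fact m" for m
    proof -
      have "\<bar>deriv_rGamma_seq n m\<bar> \<le> (1 + real (n + m)) * (1 / fact (n + m))"
        using abs_deriv_rGamma_nat[of "n + m"] by (simp add: deriv_rGamma_seq_def)
      also have "\<dots> \<le> ((1 + real n) * (1 + real m)) * (1 / (fact n * fact m))"
        by (intro mult_mono ff') (auto simp: algebra_simps)
      finally show ?thesis by simp
    qed
    from abs_egf_le[OF this, of "- ((x / 2)\<^sup>2)"] show ?thesis
      unfolding bessel_E_order_def e_def by simp
  qed
  have pw: "(x / 2) powr real n = (x / 2) ^ n" for n using assms by (simp add: powr_realpow)
  show ?thesis
  proof (intro exI[of _ K] allI conjI)
    fix n :: nat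
    define B where "B = 2 * ((1 + real n) / fact n) * e"
    have B0: "B \<ge> 0" unfolding B_def e_def by simp
    have KB: "K * ((1 + real n) / fact n * (x / 2) ^ n) = (x / 2) ^ n * (\<bar>ln (x / 2)\<bar> * B + B)"
    proof -
      have "2 * e * (1 + l) * (q * r) = r * (l * (2 * q * e) + 2 * q * e)" for l q r :: real
        by (simp add: algebra_simps)
      thus ?thesis unfolding K_def B_def .
    qed
    have "\<bar>bessel_E n x\<bar> \<le> B + \<bar>ln (x / 2)\<bar> * B"
      using E1[of n] B0 mult_nonneg_nonneg[OF abs_ge_zero B0, of "ln (x / 2)"]
      unfolding B_def[symmetric] by linarith
    hence "(x / 2) ^ n * \<bar>bessel_E n x\<bar> \<le> (x / 2) ^ n * (B + \<bar>ln (x / 2)\<bar> * B)"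
      using assms by (intro mult_left_mono) auto
    thus "\<bar>J_int n x\<bar> \<le> K * ((1 + real n) / fact n * (x / 2) ^ n)"
      using assms KB by (simp add: J_int_def bessel_J_eq pw abs_mult add.commute)
    have "\<bar>ln (x / 2) * bessel_E n x + bessel_E_order n x\<bar>
        \<le> \<bar>ln (x / 2)\<bar> * \<bar>bessel_E n x\<bar> + \<bar>bessel_E_order n x\<bar>"
      by (simp flip: abs_mult)
    also have "\<dots> \<le> \<bar>ln (x / 2)\<bar> * B + B"
      using E1[of n] E2[of n] unfolding B_def by (intro add_mono mult_left_mono) auto
    finally have "(x / 2) ^ n * \<bar>ln (x / 2) * bessel_E n x + bessel_E_order n x\<bar>
        \<le> (x / 2) ^ n * (\<bar>ln (x / 2)\<bar> * B + B)"
      using assms by (intro mult_left_mono) auto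
    thus "\<bar>J_ord n x\<bar> \<le> K * ((1 + real n) / fact n * (x / 2) ^ n)"
      using assms KB by (simp add: J_ord_def bessel_J_order_def pw abs_mult)
  qed
qed

lemma J_int_J_ord_tendsto_0:
  assumes "x > 0"
  shows "(\<lambda>n. J_int (int n + k) x) \<longlonglongrightarrow> 0" "(\<lambda>n. J_ord (int n + k) x) \<longlonglongrightarrow> 0"
proof -
  obtain K where K: "\<forall>n::nat. \<bar>J_int n x\<bar> \<le> K * ((1 + real n) / fact n * (x / 2) ^ n) \<and>
    \<bar>J_ord n x\<bar> \<le> K * ((1 + real n) / fact n * (x / 2) ^ n)"
    using J_int_J_ord_bounds[OF assms] by blast
  have 0: "(\<lambda>n. K * ((1 + real n) / fact n * (x / 2) ^ n)) \<longlonglongrightarrow> 0"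
    using tendsto_mult_right_zero[OF summable_LIMSEQ_zero[OF summable_lin_exp]] by blast
  have 1: "(\<lambda>n. J_int (int n) x) \<longlonglongrightarrow> 0" "(\<lambda>n. J_ord (int n) x) \<longlonglongrightarrow> 0"
    by (rule tendsto_rabs_zero_cancel, rule tendsto_sandwich[OF _ _ tendsto_const 0],
        use K in \<open>auto intro!: always_eventually\<close>)+
  \<comment> \<open>For small n the index n + k may be negative, where \<open>nat\<close> truncates
    to 0; from n >= |k| on nothing is lost.\<close>
  have "filterlim (\<lambda>n. nat (int n + k)) sequentially sequentially"
  proof (rule filterlim_at_top_mono)
    show "filterlim (\<lambda>n. n - nat \<bar>k\<bar>) sequentially sequentially"
      by (rule filterlim_minus_const_nat_at_top)
  qed (auto intro!: always_eventually)
  from filterlim_compose[OF 1(1) this] filterlim_compose[OF 1(2) this]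
  have 2: "(\<lambda>n. J_int (int (nat (int n + k))) x) \<longlonglongrightarrow> 0" "(\<lambda>n. J_ord (int (nat (int n + k))) x) \<longlonglongrightarrow> 0"
    by simp_all
  have ev: "eventually (\<lambda>n. int (nat (int n + k)) = int n + k) sequentially"
    using eventually_ge_at_top[of "nat \<bar>k\<bar>"] by eventually_elim auto
  show "(\<lambda>n. J_int (int n + k) x) \<longlonglongrightarrow> 0"
    by (rule Lim_transform_eventually[OF 2(1)]) (use ev in eventually_elim, simp)
  show "(\<lambda>n. J_ord (int n + k) x) \<longlonglongrightarrow> 0"
    by (rule Lim_transform_eventually[OF 2(2)]) (use ev in eventually_elim, simp)
qed

text \<open>
  \<open>JD x k l\<close> is the derivative of \<open>J\<^bsub>k+s\<^esub> x * J\<^bsub>l+s\<^esub> x\<close> with respect to \<open>s\<close> at \<open>s = 0\<close>.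
\<close>

definition JD :: "real \<Rightarrow> int \<Rightarrow> int \<Rightarrow> real" where
  "JD x k l = J_ord k x * J_int l x + J_int k x * J_ord l x"

text \<open>The bracket <k,l> of the overview.\<close>

definition JY :: "int \<Rightarrow> int \<Rightarrow> real \<Rightarrow> real" where
  "JY k l x = Y_int k x * J_int l x + J_int k x * Y_int l x"

lemma JD_sym: "JD x k l = JD x l k"
  by (simp add: JD_def)

text \<open>The recurrence at order l + s, multiplied by J_(k+s) and differentiated in s. The
  product of Bessel functions comes from the factor 2 (l + s) / x.\<close>

lemma JD_rec:
  assumes "x > 0"
  shows "JD x k (l + 1) = 2 * of_int l / x * JD x k l + 2 / x * J_int k x * J_int l x - JD x k (l - 1)"
proof -
  have a: "J_int (l + 1) x = 2 * of_int l / x * J_int l x - J_int (l - 1) x"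
    using J_int_rec[OF assms, of l] by simp
  have b: "J_ord (l + 1) x = 2 * of_int l / x * J_ord l x + 2 / x * J_int l x - J_ord (l - 1) x"
    using J_ord_rec[OF assms, of l] by simp
  show ?thesis unfolding JD_def a b by (simp add: algebra_simps)
qed

text \<open>Every Y in the result enters here: reflecting both orders negates D up to a sign and a
  bracket, so that the boundary terms for mu and -mu cancel except for brackets.\<close>

lemma JD_reflect:
  assumes "x > 0"
  shows "(-1) powi (k + l) * JD x (- k) (- l) = pi * JY k l x - JD x k l"
proof -
  have s: "(-1::real) powi (k + l) = (-1) powi k * (-1) powi l" by (simp add: power_int_add)
  have Y: "J_ord (- j) x = (-1) powi j * (pi * Y_int j x - J_ord j x)" for j
    by (simp add: Y_int_eq assms minus_one_powi)
  have c: "((-1::real) powi j) * ((-1) powi j * z) = z" for j z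
    by (simp add: minus_one_powi)
  show ?thesis unfolding s JD_def JY_def Y J_int_neg[OF assms]
    using c[of k] c[of l] by (simp add: algebra_simps)
qed

lemma JD_tendsto_0: "x > 0 \<Longrightarrow> (\<lambda>n. JD x (int n + k) (int n + l)) \<longlonglongrightarrow> 0"
  unfolding JD_def using J_int_J_ord_tendsto_0[of x]
  by (intro tendsto_add_zero tendsto_mult_zero) auto

lemma bessel_P_term_eq:
  assumes "x > 0"
  shows "bessel_P_term \<mu> x n = real n * (JD x (int n - \<mu>) (int n) + (-1) powi \<mu> * JD x (int n + \<mu>) (int n))"
  using assms by (simp add: bessel_P_term_def bessel_J_hat_eq JD_def J_int_def J_ord_def)

section \<open>Discrete antiderivatives of D(n - k, n) and n D(n - k, n)\<close>

lemma telescope_sums_int: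
  fixes Z :: "int \<Rightarrow> real"
  assumes "(\<lambda>n. Z (int n)) \<longlonglongrightarrow> 0"
  shows "(\<lambda>n. Z (int (Suc n)) - Z (int (Suc n) + 1)) sums Z 1"
  using telescope_sums'[of "\<lambda>n. Z (int (Suc n))" 0] LIMSEQ_Suc[OF assms] by (simp add: add_ac)

text \<open>Take \<open>JD_rec\<close> once in the order n and once in the order n - k and subtract.
  The inhomogeneous terms cancel and the coefficients leave 2n/x - 2(n - k)/x = 2k/x, hence the
  division by k.\<close>

definition JD_tele :: "real \<Rightarrow> int \<Rightarrow> int \<Rightarrow> real" where
  "JD_tele x k n = x / (2 * of_int k) * (JD x (n - k) (n - 1) - JD x (n - k - 1) n)"

lemma JD_tele_diff:
  assumes "x > 0" "k \<noteq> 0"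
  shows "JD_tele x k n - JD_tele x k (n + 1) = JD x (n - k) n"
proof -
  have 1: "JD x (n - k) (n + 1) = 2 * of_int n / x * JD x (n - k) n
      + 2 / x * J_int (n - k) x * J_int n x - JD x (n - k) (n - 1)"
    by (rule JD_rec[OF assms(1)])
  have 2: "JD x n (n - k + 1) = 2 * of_int (n - k) / x * JD x (n - k) n
      + 2 / x * J_int (n - k) x * J_int n x - JD x (n - k - 1) n"
    using JD_rec[OF assms(1), of n "n - k"] by (simp add: JD_sym mult_ac)
  have "JD x (n + 1 - k) n = JD x n (n - k + 1)"
    by (subst JD_sym) (simp add: algebra_simps)
  hence "JD_tele x k n - JD_tele x k (n + 1) = x / (2 * of_int k) *
     (JD x (n - k) (n - 1) - JD x (n - k - 1) n - (JD x n (n - k + 1) - JD x (n - k) (n + 1)))"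
    unfolding JD_tele_def by (simp add: right_diff_distrib)
  also have "\<dots> = x / (2 * of_int k) * (2 * of_int k / x * JD x (n - k) n)"
    unfolding 1 2 by (simp add: field_simps)
  finally show ?thesis using assms by simp
qed

lemma JD_tele_tendsto_0:
  assumes "x > 0"
  shows "(\<lambda>n. JD_tele x k (int n + i)) \<longlonglongrightarrow> 0"
proof -
  have "(\<lambda>n. x / (2 * of_int k) * (JD x (int n + (i - k)) (int n + (i - 1))
      - JD x (int n + (i - k - 1)) (int n + i))) \<longlonglongrightarrow> x / (2 * of_int k) * (0 - 0)"
    by (intro tendsto_intros JD_tendsto_0 assms)
  thus ?thesis by (simp add: JD_tele_def algebra_simps)
qed

text \<open>By \<open>JD_rec\<close>, n D(n - mu, n) is x/2 times D(n - mu, n - 1) + D(n - mu, n +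
  1), minus J_(n-mu) J_n. The two D have order differences mu - 1 and mu + 1, which explains the
  shifted arguments of \<open>JD_tele\<close>; the second line sums the product of Bessel
  functions.\<close>

definition weighted_tele :: "real \<Rightarrow> int \<Rightarrow> int \<Rightarrow> real" where
  "weighted_tele x \<mu> n = x / 2 * (JD_tele x (\<mu> - 1) (n - 1) + JD_tele x (\<mu> + 1) (n + 1))
     - x / (2 * of_int \<mu>) * (J_int (n - \<mu>) x * J_int (n - 1) x - J_int (n - \<mu> - 1) x * J_int n x)"

lemma weighted_tele_diff:
  assumes "x > 0" "\<mu> \<noteq> 0" "\<mu> \<noteq> 1" "\<mu> \<noteq> - 1"
  shows "weighted_tele x \<mu> n - weighted_tele x \<mu> (n + 1) = of_int n * JD x (n - \<mu>) n"
proof -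
  have 1: "JD_tele x (\<mu> - 1) (n - 1) - JD_tele x (\<mu> - 1) n = JD x (n - \<mu>) (n - 1)"
    using JD_tele_diff[OF assms(1), of "\<mu> - 1" "n - 1"] assms by simp
  have 2: "JD_tele x (\<mu> + 1) (n + 1) - JD_tele x (\<mu> + 1) (n + 2) = JD x (n - \<mu>) (n + 1)"
    using JD_tele_diff[OF assms(1), of "\<mu> + 1" "n + 1"] assms by (simp add: add_ac)
  have 3: "J_int (n + 1) x = 2 * of_int n / x * J_int n x - J_int (n - 1) x"
    "J_int (n - \<mu> + 1) x = 2 * of_int (n - \<mu>) / x * J_int (n - \<mu>) x - J_int (n - \<mu> - 1) x"
    using J_int_rec[OF assms(1), of n] J_int_rec[OF assms(1), of "n - \<mu>"] by simp_all
  \<comment> \<open>Cross multiplication of the two recurrences again, now for J itself.\<close>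
  have 4: "x / (2 * of_int \<mu>) * (J_int (n - \<mu>) x * J_int (n - 1) x - J_int (n - \<mu> - 1) x * J_int n x)
    - x / (2 * of_int \<mu>) * (J_int (n - \<mu> + 1) x * J_int n x - J_int (n - \<mu>) x * J_int (n + 1) x)
    = J_int (n - \<mu>) x * J_int n x"
    unfolding 3 using assms by (simp add: field_simps)
  have "n + 1 - \<mu> = n - \<mu> + 1" "n + 1 + 1 = n + 2" by simp_all
  hence "weighted_tele x \<mu> n - weighted_tele x \<mu> (n + 1)
     = x / 2 * (JD x (n - \<mu>) (n - 1) + JD x (n - \<mu>) (n + 1)) - J_int (n - \<mu>) x * J_int n x"
    unfolding weighted_tele_def 4[symmetric] 1[symmetric] 2[symmetric] by (simp add: algebra_simps)
  also have "\<dots> = of_int n * JD x (n - \<mu>) n"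
    unfolding JD_rec[OF assms(1)] using assms by (simp add: field_simps)
  finally show ?thesis .
qed

lemma weighted_tele_tendsto_0:
  assumes "x > 0"
  shows "(\<lambda>n. weighted_tele x \<mu> (int n)) \<longlonglongrightarrow> 0"
proof -
  have "(\<lambda>n. x / 2 * (JD_tele x (\<mu> - 1) (int n + (- 1)) + JD_tele x (\<mu> + 1) (int n + 1))
     - x / (2 * of_int \<mu>) * (J_int (int n + (- \<mu>)) x * J_int (int n + (- 1)) x
         - J_int (int n + (- \<mu> - 1)) x * J_int (int n + 0) x))
     \<longlonglongrightarrow> x / 2 * (0 + 0) - x / (2 * of_int \<mu>) * (0 * 0 - 0 * 0)"
    by (intro tendsto_intros JD_tele_tendsto_0 J_int_J_ord_tendsto_0 assms)
  thus ?thesis by (simp add: weighted_tele_def algebra_simps)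
qed

lemma JY_neg_1: "x > 0 \<Longrightarrow> JY k (- 1) x = - JY k 1 x"
  using J_int_neg[of x 1] Y_int_neg[of x 1] by (simp add: JY_def)

text \<open>The sum is the boundary value at n = 1 of the telescoping for mu plus (-1)^mu times the
  one for -mu. After reflection all D and all products J J cancel, and only brackets
  survive.\<close>

lemma bessel_P_sums:
  assumes "x > 0" "\<mu> \<noteq> 0" "\<mu> \<noteq> 1" "\<mu> \<noteq> - 1"
  shows "(\<lambda>n. bessel_P_term \<mu> x (Suc n)) sums ((-1) powi \<mu> * (pi * x / 4 *
     (x * ((JY \<mu> 0 x + JY (\<mu> + 1) 1 x) / (of_int \<mu> + 1) - (JY \<mu> 0 x - JY (\<mu> - 1) 1 x) / (of_int \<mu> - 1))
      - 2 * JY \<mu> 1 x)))"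
proof -
  define c where "c = ((-1::real) powi \<mu>)"
  have cc: "c * c = 1" by (simp add: c_def minus_one_powi)
  have cp: "(-1) powi (\<mu> - 1) = - c" "(-1) powi (\<mu> + - 1) = - c" by (auto simp: c_def minus_one_powi)
  have "bessel_P_term \<mu> x (Suc n) =
     (weighted_tele x \<mu> (int (Suc n)) - weighted_tele x \<mu> (int (Suc n) + 1)) +
     c * (weighted_tele x (- \<mu>) (int (Suc n)) - weighted_tele x (- \<mu>) (int (Suc n) + 1))" for n
    using assms by (subst (1 2) weighted_tele_diff) (auto simp: bessel_P_term_eq c_def algebra_simps)
  hence sums: "(\<lambda>n. bessel_P_term \<mu> x (Suc n)) sums (weighted_tele x \<mu> 1 + c * weighted_tele x (- \<mu>) 1)"
    using sums_add[OF telescope_sums_int[OF weighted_tele_tendsto_0[OF assms(1), of \<mu>]]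
        sums_mult[OF telescope_sums_int[OF weighted_tele_tendsto_0[OF assms(1), of "- \<mu>"]], of c]]
    by simp
  define m where "m = real_of_int \<mu>"
  have m: "m \<noteq> 0" "m + 1 \<noteq> 0" "m - 1 \<noteq> 0"
    using assms unfolding m_def by linarith+
  \<comment> \<open>Times (-1)^mu, the boundary terms of the half with mu become brackets plus terms
    that cancel against the half with -mu.\<close>
  have R1: "c * JD x (1 - \<mu>) (- 1) = pi * JY (\<mu> - 1) 1 x - JD x (\<mu> - 1) 1"
    using JD_reflect[OF assms(1), of "\<mu> - 1" 1] by (simp add: c_def)
  have R2: "c * JD x (- \<mu>) 0 = pi * JY \<mu> 0 x - JD x \<mu> 0"
    using JD_reflect[OF assms(1), of \<mu> 0] by (simp add: c_def)
  have R3: "c * JD x (- \<mu> - 1) 1 = - pi * JY (\<mu> + 1) 1 x - JD x (\<mu> + 1) (- 1)"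
    using JD_reflect[OF assms(1), of "\<mu> + 1" "- 1"] by (simp add: c_def JY_neg_1 assms)
  have R4: "c * JD x (- \<mu>) 1 = pi * JY \<mu> 1 x + JD x \<mu> (- 1)"
    using JD_reflect[OF assms(1), of \<mu> "- 1"] unfolding cp by (simp add: JY_neg_1 assms)
  have R5: "JD x \<mu> 1 = 2 / x * J_int \<mu> x * J_int 0 x - JD x \<mu> (- 1)"
    using JD_rec[OF assms(1), of \<mu> 0] by simp
  have R6: "c * J_int (1 - \<mu>) x = - J_int (\<mu> - 1) x" "c * J_int (- \<mu>) x = J_int \<mu> x"
    using J_int_neg[OF assms(1), of "\<mu> - 1"] J_int_neg[OF assms(1), of \<mu>] cc
    unfolding cp by (simp_all add: c_def[symmetric] flip: mult.assoc)
  have R7: "J_int (\<mu> + 1) x = 2 * m / x * J_int \<mu> x - J_int (\<mu> - 1) x"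
    using J_int_rec[OF assms(1), of \<mu>] by (simp add: m_def)
  \<comment> \<open>\<open>weighted_tele\<close> at 1 evaluates one \<open>JD_tele\<close> at 2;
    going back one step keeps the second order in {-1, 0, 1}.\<close>
  have F: "JD_tele x (\<mu> + 1) 2 = JD_tele x (\<mu> + 1) 1 - JD x (- \<mu>) 1"
     "JD_tele x (1 - \<mu>) 2 = JD_tele x (1 - \<mu>) 1 - JD x \<mu> 1"
    using JD_tele_diff[OF assms(1), of "\<mu> + 1" 1] JD_tele_diff[OF assms(1), of "1 - \<mu>" 1] assms by simp_all
  have T1: "c * weighted_tele x \<mu> 1 = x / 2 * (x / (2 * (m - 1)) * (c * JD x (1 - \<mu>) (- 1) - c * JD x (- \<mu>) 0)
     + x / (2 * (m + 1)) * (c * JD x (- \<mu>) 0 - c * JD x (- \<mu> - 1) 1) - c * JD x (- \<mu>) 1)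
     - x / (2 * m) * (c * J_int (1 - \<mu>) x * J_int 0 x - c * J_int (- \<mu>) x * J_int 1 x)"
  proof -
    have W: "weighted_tele x \<mu> 1 = x / 2 * (JD_tele x (\<mu> - 1) 0 + (JD_tele x (\<mu> + 1) 1 - JD x (- \<mu>) 1))
       - x / (2 * m) * (J_int (1 - \<mu>) x * J_int 0 x - J_int (- \<mu>) x * J_int 1 x)"
      by (simp add: weighted_tele_def F m_def)
    show ?thesis unfolding W by (simp add: JD_tele_def m_def algebra_simps)
  qed
  have T2: "weighted_tele x (- \<mu>) 1 = x / 2 * (x / (2 * (- m - 1)) * (JD x (\<mu> + 1) (- 1) - JD x \<mu> 0)
     + x / (2 * (1 - m)) * (JD x \<mu> 0 - JD x (\<mu> - 1) 1) - JD x \<mu> 1)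
     - x / (2 * - m) * (J_int (\<mu> + 1) x * J_int 0 x - J_int \<mu> x * J_int 1 x)"
  proof -
    have "weighted_tele x (- \<mu>) 1 = x / 2 * (JD_tele x (- \<mu> - 1) 0 + (JD_tele x (1 - \<mu>) 1 - JD x \<mu> 1))
       - x / (2 * - m) * (J_int (\<mu> + 1) x * J_int 0 x - J_int \<mu> x * J_int 1 x)"
      using F(2) by (simp add: weighted_tele_def m_def add.commute)
    thus ?thesis by (simp add: JD_tele_def m_def add.commute)
  qed
  define a b where "a = 1 / (m + 1)" and "b = 1 / (m - 1)"
  have ab: "x / (2 * (m - 1)) = x / 2 * b" "x / (2 * (m + 1)) = x / 2 * a"
     "x / (2 * (- m - 1)) = - x / 2 * a" "x / (2 * (1 - m)) = - x / 2 * b"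
    using m by (simp_all add: a_def b_def field_simps)
  \<comment> \<open>The products J J of both halves combine into - J_mu J_0, which in the sum is
    compensated by the inhomogeneous term of \<open>R5\<close>.\<close>
  have J: "x / (2 * m) * (- J_int (\<mu> - 1) x * J_int 0 x - J_int \<mu> x * J_int 1 x)
     + x / (2 * - m) * (J_int (\<mu> + 1) x * J_int 0 x - J_int \<mu> x * J_int 1 x) = - J_int \<mu> x * J_int 0 x"
    unfolding R7 using m assms by (simp add: field_simps)
  have "c * (weighted_tele x \<mu> 1 + c * weighted_tele x (- \<mu>) 1)
    = c * weighted_tele x \<mu> 1 + weighted_tele x (- \<mu>) 1"
    using cc by (simp add: algebra_simps flip: mult.assoc)
  also have "\<dots> = x / 2 * (x / 2 * b * (pi * JY (\<mu> - 1) 1 x - pi * JY \<mu> 0 x)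
       + x / 2 * a * (pi * JY \<mu> 0 x + pi * JY (\<mu> + 1) 1 x) - pi * JY \<mu> 1 x - 2 / x * J_int \<mu> x * J_int 0 x)
       + J_int \<mu> x * J_int 0 x"
    unfolding T1 T2 R1 R2 R3 R4 R5 R6 ab using J by (simp add: algebra_simps)
  also have "\<dots> = pi * x / 4 * (x * ((JY \<mu> 0 x + JY (\<mu> + 1) 1 x) * a - (JY \<mu> 0 x - JY (\<mu> - 1) 1 x) * b)
      - 2 * JY \<mu> 1 x)"
    using assms by (simp add: field_simps)
  finally have "c * (c * (weighted_tele x \<mu> 1 + c * weighted_tele x (- \<mu>) 1)) = c * (pi * x / 4 *
      (x * ((JY \<mu> 0 x + JY (\<mu> + 1) 1 x) * a - (JY \<mu> 0 x - JY (\<mu> - 1) 1 x) * b) - 2 * JY \<mu> 1 x))"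
    by (rule arg_cong)
  hence "weighted_tele x \<mu> 1 + c * weighted_tele x (- \<mu>) 1 = c * (pi * x / 4 *
      (x * ((JY \<mu> 0 x + JY (\<mu> + 1) 1 x) * a - (JY \<mu> 0 x - JY (\<mu> - 1) 1 x) * b) - 2 * JY \<mu> 1 x))"
    using cc by (simp only: mult.assoc[symmetric, of c c] mult_1_left)
  with sums show ?thesis
    by (simp only: c_def a_def b_def m_def times_divide_eq_right[of _ 1] mult_1_right)
qed

text \<open>The general formula would divide by mu - 1 = 0. Replacing n J_n in D(n - 1, n) - D(n +
  1, n) instead makes the mixed D(n - 1, n + 1) cancel and leaves D(n - 1, n - 1) - D(n + 1, n + 1),
  a telescoping of step two. This is why \<open>Z\<close> adds two neighbouring terms.\<close>

lemma bessel_P_sums_1: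
  assumes "x > 0"
  shows "(\<lambda>n. bessel_P_term 1 x (Suc n)) sums (pi * x / 4 * (JY 0 0 x + JY 1 1 x))"
proof -
  define Z where "Z n = x / 2 * (JD x (n - 1) (n - 1) + JD x n n) - J_int (n - 1) x * J_int n x" for n
  have step: "Z n - Z (n + 1) = of_int n * (JD x (n - 1) n - JD x (n + 1) n)" for n
  proof -
    have 1: "JD x (n - 1) (n + 1) = 2 * of_int n / x * JD x (n - 1) n
        + 2 / x * J_int (n - 1) x * J_int n x - JD x (n - 1) (n - 1)"
      by (rule JD_rec[OF assms])
    have 2: "JD x (n + 1) (n + 1) = 2 * of_int n / x * JD x (n + 1) n
        + 2 / x * J_int (n + 1) x * J_int n x - JD x (n + 1) (n - 1)"
      by (rule JD_rec[OF assms])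
    have "Z n - Z (n + 1) = x / 2 * (JD x (n - 1) (n - 1) - JD x (n + 1) (n + 1))
        - J_int n x * (J_int (n - 1) x - J_int (n + 1) x)"
      unfolding Z_def by (simp add: algebra_simps)
    also have "JD x (n - 1) (n - 1) = 2 * of_int n / x * JD x (n - 1) n
        + 2 / x * J_int (n - 1) x * J_int n x - JD x (n - 1) (n + 1)" using 1 by simp
    also have "x / 2 * (2 * of_int n / x * JD x (n - 1) n + 2 / x * J_int (n - 1) x * J_int n x
          - JD x (n - 1) (n + 1) - JD x (n + 1) (n + 1)) - J_int n x * (J_int (n - 1) x - J_int (n + 1) x)
        = of_int n * (JD x (n - 1) n - JD x (n + 1) n)"
      unfolding 2 JD_sym[of x "n + 1" "n - 1"] using assms by (simp add: field_simps)
    finally show ?thesis .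
  qed
  have "(\<lambda>n. x / 2 * (JD x (int n + (- 1)) (int n + (- 1)) + JD x (int n + 0) (int n + 0))
      - J_int (int n + (- 1)) x * J_int (int n + 0) x) \<longlonglongrightarrow> x / 2 * (0 + 0) - 0 * 0"
    by (intro tendsto_intros JD_tendsto_0 J_int_J_ord_tendsto_0 assms)
  hence "(\<lambda>n. Z (int n)) \<longlonglongrightarrow> 0" by (simp add: Z_def)
  from telescope_sums_int[OF this]
  have "(\<lambda>n. bessel_P_term 1 x (Suc n)) sums Z 1"
    unfolding step by (simp add: bessel_P_term_eq assms)
  moreover have "Z 1 = pi * x / 4 * (JY 0 0 x + JY 1 1 x)"
  proof -
    have o: "J_ord (- 1) x = 2 / x * J_int 0 x - J_ord 1 x"
      using J_ord_rec[OF assms, of 0] by simp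
    have Y0: "pi * Y_int 0 x = 2 * J_ord 0 x" using assms by (simp add: Y_int_eq)
    have Y1: "pi * Y_int 1 x = 2 * J_ord 1 x - 2 / x * J_int 0 x"
      using assms by (simp add: Y_int_eq o)
    have "pi * x / 4 * (JY 0 0 x + JY 1 1 x)
        = x / 2 * ((pi * Y_int 0 x) * J_int 0 x + (pi * Y_int 1 x) * J_int 1 x)"
      by (simp add: JY_def algebra_simps)
    also have "\<dots> = Z 1"
      unfolding Y0 Y1 Z_def JD_def using assms by (simp add: field_simps)
    finally show ?thesis by simp
  qed
  ultimately show ?thesis by simp
qed

section \<open>Recurrence and derivative of the brackets\<close>

lemma JY_sym: "JY k l x = JY l k x"
  by (simp add: JY_def)

lemma JY_rec: "x > 0 \<Longrightarrow> JY (k + 1) l x = 2 * of_int k / x * JY k l x - JY (k - 1) l x"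
  unfolding JY_def eq_diff_eq[THEN iffD2, OF J_int_rec[of x k, unfolded add.commute[of "J_int (k - 1) x"]]]
    eq_diff_eq[THEN iffD2, OF Y_int_rec[of x k, unfolded add.commute[of "Y_int (k - 1) x"]]]
  by (simp add: algebra_simps)

lemma DERIV_JY:
  assumes "x > 0"
  shows "(JY k l has_real_derivative
     of_int (k + l) / x * JY k l x - JY (k + 1) l x - JY k (l + 1) x) (at x)"
  unfolding JY_def[abs_def] using assms
  by (auto intro!: derivative_eq_intros DERIV_J_int DERIV_Y_int simp: field_simps)

subsection \<open>Laplace integrals\<close>

lemma integrable_Gamma_powr:
  fixes a :: real
  assumes "a > -1"
  shows "integrable lborel (\<lambda>u. indicator {0<..} u * (exp (- u) * u powr a))"
    "(\<integral>u. indicator {0<..} u * (exp (- u) * u powr a) \<partial>lborel) = Gamma (a + 1)"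
proof -
  have nn: "(\<integral>\<^sup>+u. ennreal (indicator {0<..} u * (exp (- u) * u powr a)) \<partial>lborel) = ennreal (Gamma (a + 1))"
  proof -
    have "(\<integral>\<^sup>+u. ennreal (indicator {0<..} u * (exp (- u) * u powr a)) \<partial>lborel)
       = (\<integral>\<^sup>+u. ennreal (indicator {0..} u * u powr (a + 1 - 1) / exp u) \<partial>lborel)"
      by (intro nn_integral_cong) (auto simp: indicator_def exp_minus field_simps)
    also have "\<dots> = ennreal (Gamma (a + 1))"
      using Gamma_conv_nn_integral_real[of "a + 1"] assms by simp
    finally show ?thesis .
  qed
  have m: "(\<lambda>u::real. indicator {0<..} u * (exp (- u) * u powr a)) \<in> borel_measurable lborel"
    by measurable
  show "integrable lborel (\<lambda>u. indicator {0<..} u * (exp (- u) * u powr a))"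
    by (rule integrableI_nonneg) (use m nn in auto)
  show "(\<integral>u. indicator {0<..} u * (exp (- u) * u powr a) \<partial>lborel) = Gamma (a + 1)"
    using assms by (intro integral_eq_nn_integral[OF m, THEN trans]) (auto simp: nn Gamma_real_nonneg)
qed

lemma Gamma_powr_scaled:
  fixes a x :: real
  assumes "a > -1" "x > 0"
  shows "set_integrable lborel {0<..} (\<lambda>u. exp (- x * u) * u powr a)"
    "(LINT u:{0<..}|lborel. exp (- x * u) * u powr a) = Gamma (a + 1) / x powr (a + 1)"
proof -
  let ?g = "\<lambda>u::real. indicator {0<..} u * (exp (- u) * u powr a)"
  have g: "?g (0 + x * u) = x powr a * (indicator {0<..} u *\<^sub>R (exp (- x * u) * u powr a))" for u
    using assms by (auto simp: indicator_def zero_less_mult_iff powr_mult)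
  have "integrable lborel (\<lambda>u. ?g (0 + x * u))"
    using integrable_Gamma_powr(1)[OF assms(1)] assms by (intro lborel_integrable_real_affine) auto
  hence "integrable lborel (\<lambda>u. x powr a * (indicator {0<..} u *\<^sub>R (exp (- x * u) * u powr a)))"
    by (simp only: g)
  hence i: "integrable lborel (\<lambda>u. inverse (x powr a) * (x powr a * (indicator {0<..} u *\<^sub>R (exp (- x * u) * u powr a))))"
    by (rule integrable_mult_right)
  thus "set_integrable lborel {0<..} (\<lambda>u. exp (- x * u) * u powr a)"
    using assms unfolding set_integrable_def by (simp flip: mult.assoc)
  have "Gamma (a + 1) = \<bar>x\<bar> *\<^sub>R (\<integral>u. ?g (0 + x * u) \<partial>lborel)"
    using lborel_integral_real_affine[of x ?g 0] assms integrable_Gamma_powr(2)[OF assms(1)] by simp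
  also have "\<dots> = x * x powr a * (LINT u:{0<..}|lborel. exp (- x * u) * u powr a)"
    unfolding g set_lebesgue_integral_def using assms by simp
  also have "x * x powr a = x powr (a + 1)" using assms by (simp add: powr_add)
  finally show "(LINT u:{0<..}|lborel. exp (- x * u) * u powr a) = Gamma (a + 1) / x powr (a + 1)"
    using assms by (simp add: field_simps)
qed

section \<open>The Laplace transform: convergence, derivative, integration by parts\<close>

definition laplace :: "(real \<Rightarrow> complex) \<Rightarrow> real \<Rightarrow> complex" where
  "laplace W x = (LINT u:{0<..}|lborel. exp (- x * u) *\<^sub>R W u)"

text \<open>Demanded for all x > 0 at once, because integrability at x/2 is what controls the
  derivative at x.\<close>

definition laplace_ok :: "(real \<Rightarrow> complex) \<Rightarrow> bool" where
  "laplace_ok W \<longleftrightarrow> (\<forall>x>0. set_integrable lborel {0<..} (\<lambda>u. exp (- x * u) *\<^sub>R W u))"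

lemma set_integrable_dominated:
  fixes f :: "real \<Rightarrow> 'b::{banach, second_countable_topology}" and g :: "real \<Rightarrow> real"
  assumes "set_integrable lborel A g" "set_borel_measurable lborel A f"
    "\<And>u. u \<in> A \<Longrightarrow> norm (f u) \<le> g u"
  shows "set_integrable lborel A f"
  unfolding set_integrable_def
proof (rule Bochner_Integration.integrable_bound)
  show "integrable lborel (\<lambda>x. indicat_real A x *\<^sub>R g x)" using assms(1) by (simp add: set_integrable_def)
  show "(\<lambda>x. indicat_real A x *\<^sub>R f x) \<in> borel_measurable lborel"
    using assms(2) by (simp add: set_borel_measurable_def)
  show "AE x in lborel. norm (indicat_real A x *\<^sub>R f x) \<le> norm (indicat_real A x *\<^sub>R g x)"
    using assms(3) by (intro AE_I2) (auto simp: indicator_def intro: order_trans[OF assms(3) abs_ge_self])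
qed

lemma set_borel_measurable_continuous_lborel:
  fixes f :: "real \<Rightarrow> 'b::real_normed_vector"
  assumes "continuous_on A f" "A \<in> sets borel"
  shows "set_borel_measurable lborel A f"
  using borel_measurable_continuous_on_indicator[OF assms(2,1)] by (simp add: set_borel_measurable_def)

text \<open>The bound admits both the singularity of the weight at 0, of order u^(-1/2), and the
  linear growth of the functions that are integrated by parts.\<close>

lemma laplace_okI:
  assumes "continuous_on {0<..} W" "\<And>u. u > 0 \<Longrightarrow> norm (W u) \<le> C * (1 + u + u powr (- 1 / 2))"
  shows "laplace_ok W"
  unfolding laplace_ok_def
proof (intro allI impI)
  fix x :: real assume x: "x > 0"
  show "set_integrable lborel {0<..} (\<lambda>u. exp (- x * u) *\<^sub>R W u)"
  proof (rule set_integrable_dominated)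
    have "set_integrable lborel {0<..} (\<lambda>u. C * (exp (- x * u) * u powr 0 + exp (- x * u) * u powr 1 + exp (- x * u) * u powr (- 1 / 2)))"
      by (intro set_integrable_mult_right set_integral_add(1) Gamma_powr_scaled x) auto
    thus "set_integrable lborel {0<..} (\<lambda>u. C * (exp (- x * u) * u powr 0 + exp (- x * u) * u powr 1 + exp (- x * u) * u powr (- 1 / 2)))" .
    show "set_borel_measurable lborel {0<..} (\<lambda>u. exp (- x * u) *\<^sub>R W u)"
      by (intro set_borel_measurable_continuous_lborel continuous_intros assms) auto
    fix u :: real assume u: "u \<in> {0<..}"
    have "exp (- x * u) * norm (W u) \<le> exp (- x * u) * (C * (1 + u + u powr (- 1 / 2)))"
      using u by (intro mult_left_mono assms) auto
    thus "norm (exp (- x * u) *\<^sub>R W u) \<le> C * (exp (- x * u) * u powr 0 + exp (- x * u) * u powr 1 + exp (- x * u) * u powr (- 1 / 2))"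
      using u by (simp add: algebra_simps)
  qed
qed

text \<open>Half of the exponential pays for the factor: u exp(-xu) <= (2/x) exp(-(x/2)u).\<close>

lemma laplace_ok_times:
  assumes "laplace_ok W"
  shows "laplace_ok (\<lambda>u. u *\<^sub>R W u)"
  unfolding laplace_ok_def
proof (intro allI impI)
  fix x :: real assume x: "x > 0"
  have i: "set_integrable lborel {0<..} (\<lambda>u. exp (- (x / 2) * u) *\<^sub>R W u)"
    using assms x half_gt_zero[OF x] unfolding laplace_ok_def by blast
  have "set_integrable lborel {0<..} (\<lambda>u. (2 / x) * norm (exp (- (x / 2) * u) *\<^sub>R W u))"
    by (intro set_integrable_mult_right set_integrable_norm i)
  thus "set_integrable lborel {0<..} (\<lambda>u. exp (- x * u) *\<^sub>R u *\<^sub>R W u)"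
  proof (rule set_integrable_dominated)
    have "(\<lambda>u. (u * exp (- (x / 2) * u)) *\<^sub>R (indicat_real {0<..} u *\<^sub>R (exp (- (x / 2) * u) *\<^sub>R W u)))
        \<in> borel_measurable lborel"
      by (intro borel_measurable_scaleR borel_measurable_integrable[OF i[unfolded set_integrable_def]]) auto
    also have "(\<lambda>u. (u * exp (- (x / 2) * u)) *\<^sub>R (indicat_real {0<..} u *\<^sub>R (exp (- (x / 2) * u) *\<^sub>R W u)))
       = (\<lambda>u. indicat_real {0<..} u *\<^sub>R (exp (- x * u) *\<^sub>R u *\<^sub>R W u))"
      by (auto simp: fun_eq_iff indicator_def mult_ac simp flip: exp_add)
    finally show "set_borel_measurable lborel {0<..} (\<lambda>u. exp (- x * u) *\<^sub>R u *\<^sub>R W u)"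
      by (simp add: set_borel_measurable_def)
    fix u :: real assume u: "u \<in> {0<..}"
    have "x / 2 * u \<le> exp (x / 2 * u)" using exp_ge_add_one_self[of "x / 2 * u"] by linarith
    hence "u \<le> 2 / x * exp (x / 2 * u)" using x by (simp add: field_simps)
    hence "exp (- x * u) * u \<le> exp (- x * u) * (2 / x * exp (x / 2 * u))"
      by (intro mult_left_mono) auto
    also have "\<dots> = 2 / x * exp (- (x / 2) * u)"
    proof -
      have "exp (- x * u) * exp (x / 2 * u) = exp (- (x / 2) * u)"
        by (simp flip: exp_add)
      thus ?thesis by (simp add: mult.left_commute)
    qed
    finally have "exp (- x * u) * u * norm (W u) \<le> 2 / x * exp (- (x / 2) * u) * norm (W u)"
      by (intro mult_right_mono) auto
    thus "norm (exp (- x * u) *\<^sub>R u *\<^sub>R W u) \<le> (2 / x) * norm (exp (- (x / 2) * u) *\<^sub>R W u)"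
      using u x by (simp add: mult_ac)
  qed
qed

text \<open>An explicit mean value estimate. It furnishes majorants for difference quotients both in
  the Laplace variable and in the exponent of a power.\<close>

lemma exp_minus_diff_le:
  fixes a b c :: real
  assumes "c \<le> a" "c \<le> b"
  shows "\<bar>exp (- a) - exp (- b)\<bar> \<le> \<bar>a - b\<bar> * exp (- c)"
proof -
  have *: "exp (- a) - exp (- b) \<le> (b - a) * exp (- c)" if "a \<le> b" "c \<le> a" for a b :: real
  proof -
    have "exp (- a) - exp (- b) = exp (- a) * (1 - exp (- (b - a)))"
      by (simp add: right_diff_distrib flip: exp_add)
    also have "\<dots> \<le> exp (- c) * (b - a)"
    proof (intro mult_mono)
      show "1 - exp (- (b - a)) \<le> b - a" using exp_ge_add_one_self[of "- (b - a)"] by linarith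
    qed (use that in auto)
    finally show ?thesis by (simp add: mult.commute)
  qed
  show ?thesis
  proof (cases "a \<le> b")
    case True
    thus ?thesis using *[of a b] assms by (simp add: abs_if)
  next
    case False
    thus ?thesis using *[of b a] assms by (simp add: abs_if)
  qed
qed

lemma has_vector_derivativeI_quotient:
  fixes f :: "real \<Rightarrow> 'a::real_normed_vector"
  assumes "((\<lambda>y. (1 / (y - x)) *\<^sub>R (f y - f x)) \<longlongrightarrow> D) (at x)"
  shows "(f has_vector_derivative D) (at x)"
  unfolding has_vector_derivative_def has_derivative_iff_norm
proof (intro conjI bounded_linear_scaleR_left)
  have "((\<lambda>y. norm ((1 / (y - x)) *\<^sub>R (f y - f x) - D)) \<longlongrightarrow> 0) (at x)"
    by (intro tendsto_norm_zero LIM_zero assms)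
  moreover have "eventually (\<lambda>y. norm ((1 / (y - x)) *\<^sub>R (f y - f x) - D)
      = norm (f y - f x - (y - x) *\<^sub>R D) / norm (y - x)) (at x)"
    unfolding eventually_at_filter
  proof (intro always_eventually allI impI)
    fix y assume "y \<noteq> x"
    hence "(1 / (y - x)) *\<^sub>R (f y - f x) - D = (1 / (y - x)) *\<^sub>R (f y - f x - (y - x) *\<^sub>R D)"
      by (simp add: scaleR_right_diff_distrib)
    thus "norm ((1 / (y - x)) *\<^sub>R (f y - f x) - D) = norm (f y - f x - (y - x) *\<^sub>R D) / norm (y - x)"
      by simp
  qed
  ultimately show "((\<lambda>y. norm (f y - f x - (y - x) *\<^sub>R D) / norm (y - x)) \<longlongrightarrow> 0) (at x)"
    by (rule Lim_transform_eventually)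
qed

lemma laplace_deriv:
  assumes ok: "laplace_ok W" and x: "x > 0"
  shows "(laplace W has_vector_derivative - laplace (\<lambda>u. u *\<^sub>R W u) x) (at x)"
proof -
  let ?f = "\<lambda>y u. indicat_real {0<..} u *\<^sub>R (exp (- y * u) *\<^sub>R W u)"
  have int: "integrable lborel (?f y)" if "y > 0" for y
    using ok that unfolding laplace_ok_def set_integrable_def by blast
  \<comment> \<open>For y > x/2 all difference quotients have the common majorant u exp(-(x/2)u) |W
    u|, and this set is a neighbourhood of x.\<close>
  let ?S = "{x / 2<..}"
  have "((\<lambda>y. (1 / (y - x)) *\<^sub>R (laplace W y - laplace W x)) \<longlongrightarrow> - laplace (\<lambda>u. u *\<^sub>R W u) x) (at x within ?S)"
    unfolding tendsto_at_iff_sequentially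
  proof (intro allI impI)
    fix X :: "nat \<Rightarrow> real" assume X: "\<forall>i. X i \<in> ?S - {x}" "X \<longlonglongrightarrow> x"
    have X0: "X i > 0" "X i \<noteq> x" "X i > x / 2" for i using X(1) x
      by (auto, smt (verit) field_sum_of_halves greaterThan_iff)
    let ?s = "\<lambda>i u. (1 / (X i - x)) *\<^sub>R (?f (X i) u - ?f x u)"
    let ?l = "\<lambda>u. - (indicat_real {0<..} u *\<^sub>R (exp (- x * u) *\<^sub>R u *\<^sub>R W u))"
    have "(\<lambda>i. \<integral>u. ?s i u \<partial>lborel) \<longlonglongrightarrow> (\<integral>u. ?l u \<partial>lborel)"
    proof (rule integral_dominated_convergence[where w = "\<lambda>u. norm (indicat_real {0<..} u *\<^sub>R (exp (- (x / 2) * u) *\<^sub>R u *\<^sub>R W u))"])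
      have A: "integrable lborel (\<lambda>u. indicat_real {0<..} u *\<^sub>R (exp (- y * u) *\<^sub>R u *\<^sub>R W u))" if "y > 0" for y
        using laplace_ok_times[OF ok] that unfolding laplace_ok_def set_integrable_def by blast
      show "?l \<in> borel_measurable lborel"
        by (rule borel_measurable_uminus[OF borel_measurable_integrable[OF A[OF x]]])
      show "integrable lborel (\<lambda>u. norm (indicat_real {0<..} u *\<^sub>R (exp (- (x / 2) * u) *\<^sub>R u *\<^sub>R W u)))"
        by (rule integrable_norm[OF A[OF half_gt_zero[OF x]]])
      show "?s i \<in> borel_measurable lborel" for i
        using int[OF X0(1)[of i]] int[OF x] by auto
      show "AE u in lborel. (\<lambda>i. ?s i u) \<longlonglongrightarrow> ?l u"
      proof (intro AE_I2)
        fix u :: real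
        have "((\<lambda>y. exp (- y * u)) has_real_derivative - u * exp (- x * u)) (at x)"
          by (auto intro!: derivative_eq_intros)
        hence "((\<lambda>y. (exp (- y * u) - exp (- x * u)) / (y - x)) \<longlongrightarrow> - u * exp (- x * u)) (at x)"
          by (simp add: has_field_derivative_iff)
        moreover have "filterlim X (at x) sequentially"
          using X X0 by (auto simp: filterlim_at)
        ultimately have "(\<lambda>i. (exp (- X i * u) - exp (- x * u)) / (X i - x)) \<longlonglongrightarrow> - u * exp (- x * u)"
          by (rule filterlim_compose)
        hence "(\<lambda>i. ((exp (- X i * u) - exp (- x * u)) / (X i - x)) *\<^sub>R (indicat_real {0<..} u *\<^sub>R W u)) \<longlonglongrightarrow>
           (- u * exp (- x * u)) *\<^sub>R (indicat_real {0<..} u *\<^sub>R W u)"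
          by (intro tendsto_intros)
        moreover have "((exp (- X i * u) - exp (- x * u)) / (X i - x)) *\<^sub>R (indicat_real {0<..} u *\<^sub>R W u) = ?s i u" for i
          by (auto simp: indicator_def algebra_simps divide_inverse simp flip: scaleR_diff_left)
        ultimately show "(\<lambda>i. ?s i u) \<longlonglongrightarrow> ?l u"
          by (simp add: mult_ac)
      qed
      show "AE u in lborel. norm (?s i u) \<le> norm (indicat_real {0<..} u *\<^sub>R (exp (- (x / 2) * u) *\<^sub>R u *\<^sub>R W u))" for i
      proof (intro AE_I2)
        fix u :: real
        show "norm (?s i u) \<le> norm (indicat_real {0<..} u *\<^sub>R (exp (- (x / 2) * u) *\<^sub>R u *\<^sub>R W u))"
        proof (cases "u > 0")
          case True
          have "\<bar>exp (- (X i * u)) - exp (- (x * u))\<bar> \<le> \<bar>X i * u - x * u\<bar> * exp (- (x / 2 * u))"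
            using True X0[of i] x by (intro exp_minus_diff_le mult_right_mono) auto
          also have "\<bar>X i * u - x * u\<bar> = \<bar>X i - x\<bar> * u" using True by (simp add: abs_mult flip: left_diff_distrib)
          finally have "\<bar>exp (- (X i * u)) - exp (- (x * u))\<bar> / \<bar>X i - x\<bar> \<le> u * exp (- (x / 2 * u))"
            using X0(2)[of i] by (simp add: field_simps)
          hence "\<bar>exp (- (X i * u)) - exp (- (x * u))\<bar> / \<bar>X i - x\<bar> * norm (W u) \<le> u * exp (- (x / 2 * u)) * norm (W u)"
            by (intro mult_right_mono) auto
          moreover have "norm (?s i u) = \<bar>exp (- (X i * u)) - exp (- (x * u))\<bar> / \<bar>X i - x\<bar> * norm (W u)"
            using True by (simp add: indicator_def flip: scaleR_diff_left)
          moreover have "norm (indicat_real {0<..} u *\<^sub>R (exp (- (x / 2) * u) *\<^sub>R u *\<^sub>R W u))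
              = u * exp (- (x / 2 * u)) * norm (W u)"
            using True by (simp add: indicator_def mult_ac)
          ultimately show ?thesis by (simp only:)
        qed (simp add: indicator_def)
      qed
    qed
    moreover have "(\<integral>u. ?s i u \<partial>lborel) = (1 / (X i - x)) *\<^sub>R (laplace W (X i) - laplace W x)" for i
      unfolding laplace_def set_lebesgue_integral_def
      by (simp only: integral_scaleR_right Bochner_Integration.integral_diff[OF int[OF X0(1)] int[OF x]])
    moreover have "(\<integral>u. ?l u \<partial>lborel) = - laplace (\<lambda>u. u *\<^sub>R W u) x"
      unfolding laplace_def set_lebesgue_integral_def by simp
    ultimately show "((\<lambda>y. (1 / (y - x)) *\<^sub>R (laplace W y - laplace W x)) \<circ> X) \<longlonglongrightarrow> - laplace (\<lambda>u. u *\<^sub>R W u) x"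
      by (simp only: o_def)
  qed
  moreover have "at x within ?S = at x" using x by (intro at_within_open) auto
  ultimately have "((\<lambda>y. (1 / (y - x)) *\<^sub>R (laplace W y - laplace W x)) \<longlongrightarrow> - laplace (\<lambda>u. u *\<^sub>R W u) x) (at x)"
    by simp
  thus ?thesis by (rule has_vector_derivativeI_quotient)
qed

text \<open>The difference of the two integrands is the derivative of exp(-xu) B(u), which vanishes
  at both ends. It serves twice: for the differential equation of the moments, and to pass from the
  weight to its primitive.\<close>

lemma laplace_by_parts:
  assumes deriv: "\<And>u. u > 0 \<Longrightarrow> (B has_vector_derivative B' u) (at u)"
    and cont: "continuous_on {0<..} B'"
    and ok': "laplace_ok B'"
    and bound: "\<And>u. u > 0 \<Longrightarrow> norm (B u) \<le> C * (1 + u)"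
    and lim: "(B \<longlongrightarrow> 0) (at_right 0)" and x: "x > 0"
  shows "laplace B' x = of_real x * laplace B x" "laplace_ok B"
proof -
  have contB: "continuous_on {0<..} B"
    using deriv by (intro continuous_at_imp_continuous_on ballI has_vector_derivative_continuous) auto
  have C: "C \<ge> 0" using order_trans[OF norm_ge_zero bound[of 1]] by simp
  show ok: "laplace_ok B"
  proof (rule laplace_okI[OF contB])
    fix u :: real assume "u > 0"
    hence "C * (1 + u) \<le> C * (1 + u + u powr (- 1 / 2))" using C by (intro mult_left_mono) auto
    thus "norm (B u) \<le> C * (1 + u + u powr (- 1 / 2))" using bound[OF \<open>u > 0\<close>] by linarith
  qed
  let ?h = "\<lambda>u. exp (- x * u) *\<^sub>R B' u - of_real x * (exp (- x * u) *\<^sub>R B u)"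
  have i1: "set_integrable lborel {0<..} (\<lambda>u. exp (- x * u) *\<^sub>R B' u)"
    using ok' x by (simp add: laplace_ok_def)
  have i2: "set_integrable lborel {0<..} (\<lambda>u. of_real x * (exp (- x * u) *\<^sub>R B u))"
    using ok x by (intro set_integrable_mult_right) (simp add: laplace_ok_def)
  have "(LBINT u=0..\<infinity>. ?h u) = 0 - 0"
  proof (rule interval_integral_FTC_integrable[where F = "\<lambda>u. exp (- x * u) *\<^sub>R B u"])
    fix u :: real assume "0 < ereal u"
    hence u: "u > 0" by simp
    show "((\<lambda>u. exp (- x * u) *\<^sub>R B u) has_vector_derivative ?h u) (at u)"
      by (rule derivative_eq_intros deriv[OF u] refl | simp add: scaleR_conv_of_real algebra_simps)+
    show "isCont ?h u"
      using u cont contB by (auto intro!: continuous_intros simp: continuous_on_eq_continuous_at)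
  next
    show "set_integrable lborel (einterval 0 \<infinity>) ?h"
      using set_integral_diff(1)[OF i1 i2] by (simp add: einterval_eq zero_ereal_def)
    have "((\<lambda>u. exp (- x * u) *\<^sub>R B u) \<longlongrightarrow> exp (- x * 0) *\<^sub>R 0) (at_right 0)"
      by (intro tendsto_intros lim)
    thus "(((\<lambda>u. exp (- x * u) *\<^sub>R B u) \<circ> real_of_ereal) \<longlongrightarrow> 0) (at_right 0)"
      by (simp add: zero_ereal_def ereal_tendsto_simps)
    have "((\<lambda>u. exp (- x * u) *\<^sub>R B u) \<longlongrightarrow> 0) at_top"
    proof (rule Lim_null_comparison)
      show "eventually (\<lambda>u. norm (exp (- x * u) *\<^sub>R B u) \<le> C * (1 + u) * exp (- x * u)) at_top"
        using eventually_gt_at_top[of 0]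
      proof eventually_elim
        case (elim u)
        thus ?case using mult_right_mono[OF bound[OF elim], of "exp (- x * u)"] by (simp add: mult.commute)
      qed
      show "((\<lambda>u. C * (1 + u) * exp (- x * u)) \<longlongrightarrow> 0) at_top"
      proof -
        have lin: "filterlim (\<lambda>u. x * u) at_top at_top"
          using x by (intro filterlim_tendsto_pos_mult_at_top[OF tendsto_const] filterlim_ident)
        have "((\<lambda>u. C * ((x * u) ^ 0 / exp (x * u) + (x * u) ^ 1 / exp (x * u) / x)) \<longlongrightarrow> C * (0 + 0 / x)) at_top"
          using x by (intro tendsto_intros filterlim_compose[OF tendsto_power_div_exp_0 lin]) auto
        thus ?thesis using x by (simp add: exp_minus field_simps)
      qed
    qed
    thus "(((\<lambda>u. exp (- x * u) *\<^sub>R B u) \<circ> real_of_ereal) \<longlongrightarrow> 0) (at_left \<infinity>)"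
      by (simp add: ereal_tendsto_simps)
  qed simp
  moreover have "(LBINT u=0..\<infinity>. ?h u) = (LINT u:{0<..}|lborel. ?h u)"
    unfolding zero_ereal_def by (rule interval_integral_to_infinity_eq)
  moreover have "(LINT u:{0<..}|lborel. ?h u) = laplace B' x - of_real x * laplace B x"
    unfolding laplace_def by (simp only: set_integral_diff(2)[OF i1 i2] set_integral_mult_right)
  ultimately show "laplace B' x = of_real x * laplace B x" by simp
qed

section \<open>The integral of exp(-v) ln v\<close>

lemma abs_ln_le:
  assumes "v > 0"
  shows "\<bar>ln v\<bar> \<le> 2 * v powr (- 1 / 2) + (v::real)"
proof (cases "v \<ge> 1")
  case True
  moreover have "0 \<le> v powr (- 1 / 2)" by simp
  moreover have "ln v \<le> v - 1" "0 \<le> ln v" using ln_le_minus_one[of v] True by auto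
  ultimately show ?thesis by linarith
next
  case False
  \<comment> \<open>Applied to v^(-1/2), the inequality ln y <= y - 1 bounds -ln v near 0 by an
    integrable power.\<close>
  have "ln (v powr (- 1 / 2)) \<le> v powr (- 1 / 2) - 1" using assms by (intro ln_le_minus_one) auto
  thus ?thesis using assms False by (simp add: ln_powr)
qed

text \<open>After division by s the right side no longer depends on s, so it dominates the
  difference quotients of v^s at s = 0.\<close>

lemma abs_powr_minus_one_le:
  assumes "v > 0" "0 < s" "s \<le> 1"
  shows "\<bar>v powr s - 1\<bar> \<le> s * \<bar>ln v\<bar> * (1 + (v::real))"
proof -
  have "\<bar>exp (- (- (s * ln v))) - exp (- 0)\<bar> \<le> \<bar>- (s * ln v) - 0\<bar> * exp (- (min 0 (- (s * ln v))))"
    by (intro exp_minus_diff_le) auto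
  also have "exp (- (min 0 (- (s * ln v)))) \<le> 1 + v"
  proof (cases "ln v \<ge> 0")
    case True
    hence "s * ln v \<le> 1 * ln v" using assms by (intro mult_right_mono) auto
    hence "exp (s * ln v) \<le> exp (ln v)" by simp
    thus ?thesis using True assms by (simp add: min_def)
  next
    case False
    hence "s * ln v \<le> 0" using assms by (simp add: mult_le_0_iff)
    thus ?thesis using assms by (simp add: min_def)
  qed
  finally have "\<bar>exp (s * ln v) - 1\<bar> \<le> \<bar>s * ln v\<bar> * (1 + v)"
    by (simp add: mult_left_mono)
  thus ?thesis using assms by (simp add: powr_def abs_mult)
qed

lemma set_integrable_exp_powr: "a > -1 \<Longrightarrow> set_integrable lborel {0<..} (\<lambda>v. exp (- v) * v powr (a::real))"
  using Gamma_powr_scaled(1)[of a 1] by simp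

lemma LINT_exp_powr: "a > -1 \<Longrightarrow> (LINT v:{0<..}|lborel. exp (- v) * v powr (a::real)) = Gamma (a + 1)"
  using Gamma_powr_scaled(2)[of a 1] by simp

lemma set_integrable_exp_ln: "set_integrable lborel {0<..} (\<lambda>v::real. exp (- v) * ln v)"
proof (rule set_integrable_dominated)
  show "set_integrable lborel {0<..} (\<lambda>v::real. 2 * (exp (- v) * v powr (- 1 / 2)) + exp (- v) * v powr 1)"
    by (intro set_integral_add(1) set_integrable_mult_right set_integrable_exp_powr) auto
  show "set_borel_measurable lborel {0<..} (\<lambda>v::real. exp (- v) * ln v)"
    by (intro set_borel_measurable_continuous_lborel continuous_intros) auto
  fix v :: real assume v: "v \<in> {0<..}"
  have "exp (- v) * \<bar>ln v\<bar> \<le> exp (- v) * (2 * v powr (- 1 / 2) + v)"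
    using v by (intro mult_left_mono abs_ln_le) auto
  thus "norm (exp (- v) * ln v) \<le> 2 * (exp (- v) * v powr (- 1 / 2)) + exp (- v) * v powr 1"
    using v by (simp add: abs_mult algebra_simps)
qed

text \<open>The integral is Gamma'(1), obtained by differentiating the Gamma integral under the
  integral sign.\<close>

lemma LINT_exp_ln: "(LINT v:{0<..}|lborel. exp (- v) * ln v) = - (euler_mascheroni :: real)"
proof -
  \<comment> \<open>Dominated convergence works along a sequence. It stays in (0, 1], as the
    majorant demands.\<close>
  define s where "s i = 1 / (1 + real i)" for i
  have s: "0 < s i" "s i \<le> 1" for i by (auto simp: s_def)
  have s0: "s \<longlonglongrightarrow> 0"
    unfolding s_def using LIMSEQ_inverse_real_of_nat by (simp add: inverse_eq_divide add.commute)
  let ?f = "\<lambda>i v. indicat_real {0<..} v * (exp (- v) * ((v powr s i - 1) / s i))"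
  let ?w = "\<lambda>v. indicat_real {0<..} v * (exp (- v) * (2 * v powr (- 1 / 2) + 2 * v powr (1 / 2) + v powr 1 + v powr 2))"
  have "(\<lambda>i. \<integral>v. ?f i v \<partial>lborel) \<longlonglongrightarrow> (\<integral>v. indicat_real {0<..} v * (exp (- v) * ln v) \<partial>lborel)"
  proof (rule integral_dominated_convergence[where w = ?w])
    show "(\<lambda>v. indicat_real {0<..} v * (exp (- v) * ln v)) \<in> borel_measurable lborel" by measurable
    show "?f i \<in> borel_measurable lborel" for i by measurable
    have "set_integrable lborel {0<..} (\<lambda>v::real. 2 * (exp (- v) * v powr (- 1 / 2)) + 2 * (exp (- v) * v powr (1 / 2))
        + exp (- v) * v powr 1 + exp (- v) * v powr 2)"
      by (intro set_integral_add(1) set_integrable_mult_right set_integrable_exp_powr) auto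
    thus "integrable lborel ?w" by (simp add: set_integrable_def algebra_simps)
    show "AE v in lborel. (\<lambda>i. ?f i v) \<longlonglongrightarrow> indicat_real {0<..} v * (exp (- v) * ln v)"
    proof (intro AE_I2)
      fix v :: real
      show "(\<lambda>i. ?f i v) \<longlonglongrightarrow> indicat_real {0<..} v * (exp (- v) * ln v)"
      proof (cases "v > 0")
        case True
        have "((\<lambda>s. v powr s) has_real_derivative v powr 0 * ln v) (at 0)"
          using True by (auto intro!: derivative_eq_intros)
        hence "((\<lambda>s. (v powr s - 1) / s) \<longlongrightarrow> ln v) (at 0)"
          using True by (simp add: has_field_derivative_iff)
        moreover have "filterlim s (at 0) sequentially"
          using s0 s by (auto simp: filterlim_at less_imp_neq[symmetric])
        ultimately have "(\<lambda>i. (v powr s i - 1) / s i) \<longlonglongrightarrow> ln v"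
          by (rule filterlim_compose)
        thus ?thesis by (intro tendsto_intros)
      qed (simp add: indicator_def)
    qed
    show "AE v in lborel. norm (?f i v) \<le> ?w v" for i
    proof (intro AE_I2)
      fix v :: real
      show "norm (?f i v) \<le> ?w v"
      proof (cases "v > 0")
        case True
        have "\<bar>(v powr s i - 1) / s i\<bar> \<le> \<bar>ln v\<bar> * (1 + v)"
          using abs_powr_minus_one_le[OF True s] s[of i] by (simp add: field_simps)
        also have "\<dots> \<le> (2 * v powr (- 1 / 2) + v) * (1 + v)"
          using True by (intro mult_right_mono abs_ln_le) auto
        also have "\<dots> = 2 * v powr (- 1 / 2) + 2 * v powr (1 / 2) + v powr 1 + v powr 2"
        proof -
          have "v powr (- 1 / 2) * v = v powr (1 / 2)"
            using True powr_add[of v "- 1 / 2" 1] by simp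
          thus ?thesis using True by (simp add: algebra_simps power2_eq_square)
        qed
        finally have "exp (- v) * \<bar>(v powr s i - 1) / s i\<bar> \<le> exp (- v) * (2 * v powr (- 1 / 2) + 2 * v powr (1 / 2) + v powr 1 + v powr 2)"
          by (intro mult_left_mono) auto
        thus ?thesis using True by (simp add: abs_mult)
      qed (simp add: indicator_def)
    qed
  qed
  moreover have "(\<integral>v. ?f i v \<partial>lborel) = (Gamma (1 + s i) - Gamma 1) / (s i)" for i
  proof -
    have 1: "(LINT v:{0<..}|lborel. (exp (- v) * v powr s i - exp (- v) * v powr 0) / s i)
        = (Gamma (s i + 1) - Gamma (0 + 1)) / s i"
      using s[of i] by (subst set_integral_divide_zero, subst set_integral_diff(2))
        (auto simp: set_integrable_exp_powr LINT_exp_powr simp del: Gamma_1 powr_zero_eq_one)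
    have 2: "(LINT v:{0<..}|lborel. (exp (- v) * v powr s i - exp (- v) * v powr 0) / s i) = (\<integral>v. ?f i v \<partial>lborel)"
      unfolding set_lebesgue_integral_def
      by (intro Bochner_Integration.integral_cong) (auto simp: indicator_def algebra_simps)
    have "(Gamma (s i + 1) - Gamma (0 + 1)) / s i = (Gamma (1 + s i) - Gamma 1) / s i"
      by (simp add: add.commute)
    from trans[OF 2[symmetric] trans[OF 1 this]] show ?thesis .
  qed
  ultimately have 1: "(\<lambda>i. (Gamma (1 + s i) - Gamma 1) / s i) \<longlonglongrightarrow> (LINT v:{0<..}|lborel. exp (- v) * ln v)"
    by (simp only: set_lebesgue_integral_def real_scaleR_def)
  have "(Gamma has_real_derivative Gamma 1 * Digamma 1) (at 1)"
    by (rule has_field_derivative_Gamma) auto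
  hence "((\<lambda>h. (Gamma (1 + h) - Gamma 1) / h) \<longlongrightarrow> - euler_mascheroni) (at (0::real))"
    by (simp add: DERIV_def)
  moreover have "filterlim s (at 0) sequentially"
    using s0 s by (auto simp: filterlim_at less_imp_neq[symmetric])
  ultimately have "(\<lambda>i. (Gamma (1 + s i) - Gamma 1) / s i) \<longlonglongrightarrow> - euler_mascheroni"
    by (rule filterlim_compose)
  with 1 show ?thesis by (rule LIMSEQ_unique)
qed

subsection \<open>The Hankel function of order zero as a Laplace integral\<close>

text \<open>
  The weight below is \<open>1 / sqrt (u (2 \<i> - u))\<close>. It arises from \<open>H\<^sub>0 x = 2 / (\<pi> \<i>) \<integral>\<^sub>0\<^sup>\<infinity> exp (\<i> x cosh t) dt\<close>
  by rotating the contour to \<open>cosh t = 1 + \<i> u\<close>.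
\<close>

definition hankel_root :: "real \<Rightarrow> complex" where
  "hankel_root u = csqrt (Complex (- (u\<^sup>2)) (2 * u))"

definition hankel_weight :: "real \<Rightarrow> complex" where
  "hankel_weight u = 1 / hankel_root u"

lemma hankel_root_sq: "hankel_root u * hankel_root u = Complex (- (u\<^sup>2)) (2 * u)"
  unfolding hankel_root_def by (metis power2_csqrt power2_eq_square)

text \<open>The radicand lies in the upper half plane, so its principal root lies in the open first
  quadrant. The real part keeps 1 + i u + root off the branch cut of \<open>Ln\<close>; the
  imaginary part prevents the root from cancelling i u.\<close>

lemma hankel_root_Re_Im:
  assumes "u > 0"
  shows "Re (hankel_root u) > 0" "Im (hankel_root u) > 0"
proof -
  have im: "2 * (Re (hankel_root u) * Im (hankel_root u)) = 2 * u"
    using arg_cong[OF hankel_root_sq[of u], of Im] by (simp add: mult.commute)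
  have "Re (hankel_root u) \<noteq> 0" using im assms by auto
  thus re: "Re (hankel_root u) > 0" unfolding hankel_root_def using csqrt_principal by blast
  have "0 < Re (hankel_root u) * Im (hankel_root u)" using im assms by linarith
  thus "Im (hankel_root u) > 0" using re by (rule zero_less_mult_pos)
qed

lemma hankel_root_nz: "u > 0 \<Longrightarrow> hankel_root u \<noteq> 0"
  using hankel_root_Re_Im(1) by fastforce

lemma norm_hankel_root_sq: "(norm (hankel_root u))\<^sup>2 = \<bar>u\<bar> * sqrt (u\<^sup>2 + 4)"
proof -
  have "(norm (hankel_root u))\<^sup>2 = norm (hankel_root u * hankel_root u)" by (simp add: norm_mult power2_eq_square)
  also have "\<dots> = sqrt (u\<^sup>2 * (u\<^sup>2 + 4))" unfolding hankel_root_sq by (simp add: complex_norm algebra_simps power2_eq_square)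
  finally show ?thesis by (simp add: real_sqrt_mult)
qed

text \<open>All follow from |root|^2 = u sqrt(u^2 + 4). The lower bound u^(1/2) is sharp in order at
  0, the lower bound u at infinity.\<close>

lemma norm_hankel_root_bounds:
  assumes "u > 0"
  shows "u \<le> norm (hankel_root u)" "u powr (1 / 2) \<le> norm (hankel_root u)" "norm (hankel_root u) \<le> sqrt (u * (u + 2))" "norm (hankel_root u) \<le> u + 2"
proof -
  have s: "u \<le> sqrt (u\<^sup>2 + 4)" "1 \<le> sqrt (u\<^sup>2 + 4)" "sqrt (u\<^sup>2 + 4) \<le> u + 2"
    using assms by (auto intro!: real_le_rsqrt real_le_lsqrt simp: power2_eq_square algebra_simps)
  have "u\<^sup>2 \<le> (norm (hankel_root u))\<^sup>2" unfolding norm_hankel_root_sq using assms s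
    by (simp add: power2_eq_square)
  thus "u \<le> norm (hankel_root u)" by (rule power2_le_imp_le) auto
  have "(u powr (1 / 2))\<^sup>2 \<le> (norm (hankel_root u))\<^sup>2" unfolding norm_hankel_root_sq using assms s
    by (simp add: powr_half_sqrt)
  thus "u powr (1 / 2) \<le> norm (hankel_root u)" by (rule power2_le_imp_le) auto
  have le: "(norm (hankel_root u))\<^sup>2 \<le> u * (u + 2)" unfolding norm_hankel_root_sq using assms s by simp
  thus "norm (hankel_root u) \<le> sqrt (u * (u + 2))" by (rule real_le_rsqrt)
  have "u * (u + 2) \<le> (u + 2)\<^sup>2" using assms by (simp add: power2_eq_square algebra_simps)
  with le have "(norm (hankel_root u))\<^sup>2 \<le> (u + 2)\<^sup>2" by linarith
  thus "norm (hankel_root u) \<le> u + 2" by (rule power2_le_imp_le) (use assms in auto)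
qed

lemma hankel_root_tendsto_0: "(hankel_root \<longlongrightarrow> 0) (at_right 0)"
proof (rule Lim_null_comparison)
  show "eventually (\<lambda>u. norm (hankel_root u) \<le> sqrt (u * (u + 2))) (at_right 0)"
    using norm_hankel_root_bounds(3) by (auto simp: eventually_at_filter)
  have "((\<lambda>u. sqrt (u * (u + 2))) \<longlongrightarrow> sqrt (0 * (0 + 2))) (at_right 0)"
    by (intro tendsto_intros)
  thus "((\<lambda>u. sqrt (u * (u + 2))) \<longlongrightarrow> 0) (at_right 0)" by simp
qed

text \<open>A difference of squares: root^2 - (i u)^2 = 2 i u, and |root + i u| >= u. So the root is
  i u up to a bounded error, which governs the limit x -> 0.\<close>

lemma norm_hankel_root_minus_le:
  assumes "u > 0"
  shows "norm (hankel_root u - \<i> * of_real u) \<le> 2"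
proof -
  have "(hankel_root u - \<i> * of_real u) * (hankel_root u + \<i> * of_real u) = 2 * \<i> * of_real u"
    using hankel_root_sq[of u] by (simp add: algebra_simps complex_eq_iff power2_eq_square)
  hence "norm (hankel_root u - \<i> * of_real u) * norm (hankel_root u + \<i> * of_real u) = 2 * u"
    using assms by (metis abs_of_pos norm_ii norm_mult norm_numeral norm_of_real mult.right_neutral)
  moreover have "u \<le> norm (hankel_root u + \<i> * of_real u)"
    using hankel_root_Re_Im(2)[OF assms] abs_Im_le_cmod[of "hankel_root u + \<i> * of_real u"] by simp
  hence "norm (hankel_root u - \<i> * of_real u) * u \<le> norm (hankel_root u - \<i> * of_real u) * norm (hankel_root u + \<i> * of_real u)"
    by (intro mult_left_mono) auto
  ultimately show ?thesis using assms by simp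
qed

lemma hankel_root_deriv:
  assumes "u > 0"
  shows "(hankel_root has_vector_derivative (\<i> - of_real u) * hankel_weight u) (at u)"
proof -
  have "((\<lambda>u. of_real (- (u\<^sup>2)) + \<i> * of_real (2 * u)) has_vector_derivative (of_real (- 2 * u) + \<i> * of_real 2)) (at u)"
    by (rule derivative_eq_intros refl | simp)+
  moreover have "of_real (- (u\<^sup>2)) + \<i> * of_real (2 * u) = Complex (- (u\<^sup>2)) (2 * u)" for u
    by (simp add: complex_eq_iff)
  ultimately have d: "((\<lambda>u. Complex (- (u\<^sup>2)) (2 * u)) has_vector_derivative (2 * (\<i> - of_real u))) (at u)"
    by (simp add: algebra_simps)
  have "Complex (- (u\<^sup>2)) (2 * u) \<notin> \<real>\<^sub>\<le>\<^sub>0" using assms by (auto simp: complex_nonpos_Reals_iff)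
  hence "(csqrt has_field_derivative inverse (2 * csqrt (Complex (- (u\<^sup>2)) (2 * u)))) (at (Complex (- (u\<^sup>2)) (2 * u)))"
    by (rule has_field_derivative_csqrt)
  from field_vector_diff_chain_at[OF d this]
  have "(hankel_root has_vector_derivative (2 * (\<i> - of_real u)) * inverse (2 * hankel_root u)) (at u)"
    by (simp only: o_def hankel_root_def[symmetric])
  moreover have "2 * a * inverse (2 * b) = a * (1 / b)" for a b :: complex
    by (cases "b = 0") (auto simp: field_simps)
  ultimately show ?thesis unfolding hankel_weight_def by (simp only:)
qed

lemma continuous_on_hankel_root: "continuous_on {0<..} hankel_root"
  by (intro continuous_at_imp_continuous_on ballI has_vector_derivative_continuous[OF hankel_root_deriv]) auto

lemma continuous_on_hankel_weight: "continuous_on {0<..} hankel_weight"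
  unfolding hankel_weight_def[abs_def] by (intro continuous_intros continuous_on_hankel_root) (auto simp: hankel_root_nz)

lemma norm_hankel_weight_le:
  assumes "u > 0"
  shows "norm (hankel_weight u) \<le> u powr (- 1 / 2)"
proof -
  have "norm (hankel_weight u) = 1 / norm (hankel_root u)" by (simp add: hankel_weight_def norm_divide)
  also have "\<dots> \<le> 1 / u powr (1 / 2)"
    using assms norm_hankel_root_bounds(2)[OF assms] hankel_root_nz[OF assms] by (intro divide_left_mono) auto
  also have "\<dots> = u powr (- 1 / 2)"
    using powr_minus_divide[of u "1 / 2"] by simp
  finally show ?thesis .
qed

lemma norm_u_hankel_weight_le: "u > 0 \<Longrightarrow> norm (u *\<^sub>R hankel_weight u) \<le> 1"
  using norm_hankel_root_bounds(1)[of u] hankel_root_nz[of u] by (simp add: hankel_weight_def norm_divide divide_le_eq)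

lemma laplace_ok_hankel_weight: "laplace_ok hankel_weight"
proof (rule laplace_okI[OF continuous_on_hankel_weight])
  fix u :: real assume "u > 0"
  thus "norm (hankel_weight u) \<le> 1 * (1 + u + u powr (- 1 / 2))" using norm_hankel_weight_le[of u] by simp
qed

lemma laplace_cong: "(\<And>u. u > 0 \<Longrightarrow> f u = g u) \<Longrightarrow> laplace f x = laplace g x"
  unfolding laplace_def by (intro set_lebesgue_integral_cong) auto

lemma laplace_lincomb:
  assumes "laplace_ok f" "laplace_ok g" "x > 0"
  shows "laplace (\<lambda>u. a * f u + b * g u) x = a * laplace f x + b * laplace g x"
proof -
  have i: "set_integrable lborel {0<..} (\<lambda>u. a * (exp (- x * u) *\<^sub>R f u))"
    "set_integrable lborel {0<..} (\<lambda>u. b * (exp (- x * u) *\<^sub>R g u))"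
    using assms unfolding laplace_ok_def by (intro set_integrable_mult_right; blast)+
  have "laplace (\<lambda>u. a * f u + b * g u) x = (LINT u:{0<..}|lborel. a * (exp (- x * u) *\<^sub>R f u) + b * (exp (- x * u) *\<^sub>R g u))"
    unfolding laplace_def by (simp add: scaleR_right_distrib)
  also have "\<dots> = a * laplace f x + b * laplace g x"
    unfolding laplace_def set_integral_add(2)[OF i] set_integral_mult_right ..
  finally show ?thesis .
qed

text \<open>Substituting v = x u moves x from the exponential into the weight, so x -> 0 becomes a
  pointwise limit of W at infinity.\<close>

lemma laplace_scale:
  assumes "x > 0"
  shows "of_real x * laplace W x = (LINT v:{0<..}|lborel. exp (- v) *\<^sub>R W (v / x))"
proof -
  let ?f = "\<lambda>u. indicat_real {0<..} u *\<^sub>R (exp (- x * u) *\<^sub>R W u)"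
  have "laplace W x = \<bar>1 / x\<bar> *\<^sub>R (\<integral>v. ?f (0 + (1 / x) * v) \<partial>lborel)"
    unfolding laplace_def set_lebesgue_integral_def using assms by (intro lborel_integral_real_affine) auto
  also have "(\<integral>v. ?f (0 + (1 / x) * v) \<partial>lborel) = (LINT v:{0<..}|lborel. exp (- v) *\<^sub>R W (v / x))"
    unfolding set_lebesgue_integral_def
    using assms by (intro Bochner_Integration.integral_cong) (auto simp: indicator_def zero_less_divide_iff)
  finally show ?thesis using assms by (simp add: scaleR_conv_of_real)
qed

section \<open>Moments of the weight\<close>

definition hankel_moment :: "nat \<Rightarrow> real \<Rightarrow> complex" where
  "hankel_moment k = laplace (\<lambda>u. (u ^ k) *\<^sub>R hankel_weight u)"

lemma laplace_ok_hankel_weight_power: "laplace_ok (\<lambda>u. (u ^ k) *\<^sub>R hankel_weight u)"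
proof (induction k)
  case 0 thus ?case using laplace_ok_hankel_weight by simp
next
  case (Suc k) thus ?case using laplace_ok_times[OF Suc] by simp
qed

lemma hankel_moment_deriv: "x > 0 \<Longrightarrow> (hankel_moment k has_vector_derivative - hankel_moment (Suc k) x) (at x)"
  using laplace_deriv[OF laplace_ok_hankel_weight_power[of k], of x] by (simp add: hankel_moment_def)

text \<open>Integration by parts for the root: its derivative is (i - u) times the weight, and the
  root itself is u (2 i - u) times the weight. With \<open>hankel_moment_deriv\<close> this is
  Bessel's equation after removal of the factor exp(i x).\<close>

lemma hankel_moment_ode:
  assumes "x > 0"
  shows "\<i> * hankel_moment 0 x - hankel_moment 1 x = of_real x * (2 * \<i> * hankel_moment 1 x - hankel_moment 2 x)"
proof -
  have "laplace (\<lambda>u. (\<i> - of_real u) * hankel_weight u) x = of_real x * laplace hankel_root x"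
  proof (rule laplace_by_parts(1)[OF hankel_root_deriv _ _ _ _ assms, where C = 2])
    show "continuous_on {0<..} (\<lambda>u. (\<i> - of_real u) * hankel_weight u)"
      by (intro continuous_intros continuous_on_hankel_weight)
    thus "laplace_ok (\<lambda>u. (\<i> - of_real u) * hankel_weight u)"
    proof (rule laplace_okI)
      fix u :: real assume u: "u > 0"
      have "norm ((\<i> - of_real u) * hankel_weight u) \<le> norm (\<i> * hankel_weight u) + norm (u *\<^sub>R hankel_weight u)"
        by (metis left_diff_distrib norm_triangle_ineq4 scaleR_conv_of_real)
      also have "\<dots> \<le> u powr (- 1 / 2) + 1"
        using norm_hankel_weight_le[OF u] norm_u_hankel_weight_le[OF u] by (intro add_mono) (simp_all add: norm_mult)
      finally show "norm ((\<i> - of_real u) * hankel_weight u) \<le> 1 * (1 + u + u powr (- 1 / 2))" using u by simp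
    qed
    show "norm (hankel_root u) \<le> 2 * (1 + u)" if "u > 0" for u using norm_hankel_root_bounds(4)[OF that] that by simp
    show "(hankel_root \<longlongrightarrow> 0) (at_right 0)" by (rule hankel_root_tendsto_0)
  qed
  also have "laplace hankel_root x = laplace (\<lambda>u. (2 * \<i>) * ((u ^ 1) *\<^sub>R hankel_weight u) + (- 1) * ((u ^ 2) *\<^sub>R hankel_weight u)) x"
  proof (rule laplace_cong)
    fix u :: real assume u: "u > 0"
    have "hankel_root u = (hankel_root u * hankel_root u) * hankel_weight u" using hankel_root_nz[OF u] by (simp add: hankel_weight_def)
    also have "hankel_root u * hankel_root u = 2 * \<i> * of_real u - of_real (u ^ 2)" unfolding hankel_root_sq by (simp add: complex_eq_iff)
    finally show "hankel_root u = (2 * \<i>) * ((u ^ 1) *\<^sub>R hankel_weight u) + (- 1) * ((u ^ 2) *\<^sub>R hankel_weight u)"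
      by (simp add: scaleR_conv_of_real algebra_simps)
  qed
  also have "\<dots> = 2 * \<i> * hankel_moment 1 x - hankel_moment 2 x"
    by (subst laplace_lincomb[OF laplace_ok_hankel_weight_power laplace_ok_hankel_weight_power assms]) (simp add: hankel_moment_def)
  also have "laplace (\<lambda>u. (\<i> - of_real u) * hankel_weight u) x = laplace (\<lambda>u. \<i> * ((u ^ 0) *\<^sub>R hankel_weight u) + (- 1) * ((u ^ 1) *\<^sub>R hankel_weight u)) x"
    by (intro laplace_cong) (simp add: scaleR_conv_of_real algebra_simps)
  also have "\<dots> = \<i> * hankel_moment 0 x - hankel_moment 1 x"
    by (subst laplace_lincomb[OF laplace_ok_hankel_weight_power laplace_ok_hankel_weight_power assms]) (simp add: hankel_moment_def)
  finally show ?thesis .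
qed

text \<open>Bounding the weight by u^(-1/2) leaves a Gamma integral. Each further moment gains a
  factor 1/x, the source of the decay x^(-3/2) in the asymptotics.\<close>

lemma norm_hankel_moment_le:
  assumes "x > 0"
  shows "norm (hankel_moment k x) \<le> Gamma (real k + 1 / 2) / x powr (real k + 1 / 2)"
proof -
  have a: "real k - 1 / 2 > - 1" by simp
  have "norm (hankel_moment k x) \<le> (LINT u:{0<..}|lborel. norm (exp (- x * u) *\<^sub>R (u ^ k) *\<^sub>R hankel_weight u))"
    unfolding hankel_moment_def laplace_def using laplace_ok_hankel_weight_power[of k] assms
    by (intro set_integral_norm_bound) (simp add: laplace_ok_def)
  also have "\<dots> \<le> (LINT u:{0<..}|lborel. exp (- x * u) * u powr (real k - 1 / 2))"
  proof (rule set_integral_mono)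
    show "set_integrable lborel {0<..} (\<lambda>u. norm (exp (- x * u) *\<^sub>R (u ^ k) *\<^sub>R hankel_weight u))"
      using laplace_ok_hankel_weight_power[of k] assms unfolding laplace_ok_def by (intro set_integrable_norm) blast
    show "set_integrable lborel {0<..} (\<lambda>u. exp (- x * u) * u powr (real k - 1 / 2))"
      by (rule Gamma_powr_scaled(1)[OF a assms])
    fix u :: real assume "u \<in> {0<..}"
    hence u: "u > 0" by simp
    have "u ^ k * norm (hankel_weight u) \<le> u ^ k * u powr (- 1 / 2)"
      using u by (intro mult_left_mono norm_hankel_weight_le) auto
    also have "\<dots> = u powr (real k - 1 / 2)"
      using u powr_add[of u "real k" "- 1 / 2"] by (simp add: powr_realpow)
    finally have "exp (- x * u) * (u ^ k * norm (hankel_weight u)) \<le> exp (- x * u) * u powr (real k - 1 / 2)"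
      by (intro mult_left_mono) auto
    thus "norm (exp (- x * u) *\<^sub>R (u ^ k) *\<^sub>R hankel_weight u) \<le> exp (- x * u) * u powr (real k - 1 / 2)"
      using u by (simp add: abs_mult)
  qed
  also have "\<dots> = Gamma (real k + 1 / 2) / x powr (real k + 1 / 2)"
    using Gamma_powr_scaled(2)[OF a assms] by (simp add: add.commute)
  finally show ?thesis .
qed

text \<open>A primitive of the weight: up to the factor \<open>- \<i>\<close> it is \<open>arcosh (1 + \<i> u)\<close>.\<close>

definition hankel_primitive :: "real \<Rightarrow> complex" where
  "hankel_primitive u = - \<i> * Ln (1 + \<i> * of_real u + hankel_root u)"

lemma hankel_primitive_deriv:
  assumes "u > 0"
  shows "(hankel_primitive has_vector_derivative hankel_weight u) (at u)"
proof -
  define z where "z = 1 + \<i> * of_real u + hankel_root u"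
  have z: "Re z > 1" using hankel_root_Re_Im(1)[OF assms] by (simp add: z_def)
  hence "z \<notin> \<real>\<^sub>\<le>\<^sub>0" by (auto simp: complex_nonpos_Reals_iff)
  hence L: "(Ln has_field_derivative inverse z) (at z)" by (rule has_field_derivative_Ln)
  have "((\<lambda>u. 1 + \<i> * of_real u + hankel_root u) has_vector_derivative (\<i> + (\<i> - of_real u) * hankel_weight u)) (at u)"
    by (rule derivative_eq_intros hankel_root_deriv[OF assms] refl | simp)+
  from field_vector_diff_chain_at[OF this L[unfolded z_def]]
  have "((\<lambda>u. Ln (1 + \<i> * of_real u + hankel_root u)) has_vector_derivative (\<i> + (\<i> - of_real u) * hankel_weight u) * inverse z) (at u)"
    by (simp add: o_def z_def)
  from has_vector_derivative_mult_right[OF this, of "- \<i>"]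
  have d: "(hankel_primitive has_vector_derivative - \<i> * ((\<i> + (\<i> - of_real u) * hankel_weight u) * inverse z)) (at u)"
    unfolding hankel_primitive_def[abs_def] .
  have "z \<noteq> 0" using z by auto
  \<comment> \<open>As for arcosh, the derivative of the argument of \<open>Ln\<close> is a multiple
    of the argument itself, which then cancels.\<close>
  moreover have "\<i> * hankel_root u + (\<i> - of_real u) = \<i> * z" by (simp add: z_def algebra_simps)
  hence "\<i> + (\<i> - of_real u) * hankel_weight u = \<i> * z * hankel_weight u"
    using hankel_root_nz[OF assms] by (simp add: hankel_weight_def field_simps)
  ultimately have "- \<i> * ((\<i> + (\<i> - of_real u) * hankel_weight u) * inverse z) = hankel_weight u" by (simp add: field_simps)
  with d show ?thesis by (simp only:)
qed

lemma norm_Ln_le: "z \<noteq> 0 \<Longrightarrow> norm (Ln z) \<le> \<bar>ln (norm z)\<bar> + pi"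
  using cmod_le[of "Ln z"] Im_Ln_le_pi[of z] mpi_less_Im_Ln[of z] by (auto simp: abs_le_iff)

text \<open>The weight decays only like 1/u, so moment 0 diverges logarithmically as x -> 0. Written
  through the primitive and rescaled, it becomes an integral of exp(-v) times a logarithm, from
  which ln x splits off explicitly.\<close>

lemma hankel_moment_eq_hankel_primitive:
  assumes "x > 0"
  shows "hankel_moment 0 x = of_real x * laplace hankel_primitive x" "laplace_ok hankel_primitive"
proof -
  have b: "norm (hankel_primitive u) \<le> 6 * (1 + u)" if u: "u > 0" for u
  proof -
    define z where "z = 1 + \<i> * of_real u + hankel_root u"
    have "Re z > 1" using hankel_root_Re_Im(1)[OF u] by (simp add: z_def)
    hence z1: "norm z \<ge> 1" using complex_Re_le_cmod[of z] by linarith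
    have "norm z \<le> norm (1 + \<i> * of_real u) + norm (hankel_root u)" unfolding z_def by (rule norm_triangle_ineq)
    also have "\<dots> \<le> (1 + u) + (u + 2)"
      using u norm_hankel_root_bounds(4)[OF u] norm_triangle_ineq[of 1 "\<i> * of_real u"]
      by (intro add_mono) (auto simp: norm_mult)
    finally have "ln (norm z) \<le> 2 + 2 * u" using ln_le_minus_one[of "norm z"] z1 by linarith
    moreover have "ln (norm z) \<ge> 0" using z1 by simp
    ultimately have "norm (Ln z) \<le> 2 + 2 * u + pi" using norm_Ln_le[of z] z1 by fastforce
    moreover have "norm (hankel_primitive u) = norm (Ln z)" by (simp add: hankel_primitive_def z_def norm_mult)
    \<comment> \<open>The norm of z is at most 3 + 2u, so its logarithm is at most 2 + 2u; adding pi
      < 4 gives the constant 6.\<close>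
    ultimately show ?thesis using pi_less_4 u by (simp add: algebra_simps)
  qed
  have l: "(hankel_primitive \<longlongrightarrow> 0) (at_right 0)"
  proof -
    have "((\<lambda>u. - \<i> * Ln (1 + \<i> * of_real u + hankel_root u)) \<longlongrightarrow> - \<i> * Ln (1 + \<i> * of_real 0 + 0)) (at_right 0)"
      by (intro tendsto_intros hankel_root_tendsto_0) auto
    thus ?thesis by (simp add: hankel_primitive_def[abs_def])
  qed
  have "laplace hankel_weight x = of_real x * laplace hankel_primitive x" "laplace_ok hankel_primitive"
    by (rule laplace_by_parts[OF hankel_primitive_deriv continuous_on_hankel_weight laplace_ok_hankel_weight b l assms]; assumption)+
  thus "hankel_moment 0 x = of_real x * laplace hankel_primitive x" "laplace_ok hankel_primitive" by (simp_all add: hankel_moment_def)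
qed

section \<open>Limits of the moments as x tends to 0\<close>

lemma scaled_hankel_root_tendsto:
  assumes "v > 0" "\<And>i. X i > 0" "X \<longlonglongrightarrow> 0"
  shows "(\<lambda>i. of_real (X i) * hankel_root (v / X i)) \<longlonglongrightarrow> \<i> * of_real v"
proof (rule LIM_zero_cancel, rule Lim_null_comparison)
  show "eventually (\<lambda>i. norm (of_real (X i) * hankel_root (v / X i) - \<i> * of_real v) \<le> X i * 2) sequentially"
  proof (intro always_eventually allI)
    fix i
    have X: "X i > 0" by (rule assms)
    have "of_real (X i) * hankel_root (v / X i) - \<i> * of_real v = of_real (X i) * (hankel_root (v / X i) - \<i> * of_real (v / X i))"
      using X by (simp add: field_simps)
    hence "norm (of_real (X i) * hankel_root (v / X i) - \<i> * of_real v) = X i * norm (hankel_root (v / X i) - \<i> * of_real (v / X i))"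
      using X by (simp add: norm_mult)
    also have "\<dots> \<le> X i * 2"
      using X assms(1) by (intro mult_left_mono norm_hankel_root_minus_le) auto
    finally show "norm (of_real (X i) * hankel_root (v / X i) - \<i> * of_real v) \<le> X i * 2" .
  qed
  show "(\<lambda>i. X i * 2) \<longlonglongrightarrow> 0" using tendsto_mult_left_zero[OF assms(3)] by simp
qed

text \<open>After scaling the integrand is exp(-v) times u * weight(u) at u = v/x. That product
  tends to 1/i = -i and is bounded by 1. This is the pole of H_1 at 0.\<close>

lemma hankel_moment_1_limit:
  assumes "\<And>i. X i > 0" "X \<longlonglongrightarrow> 0"
  shows "(\<lambda>i. of_real (X i) * hankel_moment 1 (X i)) \<longlonglongrightarrow> - \<i>"
proof -
  let ?W = "\<lambda>u. (u ^ 1) *\<^sub>R hankel_weight u"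
  let ?f = "\<lambda>i v. indicat_real {0<..} v *\<^sub>R (exp (- v) *\<^sub>R ?W (v / X i))"
  let ?l = "\<lambda>v. indicat_real {0<..} v *\<^sub>R (exp (- v) *\<^sub>R (- \<i>))"
  have e: "set_integrable lborel {0<..} (\<lambda>v::real. exp (- v))"
    using Gamma_powr_scaled(1)[of 0 1] unfolding set_integrable_def
    by (rule Bochner_Integration.integrable_cong[THEN iffD1, rotated -1]) (auto simp: indicator_def)
  have "(\<lambda>i. \<integral>v. ?f i v \<partial>lborel) \<longlonglongrightarrow> (\<integral>v. ?l v \<partial>lborel)"
  proof (rule integral_dominated_convergence[where w = "\<lambda>v::real. indicat_real {0<..} v *\<^sub>R exp (- v)"])
    show "integrable lborel (\<lambda>v::real. indicat_real {0<..} v *\<^sub>R exp (- v))"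
      using e unfolding set_integrable_def .
    show "?l \<in> borel_measurable lborel" by measurable
    show "?f i \<in> borel_measurable lborel" for i
    proof -
      have "continuous_on {0<..} (\<lambda>v. exp (- v) *\<^sub>R ?W (v / X i))"
        using assms(1)[of i]
        by (intro continuous_intros continuous_on_compose2[OF continuous_on_hankel_weight]) auto
      from set_borel_measurable_continuous_lborel[OF this] show ?thesis by (simp add: set_borel_measurable_def)
    qed
    show "AE v in lborel. (\<lambda>i. ?f i v) \<longlonglongrightarrow> ?l v"
    proof (intro AE_I2)
      fix v :: real
      show "(\<lambda>i. ?f i v) \<longlonglongrightarrow> ?l v"
      proof (cases "v > 0")
        case True
        have "(\<lambda>i. of_real v / (of_real (X i) * hankel_root (v / X i))) \<longlonglongrightarrow> of_real v / (\<i> * of_real v)"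
          using True by (intro tendsto_divide tendsto_const scaled_hankel_root_tendsto assms) auto
        also have "of_real v / (\<i> * of_real v) = - \<i>" using True by (simp add: field_simps)
        also have "(\<lambda>i. of_real v / (of_real (X i) * hankel_root (v / X i))) = (\<lambda>i. ?W (v / X i))"
          using assms(1) by (auto simp: hankel_weight_def scaleR_conv_of_real fun_eq_iff)
        finally show ?thesis by (intro tendsto_intros)
      qed (simp add: indicator_def)
    qed
    show "AE v in lborel. norm (?f i v) \<le> indicat_real {0<..} v *\<^sub>R exp (- v)" for i
    proof (intro AE_I2)
      fix v :: real
      show "norm (?f i v) \<le> indicat_real {0<..} v *\<^sub>R exp (- v)"
      proof (cases "v > 0")
        case True
        hence "norm (?W (v / X i)) \<le> 1" using norm_u_hankel_weight_le[of "v / X i"] assms(1)[of i] by simp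
        hence "exp (- v) * norm (?W (v / X i)) \<le> exp (- v) * 1" by (intro mult_left_mono) auto
        thus ?thesis using True by simp
      qed (simp add: indicator_def)
    qed
  qed
  moreover have "(\<integral>v. ?f i v \<partial>lborel) = of_real (X i) * hankel_moment 1 (X i)" for i
    using laplace_scale[OF assms(1), of i ?W] unfolding hankel_moment_def set_lebesgue_integral_def by simp
  moreover have "(\<integral>v. ?l v \<partial>lborel) = - \<i>"
  proof -
    have "(LINT v:{0<..}|lborel. exp (- v)) = (LINT v:{0<..}|lborel. exp (- v) * v powr 0 :: real)"
      by (intro set_lebesgue_integral_cong) auto
    hence "(LINT v:{0<..}|lborel. exp (- v :: real)) = 1"
      using LINT_exp_powr[of 0] by simp
    hence "(\<integral>v. (indicat_real {0<..} v *\<^sub>R exp (- (v::real))) *\<^sub>R (- \<i>) \<partial>lborel) = - \<i>"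
      using e unfolding set_lebesgue_integral_def set_integrable_def
      by (subst Bochner_Integration.integral_scaleR_left) auto
    thus ?thesis by simp
  qed
  ultimately show ?thesis by simp
qed

text \<open>With u = v/x, x (1 + i u + root) tends to 2 i v, and the factor x accounts for the
  subtracted ln x. What remains is the integral of exp(-v) (-i) (ln 2 + ln v + i pi/2), where
  \<open>LINT_exp_ln\<close> supplies Euler's constant.\<close>

lemma hankel_moment_0_limit:
  assumes "\<And>i. X i > 0" "\<And>i. X i \<le> 1" "X \<longlonglongrightarrow> 0"
  shows "(\<lambda>i. hankel_moment 0 (X i) - \<i> * of_real (ln (X i))) \<longlonglongrightarrow> of_real (pi / 2) + \<i> * of_real (euler_mascheroni - ln 2)"
proof -
  let ?z = "\<lambda>x v. of_real x + \<i> * of_real v + of_real x * hankel_root (v / x)"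
  let ?f = "\<lambda>i v. indicat_real {0<..} v *\<^sub>R (exp (- v) *\<^sub>R (- \<i> * Ln (?z (X i) v)))"
  let ?l = "\<lambda>v. indicat_real {0<..} v *\<^sub>R (exp (- v) *\<^sub>R (- \<i> * Ln (2 * \<i> * of_real v)))"
  let ?w = "\<lambda>v::real. indicat_real {0<..} v *\<^sub>R (2 * (exp (- v) * v powr (- 1 / 2)) + 3 * (exp (- v) * v powr 1) + 6 * (exp (- v) * v powr 0))"
  have Ln2: "Ln (2 * \<i> * of_real v) = of_real (ln 2 + ln v) + \<i> * of_real (pi / 2)" if "v > 0" for v
  proof -
    have "2 * \<i> * of_real v = of_real (2 * v) * \<i>" by simp
    also have "Ln \<dots> = of_real (ln (2 * v)) + Ln \<i>" using that by (subst Ln_times_of_real) (auto simp: Ln_of_real simp del: of_real_mult)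
    finally show ?thesis using that by (simp add: ln_mult)
  qed
  \<comment> \<open>The lower bound on the imaginary part bounds |z| below by v for every i, so ln
    |z| cannot drop below ln v; this makes the majorant independent of i.\<close>
  have z: "Im (?z (X i) v) \<ge> v" "Re (?z (X i) v) > 0" "norm (?z (X i) v) \<le> 3 + 2 * v" if "v > 0" for i v
  proof -
    have u: "v / X i > 0" using that assms(1)[of i] by simp
    show "Im (?z (X i) v) \<ge> v" "Re (?z (X i) v) > 0"
      using hankel_root_Re_Im[OF u] assms(1)[of i] by (auto simp: add_pos_pos)
    have "norm (?z (X i) v) \<le> norm (complex_of_real (X i)) + norm (\<i> * complex_of_real v) + norm (of_real (X i) * hankel_root (v / X i))"
      by (intro order_trans[OF norm_triangle_ineq] add_mono norm_triangle_ineq order_refl)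
    also have "\<dots> \<le> X i + v + X i * (v / X i + 2)"
      using norm_hankel_root_bounds(4)[OF u] that assms(1)[of i]
      by (intro add_mono) (auto simp: norm_mult simp del: times_divide_eq_right)
    also have "\<dots> \<le> 3 + 2 * v" using assms(1)[of i] assms(2)[of i] by (simp add: distrib_left)
    finally show "norm (?z (X i) v) \<le> 3 + 2 * v" .
  qed
  have "(\<lambda>i. \<integral>v. ?f i v \<partial>lborel) \<longlonglongrightarrow> (\<integral>v. ?l v \<partial>lborel)"
  proof (rule integral_dominated_convergence[where w = ?w])
    have "set_integrable lborel {0<..} (\<lambda>v::real. 2 * (exp (- v) * v powr (- 1 / 2)) + 3 * (exp (- v) * v powr 1) + 6 * (exp (- v) * v powr 0))"
      by (intro set_integral_add(1) set_integrable_mult_right set_integrable_exp_powr) auto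
    thus "integrable lborel ?w" unfolding set_integrable_def .
    have "continuous_on {0<..} (\<lambda>v. exp (- v) *\<^sub>R (- \<i> * (of_real (ln 2 + ln v) + \<i> * of_real (pi / 2))))"
      by (intro continuous_intros) auto
    hence "continuous_on {0<..} (\<lambda>v. exp (- v) *\<^sub>R (- \<i> * Ln (2 * \<i> * of_real v)))"
      by (rule continuous_on_cong[THEN iffD1, rotated -1]) (auto simp: Ln2)
    from set_borel_measurable_continuous_lborel[OF this]
    show "?l \<in> borel_measurable lborel" by (simp add: set_borel_measurable_def)
    show "?f i \<in> borel_measurable lborel" for i
    proof -
      have "?z (X i) v \<notin> \<real>\<^sub>\<le>\<^sub>0" if "v > 0" for v
        using z(2)[OF that, of i] unfolding complex_nonpos_Reals_iff by linarith
      hence "continuous_on {0<..} (\<lambda>v. exp (- v) *\<^sub>R (- \<i> * Ln (?z (X i) v)))"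
        using assms(1)[of i]
        by (intro continuous_intros continuous_on_compose2[OF continuous_on_hankel_root]) auto
      from set_borel_measurable_continuous_lborel[OF this] show ?thesis by (simp add: set_borel_measurable_def)
    qed
    show "AE v in lborel. (\<lambda>i. ?f i v) \<longlonglongrightarrow> ?l v"
    proof (intro AE_I2)
      fix v :: real
      show "(\<lambda>i. ?f i v) \<longlonglongrightarrow> ?l v"
      proof (cases "v > 0")
        case True
        have "(\<lambda>i. ?z (X i) v) \<longlonglongrightarrow> of_real 0 + \<i> * of_real v + \<i> * of_real v"
          by (intro tendsto_intros scaled_hankel_root_tendsto assms True)
        hence "(\<lambda>i. ?z (X i) v) \<longlonglongrightarrow> 2 * \<i> * of_real v" by (simp add: algebra_simps)
        moreover have "2 * \<i> * of_real v \<notin> \<real>\<^sub>\<le>\<^sub>0"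
          using True by (auto simp: complex_nonpos_Reals_iff)
        ultimately show ?thesis by (intro tendsto_intros)
      qed (simp add: indicator_def)
    qed
    show "AE v in lborel. norm (?f i v) \<le> ?w v" for i
    proof (intro AE_I2)
      fix v :: real
      show "norm (?f i v) \<le> ?w v"
      proof (cases "v > 0")
        case True
        let ?n = "norm (?z (X i) v)"
        have n: "v \<le> ?n" using z(1)[OF True, of i] abs_Im_le_cmod[of "?z (X i) v"] by linarith
        have "0 < ?n" using n True by linarith
        hence "ln v \<le> ln ?n" using n True by (subst ln_le_cancel_iff) auto
        moreover have "ln ?n \<le> 2 + 2 * v"
          using ln_le_minus_one[of ?n] z(3)[OF True, of i] n True by linarith
        ultimately have "\<bar>ln ?n\<bar> \<le> \<bar>ln v\<bar> + 2 + 2 * v" using True by linarith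
        moreover have "?z (X i) v \<noteq> 0" using n True by auto
        ultimately have "norm (Ln (?z (X i) v)) \<le> 2 * v powr (- 1 / 2) + 3 * v + 6"
          using norm_Ln_le[of "?z (X i) v"] abs_ln_le[OF True] pi_less_4 by linarith
        hence "exp (- v) * norm (Ln (?z (X i) v)) \<le> exp (- v) * (2 * v powr (- 1 / 2) + 3 * v + 6)"
          by (intro mult_left_mono) auto
        moreover have "norm (?f i v) = exp (- v) * norm (Ln (?z (X i) v))"
          using True by (simp add: norm_mult)
        ultimately show ?thesis using True by (simp add: algebra_simps)
      qed (simp add: indicator_def)
    qed
  qed
  moreover have "(\<integral>v. ?f i v \<partial>lborel) = hankel_moment 0 (X i) - \<i> * of_real (ln (X i))" for i
  proof -
    let ?x = "X i"
    have x: "?x > 0" by (rule assms)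
    have L: "Ln (?z ?x v) = \<i> * hankel_primitive (v / ?x) + of_real (ln ?x)" if "v > 0" for v
    proof -
      have "?z ?x v = of_real ?x * (1 + \<i> * of_real (v / ?x) + hankel_root (v / ?x))"
        using x by (simp add: field_simps)
      moreover have "Re (1 + \<i> * of_real (v / ?x) + hankel_root (v / ?x)) > 0"
        using hankel_root_Re_Im(1)[of "v / ?x"] that x by simp
      hence "1 + \<i> * of_real (v / ?x) + hankel_root (v / ?x) \<noteq> 0" by (metis less_irrefl zero_complex.sel(1))
      ultimately have "Ln (?z ?x v) = of_real (ln ?x) + Ln (1 + \<i> * of_real (v / ?x) + hankel_root (v / ?x))"
        using x by (simp only:) (subst Ln_times_of_real, auto simp: Ln_of_real)
      thus ?thesis by (simp add: hankel_primitive_def algebra_simps)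
    qed
    have iA: "set_integrable lborel {0<..} (\<lambda>v. exp (- v) *\<^sub>R hankel_primitive (v / ?x))"
    proof -
      have "integrable lborel (\<lambda>v. indicat_real {0<..} (0 + (1 / ?x) * v) *\<^sub>R (exp (- ?x * (0 + (1 / ?x) * v)) *\<^sub>R hankel_primitive (0 + (1 / ?x) * v)))"
        using x hankel_moment_eq_hankel_primitive(2)[OF x] unfolding laplace_ok_def set_integrable_def
        by (intro lborel_integrable_real_affine) auto
      thus ?thesis unfolding set_integrable_def
        by (rule Bochner_Integration.integrable_cong[THEN iffD1, rotated -1])
          (use x in \<open>auto simp: indicator_def zero_less_divide_iff\<close>)
    qed
    have ic: "set_integrable lborel {0<..} (\<lambda>v. of_real (exp (- v) * v powr 0) * (\<i> * of_real (ln ?x)))"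
      by (intro set_integrable_mult_left) (use set_integrable_exp_powr[of 0] in
        \<open>simp add: set_integrable_def scaleR_conv_of_real del: powr_zero_eq_one flip: of_real_mult\<close>)
    have "(\<integral>v. ?f i v \<partial>lborel) = (LINT v:{0<..}|lborel. exp (- v) *\<^sub>R hankel_primitive (v / ?x) - of_real (exp (- v) * v powr 0) * (\<i> * of_real (ln ?x)))"
      unfolding set_lebesgue_integral_def
      by (intro Bochner_Integration.integral_cong refl)
        (auto simp: indicator_def L scaleR_conv_of_real distrib_left right_diff_distrib)
    also have "\<dots> = (LINT v:{0<..}|lborel. exp (- v) *\<^sub>R hankel_primitive (v / ?x)) - (LINT v:{0<..}|lborel. of_real (exp (- v) * v powr 0) * (\<i> * of_real (ln ?x)))"
      by (rule set_integral_diff(2)[OF iA ic])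
    also have "(LINT v:{0<..}|lborel. of_real (exp (- v) * v powr 0) * (\<i> * of_real (ln ?x))) = \<i> * of_real (ln ?x)"
      unfolding set_integral_mult_left set_integral_complex_of_real using LINT_exp_powr[of 0]
      by (simp del: powr_zero_eq_one)
    also have "(LINT v:{0<..}|lborel. exp (- v) *\<^sub>R hankel_primitive (v / ?x)) = hankel_moment 0 ?x"
      unfolding hankel_moment_eq_hankel_primitive(1)[OF x] laplace_scale[OF x] ..
    finally show ?thesis .
  qed
  moreover have "(\<integral>v. ?l v \<partial>lborel) = of_real (pi / 2) + \<i> * of_real (euler_mascheroni - ln 2)"
  proof -
    have i1: "set_integrable lborel {0<..} (\<lambda>v. of_real (exp (- v) * ln v) * (- \<i>))"
      by (intro set_integrable_mult_left) (use set_integrable_exp_ln in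
        \<open>simp add: set_integrable_def scaleR_conv_of_real flip: of_real_mult\<close>)
    have i2: "set_integrable lborel {0<..} (\<lambda>v. of_real (exp (- v) * v powr 0) * (of_real (pi / 2) - \<i> * of_real (ln 2)))"
      by (intro set_integrable_mult_left) (use set_integrable_exp_powr[of 0] in
        \<open>simp add: set_integrable_def scaleR_conv_of_real del: powr_zero_eq_one flip: of_real_mult\<close>)
    have "(\<integral>v. ?l v \<partial>lborel) = (LINT v:{0<..}|lborel. of_real (exp (- v) * ln v) * (- \<i>) + of_real (exp (- v) * v powr 0) * (of_real (pi / 2) - \<i> * of_real (ln 2)))"
      unfolding set_lebesgue_integral_def
      by (intro Bochner_Integration.integral_cong refl)
        (auto simp: indicator_def Ln2 scaleR_conv_of_real distrib_left right_diff_distrib)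
    also have "\<dots> = of_real (- euler_mascheroni) * (- \<i>) + of_real 1 * (of_real (pi / 2) - \<i> * of_real (ln 2))"
      unfolding set_integral_add(2)[OF i1 i2] set_integral_mult_left set_integral_complex_of_real
      using LINT_exp_powr[of 0] LINT_exp_ln by (simp del: powr_zero_eq_one)
    also have "\<dots> = of_real (pi / 2) + \<i> * of_real (euler_mascheroni - ln 2)"
      by (simp add: algebra_simps)
    finally show ?thesis .
  qed
  ultimately show ?thesis by simp
qed

subsection \<open>Identifying the Hankel function\<close>

definition hankel_int :: "real \<Rightarrow> complex" where
  "hankel_int x = of_real (2 / pi) * (exp (\<i> * of_real x) * hankel_moment 0 x)"

text \<open>The negative of the derivative of \<open>hankel_int\<close>, as H_1 = - H_0'
  dictates.\<close>

definition hankel_int1 :: "real \<Rightarrow> complex" where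
  "hankel_int1 x = - of_real (2 / pi) * (exp (\<i> * of_real x) * (\<i> * hankel_moment 0 x - hankel_moment 1 x))"

text \<open>
  Bessel's equation of order zero as a first-order system, satisfied by \<open>(J\<^sub>0, J\<^sub>1)\<close> and \<open>(Y\<^sub>0, Y\<^sub>1)\<close>.
\<close>

definition bessel_pair :: "(real \<Rightarrow> complex) \<Rightarrow> (real \<Rightarrow> complex) \<Rightarrow> bool" where
  "bessel_pair f f1 \<longleftrightarrow> (\<forall>x>0. (f has_vector_derivative - f1 x) (at x) \<and>
     (f1 has_vector_derivative f x - f1 x / of_real x) (at x))"

lemma bessel_pair_hankel_int: "bessel_pair hankel_int hankel_int1"
  unfolding bessel_pair_def
proof (intro allI impI conjI)
  fix x :: real assume x: "x > 0"
  have e: "((\<lambda>x. exp (\<i> * of_real x)) has_vector_derivative \<i> * exp (\<i> * of_real x)) (at x)"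
  proof -
    have "((\<lambda>x. \<i> * of_real x) has_vector_derivative \<i>) (at x)"
      by (rule derivative_eq_intros refl | simp)+
    from field_vector_diff_chain_at[OF this DERIV_exp] show ?thesis by (simp add: o_def)
  qed
  have p0: "(hankel_moment 0 has_vector_derivative - hankel_moment 1 x) (at x)"
    using hankel_moment_deriv[OF x, of 0] by simp
  have p1: "(hankel_moment 1 has_vector_derivative - hankel_moment 2 x) (at x)"
    using hankel_moment_deriv[OF x, of 1] by (simp add: numeral_2_eq_2)
  have "(hankel_int has_vector_derivative of_real (2 / pi) * (exp (\<i> * of_real x) * - hankel_moment 1 x + \<i> * exp (\<i> * of_real x) * hankel_moment 0 x)) (at x)"
    unfolding hankel_int_def[abs_def] by (intro has_vector_derivative_mult_right has_vector_derivative_mult e p0)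
  thus "(hankel_int has_vector_derivative - hankel_int1 x) (at x)"
    by (rule has_vector_derivative_eq_rhs) (simp add: hankel_int1_def algebra_simps)
  have d: "(hankel_int1 has_vector_derivative - of_real (2 / pi) * (exp (\<i> * of_real x) * (\<i> * - hankel_moment 1 x - (- hankel_moment 2 x))
      + \<i> * exp (\<i> * of_real x) * (\<i> * hankel_moment 0 x - hankel_moment 1 x))) (at x)"
    unfolding hankel_int1_def[abs_def]
    by (intro has_vector_derivative_mult_right has_vector_derivative_mult has_vector_derivative_diff e p0 p1)
  have ode: "hankel_moment 2 x = 2 * \<i> * hankel_moment 1 x - (\<i> * hankel_moment 0 x - hankel_moment 1 x) / of_real x"
    using hankel_moment_ode[OF x] x by (simp add: field_simps)
  show "(hankel_int1 has_vector_derivative hankel_int x - hankel_int1 x / of_real x) (at x)"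
    by (rule has_vector_derivative_eq_rhs[OF d], unfold ode) (use x in \<open>simp add: hankel_int_def hankel_int1_def field_simps\<close>)
qed

lemma bessel_pair_of_real:
  assumes "\<And>x. x > 0 \<Longrightarrow> (f has_real_derivative - f1 x) (at x)"
    "\<And>x. x > 0 \<Longrightarrow> (f1 has_real_derivative f x - f1 x / x) (at x)"
  shows "bessel_pair (\<lambda>x. of_real (f x)) (\<lambda>x. of_real (f1 x))"
  unfolding bessel_pair_def
  using has_vector_derivative_of_real[OF assms(1), where 'a = complex]
    has_vector_derivative_of_real[OF assms(2), where 'a = complex] by simp

lemma bessel_pair_J: "bessel_pair (\<lambda>x. of_real (J_int 0 x)) (\<lambda>x. of_real (J_int 1 x))"
proof (rule bessel_pair_of_real)
  fix x :: real assume x: "x > 0"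
  show "(J_int 0 has_real_derivative - J_int 1 x) (at x)"
    using DERIV_J_int[OF x, of 0] by simp
  show "(J_int 1 has_real_derivative J_int 0 x - J_int 1 x / x) (at x)"
    by (rule DERIV_cong[OF DERIV_J_int[OF x, of 1]])
      (use J_int_rec[OF x, of 1] x in \<open>simp add: field_simps\<close>)
qed

lemma bessel_pair_Y: "bessel_pair (\<lambda>x. of_real (Y_int 0 x)) (\<lambda>x. of_real (Y_int 1 x))"
proof (rule bessel_pair_of_real)
  fix x :: real assume x: "x > 0"
  show "(Y_int 0 has_real_derivative - Y_int 1 x) (at x)"
    using DERIV_Y_int[OF x, of 0] by simp
  show "(Y_int 1 has_real_derivative Y_int 0 x - Y_int 1 x / x) (at x)"
    by (rule DERIV_cong[OF DERIV_Y_int[OF x, of 1]])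
      (use Y_int_rec[OF x, of 1] x in \<open>simp add: field_simps\<close>)
qed

lemma bessel_pair_lincomb:
  assumes "bessel_pair f f1" "bessel_pair g g1"
  shows "bessel_pair (\<lambda>x. f x + c * g x) (\<lambda>x. f1 x + c * g1 x)"
  unfolding bessel_pair_def
proof (intro allI impI conjI)
  fix x :: real assume x: "x > 0"
  have 1: "((\<lambda>x. f x + c * g x) has_vector_derivative - f1 x + c * - g1 x) (at x)"
    "((\<lambda>x. f1 x + c * g1 x) has_vector_derivative (f x - f1 x / of_real x) + c * (g x - g1 x / of_real x)) (at x)"
    using assms[unfolded bessel_pair_def, rule_format, OF x]
    by (intro has_vector_derivative_add has_vector_derivative_mult_right; simp)+
  show "((\<lambda>x. f x + c * g x) has_vector_derivative - (f1 x + c * g1 x)) (at x)"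
    by (rule has_vector_derivative_eq_rhs[OF 1(1)]) simp
  show "((\<lambda>x. f1 x + c * g1 x) has_vector_derivative f x + c * g x - (f1 x + c * g1 x) / of_real x) (at x)"
    by (rule has_vector_derivative_eq_rhs[OF 1(2)]) (simp add: algebra_simps add_divide_distrib)
qed

text \<open>Abel's identity: the damping term f1/x makes the Wronskian proportional to 1/x.\<close>

lemma bessel_wronskian:
  assumes "bessel_pair f f1" "bessel_pair g g1"
  shows "\<exists>c. \<forall>x>0. of_real x * (f x * g1 x - f1 x * g x) = c"
proof -
  have "\<exists>c. \<forall>x\<in>{0<..}. of_real x * (f x * g1 x - f1 x * g x) = c"
  proof (rule has_vector_derivative_zero_constant)
    fix x :: real assume "x \<in> {0<..}"
    hence x: "x > 0" by simp
    note d = assms[unfolded bessel_pair_def, rule_format, OF x]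
    have "((\<lambda>x. of_real x * (f x * g1 x - f1 x * g x)) has_vector_derivative
       (of_real x * ((f x * (g x - g1 x / of_real x) + - f1 x * g1 x) - (f1 x * - g1 x + (f x - f1 x / of_real x) * g x))
        + of_real 1 * (f x * g1 x - f1 x * g x))) (at x)"
      by (intro has_vector_derivative_mult has_vector_derivative_diff has_vector_derivative_of_real DERIV_ident)
        (use d in auto)
    hence "((\<lambda>x. of_real x * (f x * g1 x - f1 x * g x)) has_vector_derivative 0) (at x)"
      by (rule has_vector_derivative_eq_rhs) (use x in \<open>simp add: field_simps\<close>)
    thus "((\<lambda>x. of_real x * (f x * g1 x - f1 x * g x)) has_vector_derivative 0) (at x within {0<..})"
      by (rule has_vector_derivative_at_within)
  qed (simp, blast)
  thus ?thesis by (auto simp: Ball_def)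
qed

section \<open>Behaviour of J and Y at the origin\<close>

lemma x_ln_tendsto_0: "((\<lambda>x::real. x * ln x) \<longlongrightarrow> 0) (at_right 0)"
proof (rule Lim_null_comparison)
  show "eventually (\<lambda>x. norm (x * ln x) \<le> 2 * sqrt x + x * x) (at_right 0)"
    unfolding eventually_at_filter
  proof (intro always_eventually allI impI)
    fix x :: real assume "x \<in> {0<..}"
    hence x: "x > 0" by simp
    have "norm (x * ln x) = x * \<bar>ln x\<bar>" using x by (simp add: abs_mult)
    also have "\<dots> \<le> x * (2 * x powr (- 1 / 2) + x)"
      using x by (intro mult_left_mono abs_ln_le) auto
    also have "x * x powr (- 1 / 2) = sqrt x"
      using x powr_add[of x 1 "- 1 / 2"] by (simp add: powr_half_sqrt)
    hence "x * (2 * x powr (- 1 / 2) + x) = 2 * sqrt x + x * x" by (simp add: distrib_left)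
    finally show "norm (x * ln x) \<le> 2 * sqrt x + x * x" .
  qed
  have "((\<lambda>x. 2 * sqrt x + x * x) \<longlongrightarrow> 2 * sqrt 0 + 0 * 0) (at_right (0::real))"
    by (intro tendsto_intros)
  thus "((\<lambda>x. 2 * sqrt x + x * x) \<longlongrightarrow> 0) (at_right (0::real))" by simp
qed

lemma bessel_E_at_right_0:
  "(bessel_E p \<longlongrightarrow> rGamma (p + 1)) (at_right 0)"
  "(bessel_E_order p \<longlongrightarrow> deriv rGamma (p + 1)) (at_right 0)"
proof -
  have "isCont (bessel_E p) 0" "isCont (bessel_E_order p) 0"
    using DERIV_bessel_E DERIV_isCont by blast+
  hence "(bessel_E p \<longlongrightarrow> bessel_E p 0) (at 0)" "(bessel_E_order p \<longlongrightarrow> bessel_E_order p 0) (at 0)"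
    by (simp_all add: isCont_def)
  moreover have "bessel_E p 0 = rGamma (p + 1)" "bessel_E_order p 0 = deriv rGamma (p + 1)"
    by (simp_all add: bessel_E_def bessel_E_order_def rGamma_seq_def deriv_rGamma_seq_def)
  ultimately show "(bessel_E p \<longlongrightarrow> rGamma (p + 1)) (at_right 0)"
    "(bessel_E_order p \<longlongrightarrow> deriv rGamma (p + 1)) (at_right 0)"
    by (auto intro: tendsto_mono[OF at_le])
qed

text \<open>The data that single out H_0 among the solutions: the constant term of Y_0, where
  Euler's constant is the derivative of 1/Gamma at 1, and the pole of Y_1.\<close>

lemma bessel_0_limits:
  "(J_int 0 \<longlongrightarrow> 1) (at_right 0)"
  "(J_int 1 \<longlongrightarrow> 0) (at_right 0)"
  "((\<lambda>x. Y_int 0 x - 2 / pi * ln x) \<longlongrightarrow> 2 / pi * (euler_mascheroni - ln 2)) (at_right 0)"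
  "((\<lambda>x. x * Y_int 0 x) \<longlongrightarrow> 0) (at_right 0)"
  "((\<lambda>x. x * Y_int 1 x) \<longlongrightarrow> - 2 / pi) (at_right 0)"
proof -
  have ev: "eventually (\<lambda>x::real. x > 0) (at_right 0)" by (rule eventually_at_right_less)
  note E0 = bessel_E_at_right_0[of 0, simplified] note E1 = bessel_E_at_right_0[of 1]
  have J0: "J_int 0 x = bessel_E 0 x" "J_int 1 x = x / 2 * bessel_E 1 x"
     "J_ord 0 x = ln (x / 2) * bessel_E 0 x + bessel_E_order 0 x"
     "J_ord 1 x = x / 2 * (ln (x / 2) * bessel_E 1 x + bessel_E_order 1 x)" if "x > 0" for x
    using that by (simp_all add: J_int_def J_ord_def bessel_J_eq bessel_J_order_def)
  show j0: "(J_int 0 \<longlongrightarrow> 1) (at_right 0)"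
    by (rule Lim_transform_eventually[OF E0(1)]) (use ev in eventually_elim, simp add: J0)
  have half: "((\<lambda>x. x / 2) \<longlongrightarrow> 0 / 2) (at_right (0::real))" by (intro tendsto_intros) auto
  have "((\<lambda>x. x / 2 * bessel_E 1 x) \<longlongrightarrow> 0 / 2 * rGamma (1 + 1)) (at_right 0)"
    by (rule tendsto_mult[OF half E1(1)])
  hence "((\<lambda>x. x / 2 * bessel_E 1 x) \<longlongrightarrow> 0) (at_right 0)" by simp
  thus "(J_int 1 \<longlongrightarrow> 0) (at_right 0)"
    by (rule Lim_transform_eventually) (use ev in eventually_elim, simp add: J0)
  have xl: "((\<lambda>x::real. x * ln (x / 2)) \<longlongrightarrow> 0) (at_right 0)"
  proof -
    have "((\<lambda>x::real. x * ln x - x * ln 2) \<longlongrightarrow> 0 - 0 * ln 2) (at_right 0)"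
      by (rule tendsto_diff[OF x_ln_tendsto_0 tendsto_mult[OF tendsto_ident_at tendsto_const]])
    hence "((\<lambda>x::real. x * ln x - x * ln 2) \<longlongrightarrow> 0) (at_right 0)" by simp
    thus ?thesis
      by (rule Lim_transform_eventually)
        (use ev in eventually_elim, simp add: ln_div algebra_simps)
  qed
  \<comment> \<open>E_0 multiplies a logarithm in Y_0, so E_0 -> 1 is not enough; E_0 - 1 = o(x) is,
    as x ln x tends to 0.\<close>
  have d0: "((\<lambda>x. (bessel_E 0 x - 1) / x) \<longlongrightarrow> 0) (at_right 0)"
  proof -
    have "(bessel_E 0 has_real_derivative 0) (at 0)" using DERIV_bessel_E(1)[of 0 0] by simp
    hence "((\<lambda>x. (bessel_E 0 x - bessel_E 0 0) / (x - 0)) \<longlongrightarrow> 0) (at 0)"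
      by (simp add: has_field_derivative_iff)
    moreover have "bessel_E 0 0 = 1" by (simp add: bessel_E_def rGamma_seq_def)
    ultimately show ?thesis by (auto intro: tendsto_mono[OF at_le])
  qed
  have Y0: "Y_int 0 x - 2 / pi * ln x =
      2 / pi * ((x * ln (x / 2)) * ((bessel_E 0 x - 1) / x) + bessel_E_order 0 x - ln 2)" if "x > 0" for x
    using that by (simp add: Y_int_eq J0 ln_div field_simps)
  have "((\<lambda>x. 2 / pi * ((x * ln (x / 2)) * ((bessel_E 0 x - 1) / x) + bessel_E_order 0 x - ln 2))
      \<longlongrightarrow> 2 / pi * (0 * 0 + deriv rGamma 1 - ln 2)) (at_right 0)"
    by (rule tendsto_mult[OF tendsto_const tendsto_diff[OF tendsto_add[OF tendsto_mult[OF xl d0] E0(2)] tendsto_const]])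
  hence "((\<lambda>x. 2 / pi * ((x * ln (x / 2)) * ((bessel_E 0 x - 1) / x) + bessel_E_order 0 x - ln 2))
      \<longlongrightarrow> 2 / pi * (euler_mascheroni - ln 2)) (at_right 0)"
    by (simp add: deriv_rGamma_1)
  thus y0: "((\<lambda>x. Y_int 0 x - 2 / pi * ln x) \<longlongrightarrow> 2 / pi * (euler_mascheroni - ln 2)) (at_right 0)"
    by (rule Lim_transform_eventually) (use ev in eventually_elim, simp only: Y0)
  have "((\<lambda>x. x * (Y_int 0 x - 2 / pi * ln x) + 2 / pi * (x * ln x)) \<longlongrightarrow>
      0 * (2 / pi * (euler_mascheroni - ln 2)) + 2 / pi * 0) (at_right 0)"
    by (rule tendsto_add[OF tendsto_mult[OF tendsto_ident_at y0] tendsto_mult[OF tendsto_const x_ln_tendsto_0]])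
  thus "((\<lambda>x. x * Y_int 0 x) \<longlongrightarrow> 0) (at_right 0)" by (simp add: algebra_simps)
  have Y1: "x * Y_int 1 x = 2 / pi * (x / 2 * ((x * ln (x / 2)) * bessel_E 1 x + x * bessel_E_order 1 x) - J_int 0 x)"
    if "x > 0" for x
  proof -
    \<comment> \<open>The pole of Y_1 is the inhomogeneous term of this recurrence at order
      0.\<close>
    have "J_ord (- 1) x = 2 / x * J_int 0 x - J_ord 1 x" using J_ord_rec[OF that, of 0] by simp
    hence "Y_int 1 x = (2 * J_ord 1 x - 2 / x * J_int 0 x) / pi" using that by (simp add: Y_int_eq)
    thus ?thesis using that unfolding J0(4)[OF that] by (simp add: field_simps)
  qed
  have "((\<lambda>x. 2 / pi * (x / 2 * ((x * ln (x / 2)) * bessel_E 1 x + x * bessel_E_order 1 x) - J_int 0 x))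
      \<longlongrightarrow> 2 / pi * (0 / 2 * (0 * rGamma (1 + 1) + 0 * deriv rGamma (1 + 1)) - 1)) (at_right 0)"
    by (rule tendsto_mult[OF tendsto_const tendsto_diff[OF tendsto_mult[OF half
          tendsto_add[OF tendsto_mult[OF xl E1(1)] tendsto_mult[OF tendsto_ident_at E1(2)]]] j0]])
  hence "((\<lambda>x. 2 / pi * (x / 2 * ((x * ln (x / 2)) * bessel_E 1 x + x * bessel_E_order 1 x) - J_int 0 x))
      \<longlongrightarrow> - 2 / pi) (at_right 0)" by simp
  thus "((\<lambda>x. x * Y_int 1 x) \<longlongrightarrow> - 2 / pi) (at_right 0)"
    by (rule Lim_transform_eventually) (use ev in eventually_elim, simp only: Y1)
qed

definition bessel_H :: "int \<Rightarrow> real \<Rightarrow> complex" where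
  "bessel_H k x = of_real (J_int k x) + \<i> * of_real (Y_int k x)"

text \<open>The difference z of both sides solves the same system, with z -> 0 and x z1 -> 0 at the
  origin. Its Wronskian with J therefore vanishes, so z is a multiple of J_0, and the multiple is 0
  because J_0 -> 1. The Wronskian with Y cannot be read off directly, since x z1 would meet the
  logarithm of Y_0.\<close>

lemma bessel_H_eq_hankel_int:
  assumes "x > 0"
  shows "bessel_H 0 x = hankel_int x" "bessel_H 1 x = hankel_int1 x"
proof -
  define X where "X i = 1 / (1 + real i)" for i
  have X: "X i > 0" "X i \<le> 1" for i by (auto simp: X_def)
  have X0: "X \<longlonglongrightarrow> 0"
    unfolding X_def using LIMSEQ_inverse_real_of_nat by (simp add: inverse_eq_divide add.commute)
  have Xr: "filterlim X (at_right 0) sequentially"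
    using X0 X by (intro tendsto_imp_filterlim_at_right) auto
  note lims = bessel_0_limits[THEN filterlim_compose, OF Xr]
  have H: "bessel_pair (bessel_H 0) (bessel_H 1)"
    unfolding bessel_H_def[abs_def] by (rule bessel_pair_lincomb[OF bessel_pair_J bessel_pair_Y])
  define z where "z x = hankel_int x + (- 1) * bessel_H 0 x" for x
  define z1 where "z1 x = hankel_int1 x + (- 1) * bessel_H 1 x" for x
  have Z: "bessel_pair z z1"
    unfolding z_def[abs_def] z1_def[abs_def] by (rule bessel_pair_lincomb[OF bessel_pair_hankel_int H])
  have ex: "(\<lambda>i. exp (\<i> * of_real (X i))) \<longlonglongrightarrow> 1"
  proof -
    have "(\<lambda>i. exp (\<i> * of_real (X i))) \<longlonglongrightarrow> exp (\<i> * of_real 0)" by (intro tendsto_intros X0)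
    thus ?thesis by simp
  qed
  have XlnX: "(\<lambda>i. X i * ln (X i)) \<longlonglongrightarrow> 0" using filterlim_compose[OF x_ln_tendsto_0 Xr] .
  \<comment> \<open>Lets the factor exp(i x) be replaced by 1 in front of the logarithmic part of
    moment 0.\<close>
  have exln: "(\<lambda>i. (exp (\<i> * of_real (X i)) - 1) * of_real (ln (X i))) \<longlonglongrightarrow> 0"
  proof -
    have "filterlim (\<lambda>i. \<i> * of_real (X i)) (at 0) sequentially"
      unfolding filterlim_at
    proof
      show "\<forall>\<^sub>F i in sequentially. \<i> * complex_of_real (X i) \<in> UNIV \<and> \<i> * complex_of_real (X i) \<noteq> 0"
        using X(1) by (auto simp: less_imp_neq[symmetric])
      show "(\<lambda>i. \<i> * complex_of_real (X i)) \<longlonglongrightarrow> 0"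
        using tendsto_mult[OF tendsto_const[of \<i>] tendsto_of_real[OF X0]] by simp
    qed
    from filterlim_compose[OF lim_exp_minus_1 this]
    have "(\<lambda>i. (exp (\<i> * of_real (X i)) - 1) / (\<i> * of_real (X i)) * (\<i> * of_real (X i * ln (X i)))) \<longlonglongrightarrow> 1 * (\<i> * of_real 0)"
      by (rule tendsto_mult[OF _ tendsto_mult[OF tendsto_const tendsto_of_real[OF XlnX]]])
    moreover have "(exp (\<i> * of_real (X i)) - 1) / (\<i> * of_real (X i)) * (\<i> * of_real (X i * ln (X i)))
       = (exp (\<i> * of_real (X i)) - 1) * of_real (ln (X i))" for i
      using X(1)[of i] by simp
    ultimately show ?thesis by simp
  qed
  let ?c = "of_real (pi / 2) + \<i> * of_real (euler_mascheroni - ln 2)"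
  have P0: "(\<lambda>i. hankel_moment 0 (X i) - \<i> * of_real (ln (X i))) \<longlonglongrightarrow> ?c"
    by (rule hankel_moment_0_limit[OF X X0])
  have P1: "(\<lambda>i. of_real (X i) * hankel_moment 1 (X i)) \<longlonglongrightarrow> - \<i>"
    by (rule hankel_moment_1_limit[OF X(1) X0])
  have xP0: "(\<lambda>i. of_real (X i) * hankel_moment 0 (X i)) \<longlonglongrightarrow> 0"
  proof -
    have "(\<lambda>i. of_real (X i) * (hankel_moment 0 (X i) - \<i> * of_real (ln (X i))) + \<i> * of_real (X i * ln (X i))) \<longlonglongrightarrow> of_real 0 * ?c + \<i> * of_real 0"
      by (rule tendsto_add[OF tendsto_mult[OF tendsto_of_real[OF X0] P0] tendsto_mult[OF tendsto_const tendsto_of_real[OF XlnX]]])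
    thus ?thesis by (simp add: algebra_simps)
  qed
  have zlim: "(\<lambda>i. z (X i)) \<longlonglongrightarrow> 0"
  proof -
    have "(\<lambda>i. of_real (2 / pi) * (exp (\<i> * of_real (X i)) * (hankel_moment 0 (X i) - \<i> * of_real (ln (X i)))
        + \<i> * ((exp (\<i> * of_real (X i)) - 1) * of_real (ln (X i))))
        - of_real (J_int 0 (X i)) - \<i> * of_real (Y_int 0 (X i) - 2 / pi * ln (X i)))
       \<longlonglongrightarrow> of_real (2 / pi) * (1 * ?c + \<i> * 0) - of_real 1 - \<i> * of_real (2 / pi * (euler_mascheroni - ln 2))"
      by (rule tendsto_diff[OF tendsto_diff[OF tendsto_mult[OF tendsto_const tendsto_add[OF tendsto_mult[OF ex P0]
            tendsto_mult[OF tendsto_const exln]]] tendsto_of_real[OF lims(1)]] tendsto_mult[OF tendsto_const tendsto_of_real[OF lims(3)]]])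
    also have "of_real (2 / pi) * (1 * ?c + \<i> * 0) - of_real 1 - \<i> * of_real (2 / pi * (euler_mascheroni - ln 2)) = 0"
      by (simp add: field_simps)
    also have "(\<lambda>i. of_real (2 / pi) * (exp (\<i> * of_real (X i)) * (hankel_moment 0 (X i) - \<i> * of_real (ln (X i)))
        + \<i> * ((exp (\<i> * of_real (X i)) - 1) * of_real (ln (X i))))
        - of_real (J_int 0 (X i)) - \<i> * of_real (Y_int 0 (X i) - 2 / pi * ln (X i))) = (\<lambda>i. z (X i))"
      by (simp add: fun_eq_iff z_def hankel_int_def bessel_H_def algebra_simps)
    finally show ?thesis .
  qed
  have z1lim: "(\<lambda>i. of_real (X i) * z1 (X i)) \<longlonglongrightarrow> 0"
  proof -
    have "(\<lambda>i. - of_real (2 / pi) * (exp (\<i> * of_real (X i)) * (\<i> * (of_real (X i) * hankel_moment 0 (X i)) - of_real (X i) * hankel_moment 1 (X i)))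
         - of_real (X i) * of_real (J_int 1 (X i)) - \<i> * of_real (X i * Y_int 1 (X i)))
       \<longlonglongrightarrow> - of_real (2 / pi) * (1 * (\<i> * 0 - (- \<i>))) - of_real 0 * of_real 0 - \<i> * of_real (- 2 / pi)"
      by (rule tendsto_diff[OF tendsto_diff[OF tendsto_mult[OF tendsto_const tendsto_mult[OF ex tendsto_diff[OF
            tendsto_mult[OF tendsto_const xP0] P1]]] tendsto_mult[OF tendsto_of_real[OF X0] tendsto_of_real[OF lims(2)]]]
            tendsto_mult[OF tendsto_const tendsto_of_real[OF lims(5)]]])
    also have "- of_real (2 / pi) * (1 * (\<i> * 0 - (- \<i>))) - of_real 0 * of_real 0 - \<i> * of_real (- 2 / pi) = (0 :: complex)"
      by simp
    also have "(\<lambda>i. - of_real (2 / pi) * (exp (\<i> * of_real (X i)) * (\<i> * (of_real (X i) * hankel_moment 0 (X i)) - of_real (X i) * hankel_moment 1 (X i)))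
         - of_real (X i) * of_real (J_int 1 (X i)) - \<i> * of_real (X i * Y_int 1 (X i))) = (\<lambda>i. of_real (X i) * z1 (X i))"
      by (simp add: fun_eq_iff z1_def hankel_int1_def bessel_H_def algebra_simps)
    finally show ?thesis .
  qed
  obtain c1 where c1: "\<And>x. x > 0 \<Longrightarrow> of_real x * (z x * of_real (J_int 1 x) - z1 x * of_real (J_int 0 x)) = c1"
    using bessel_wronskian[OF Z bessel_pair_J] by blast
  obtain c2 where c2: "\<And>x. x > 0 \<Longrightarrow> of_real x * (z x * of_real (Y_int 1 x) - z1 x * of_real (Y_int 0 x)) = c2"
    using bessel_wronskian[OF Z bessel_pair_Y] by blast
  obtain w where w: "\<And>x. x > 0 \<Longrightarrow> of_real x * (complex_of_real (J_int 0 x) * of_real (Y_int 1 x) - of_real (J_int 1 x) * of_real (Y_int 0 x)) = w"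
    using bessel_wronskian[OF bessel_pair_J bessel_pair_Y] by blast
  have "(\<lambda>i. of_real (X i) * (z (X i) * of_real (J_int 1 (X i))) - (of_real (X i) * z1 (X i)) * of_real (J_int 0 (X i)))
      \<longlonglongrightarrow> of_real 0 * (0 * of_real 0) - 0 * of_real 1"
    by (rule tendsto_diff[OF tendsto_mult[OF tendsto_of_real[OF X0] tendsto_mult[OF zlim tendsto_of_real[OF lims(2)]]]
          tendsto_mult[OF z1lim tendsto_of_real[OF lims(1)]]])
  moreover have "of_real (X i) * (z (X i) * of_real (J_int 1 (X i))) - (of_real (X i) * z1 (X i)) * of_real (J_int 0 (X i)) = c1" for i
    using c1[OF X(1)[of i]] by (simp add: algebra_simps)
  ultimately have c10: "c1 = 0" by (simp add: LIMSEQ_const_iff)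
  have "(\<lambda>i. complex_of_real (J_int 0 (X i)) * of_real (X i * Y_int 1 (X i)) - of_real (J_int 1 (X i)) * of_real (X i * Y_int 0 (X i)))
      \<longlonglongrightarrow> of_real 1 * of_real (- 2 / pi) - of_real 0 * of_real 0"
    by (rule tendsto_diff[OF tendsto_mult[OF tendsto_of_real[OF lims(1)] tendsto_of_real[OF lims(5)]]
          tendsto_mult[OF tendsto_of_real[OF lims(2)] tendsto_of_real[OF lims(4)]]])
  moreover have "complex_of_real (J_int 0 (X i)) * of_real (X i * Y_int 1 (X i)) - of_real (J_int 1 (X i)) * of_real (X i * Y_int 0 (X i)) = w" for i
    using w[OF X(1)[of i]] by (simp add: algebra_simps)
  ultimately have w0: "w = - of_real (2 / pi)" by (simp add: LIMSEQ_const_iff)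
  \<comment> \<open>Cramer's rule: the constants c1 and c2 are linear equations for z and z1 with
    determinant w.\<close>
  have key: "z x * w = of_real (J_int 0 x) * c2" "z1 x * w = of_real (J_int 1 x) * c2" if "x > 0" for x
  proof -
    have "z x * w = of_real (J_int 0 x) * c2 - of_real (Y_int 0 x) * c1"
      unfolding c1[OF that, symmetric] c2[OF that, symmetric] w[OF that, symmetric] by (simp add: algebra_simps)
    thus "z x * w = of_real (J_int 0 x) * c2" using c10 by simp
    have "z1 x * w = of_real (J_int 1 x) * c2 - of_real (Y_int 1 x) * c1"
      unfolding c1[OF that, symmetric] c2[OF that, symmetric] w[OF that, symmetric] by (simp add: algebra_simps)
    thus "z1 x * w = of_real (J_int 1 x) * c2" using c10 by simp
  qed
  have "(\<lambda>i. z (X i) * w) \<longlonglongrightarrow> 0 * w" by (rule tendsto_mult[OF zlim tendsto_const])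
  moreover have "(\<lambda>i. of_real (J_int 0 (X i)) * c2) \<longlonglongrightarrow> of_real 1 * c2" by (rule tendsto_mult[OF tendsto_of_real[OF lims(1)] tendsto_const])
  ultimately have "c2 = 0" using LIMSEQ_unique key(1)[OF X(1)] by fastforce
  moreover have "w \<noteq> 0" by (simp add: w0)
  ultimately have "z x = 0" "z1 x = 0" using key[OF assms] by auto
  thus "bessel_H 0 x = hankel_int x" "bessel_H 1 x = hankel_int1 x" by (simp_all add: z_def z1_def)
qed

subsection \<open>Asymptotics at infinity\<close>

lemma bessel_H_rec: "x > 0 \<Longrightarrow> bessel_H (k + 1) x = of_real (2 * of_int k / x) * bessel_H k x - bessel_H (k - 1) x"
  using J_int_rec[of x k] Y_int_rec[of x k] unfolding bessel_H_def
  by (simp add: complex_eq_iff algebra_simps)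

text \<open>The second bound propagates through H_(k+2) + i H_(k+1) = i (H_(k+1) + i H_k) + 2 (k +
  1)/x H_(k+1), whose last term is small by the first bound, so both are carried along. In the base
  case moment 0 cancels and H_1 + i H_0 is a multiple of moment 1.\<close>

lemma bessel_H_asymp:
  "\<exists>C. \<forall>x\<ge>1. norm (bessel_H (int k) x) \<le> C / sqrt x \<and>
       norm (bessel_H (int k + 1) x + \<i> * bessel_H (int k) x) \<le> C / (x * sqrt x)"
proof (induction k)
  case 0
  define C where "C = 2 / pi * (Gamma (1 / 2) + Gamma (3 / 2))"
  have G: "Gamma (1 / 2) > (0::real)" "Gamma (3 / 2) > (0::real)" by (auto intro: Gamma_real_pos)
  have "norm (bessel_H 0 x) \<le> C / sqrt x \<and> norm (bessel_H 1 x + \<i> * bessel_H 0 x) \<le> C / (x * sqrt x)"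
    if x: "x \<ge> 1" for x
  proof
    have x0: "x > 0" using x by simp
    have "norm (bessel_H 0 x) = 2 / pi * norm (hankel_moment 0 x)"
      unfolding bessel_H_eq_hankel_int[OF x0] hankel_int_def by (simp add: norm_mult norm_divide)
    also have "\<dots> \<le> 2 / pi * (Gamma (1 / 2) / sqrt x)"
      using norm_hankel_moment_le[OF x0, of 0] x0 by (intro mult_left_mono) (auto simp: powr_half_sqrt)
    also have "\<dots> \<le> C / sqrt x" using G x0 by (simp add: C_def field_simps)
    finally show "norm (bessel_H 0 x) \<le> C / sqrt x" .
    have "hankel_int1 x + \<i> * hankel_int x = of_real (2 / pi) * (exp (\<i> * of_real x) * hankel_moment 1 x)"
      by (simp add: hankel_int_def hankel_int1_def algebra_simps)
    hence "norm (bessel_H 1 x + \<i> * bessel_H 0 x) = 2 / pi * norm (hankel_moment 1 x)"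
      unfolding bessel_H_eq_hankel_int[OF x0] by (simp add: norm_mult norm_divide)
    also have "\<dots> \<le> 2 / pi * (Gamma (3 / 2) / (x * sqrt x))"
    proof -
      have "x powr (1 + 1 / 2) = x * sqrt x" using x0 by (subst powr_add) (simp add: powr_half_sqrt)
      thus ?thesis using norm_hankel_moment_le[OF x0, of 1] by (intro mult_left_mono) auto
    qed
    also have "\<dots> \<le> C / (x * sqrt x)" using G x0 by (simp add: C_def field_simps)
    finally show "norm (bessel_H 1 x + \<i> * bessel_H 0 x) \<le> C / (x * sqrt x)" .
  qed
  thus ?case by auto
next
  case (Suc k)
  then obtain C where C: "\<And>x. x \<ge> 1 \<Longrightarrow> norm (bessel_H (int k) x) \<le> C / sqrt x"
     "\<And>x. x \<ge> 1 \<Longrightarrow> norm (bessel_H (int k + 1) x + \<i> * bessel_H (int k) x) \<le> C / (x * sqrt x)" by blast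
  have C0: "C \<ge> 0" using order_trans[OF norm_ge_zero C(1)[of 1]] by simp
  \<comment> \<open>The first summand bounds H_(k+1) through H_(k+1) = (H_(k+1) + i H_k) - i H_k,
    the other two its relation to H_(k+2).\<close>
  define D where "D = 2 * C + C + 2 * (real k + 1) * (2 * C)"
  have "norm (bessel_H (int k + 1) x) \<le> D / sqrt x \<and>
     norm (bessel_H (int k + 1 + 1) x + \<i> * bessel_H (int k + 1) x) \<le> D / (x * sqrt x)" if x: "x \<ge> 1" for x
  proof -
    have x0: "x > 0" using x by simp
    let ?e = "bessel_H (int k + 1) x + \<i> * bessel_H (int k) x"
    have "bessel_H (int k + 1) x = ?e + (- \<i>) * bessel_H (int k) x" by simp
    hence "norm (bessel_H (int k + 1) x) \<le> norm ?e + norm (bessel_H (int k) x)"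
      by (metis mult_1 norm_ii norm_minus_cancel norm_mult norm_triangle_ineq)
    also have "\<dots> \<le> C / (x * sqrt x) + C / sqrt x" by (intro add_mono C x)
    also have "\<dots> \<le> C / sqrt x + C / sqrt x"
      using C0 x by (intro add_mono divide_left_mono) auto
    finally have b: "norm (bessel_H (int k + 1) x) \<le> 2 * C / sqrt x" by simp
    have "bessel_H (int k + 1 + 1) x + \<i> * bessel_H (int k + 1) x
        = \<i> * ?e + of_real (2 * (real k + 1) / x) * bessel_H (int k + 1) x"
      using bessel_H_rec[OF x0, of "int k + 1"] by (simp add: algebra_simps)
    also have "norm \<dots> \<le> norm (\<i> * ?e) + norm (of_real (2 * (real k + 1) / x) * bessel_H (int k + 1) x)"
      by (rule norm_triangle_ineq)
    also have "\<dots> = norm ?e + 2 * (real k + 1) / x * norm (bessel_H (int k + 1) x)"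
      using x0 by (simp only: norm_mult norm_of_real norm_ii) simp
    also have "\<dots> \<le> C / (x * sqrt x) + 2 * (real k + 1) / x * (2 * C / sqrt x)"
      using x0 by (intro add_mono C x mult_left_mono b) auto
    also have "\<dots> = (C + 2 * (real k + 1) * (2 * C)) / (x * sqrt x)"
      using x0 by (simp add: field_simps)
    also have "\<dots> \<le> D / (x * sqrt x)"
      using x0 C0 unfolding D_def by (intro divide_right_mono) auto
    finally have 2: "norm (bessel_H (int k + 1 + 1) x + \<i> * bessel_H (int k + 1) x) \<le> D / (x * sqrt x)" .
    have "2 * C / sqrt x \<le> D / sqrt x"
      using x0 C0 unfolding D_def by (intro divide_right_mono) auto
    with b 2 show ?thesis by linarith
  qed
  thus ?case by (auto simp: add_ac)
qed

text \<open>Turns estimates for products of Hankel functions, whose moduli do not oscillate, into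
  estimates for the brackets.\<close>

lemma JY_eq_Im: "JY k l x = Im (bessel_H k x * bessel_H l x)"
  by (simp add: JY_def bessel_H_def)

lemma bessel_H_asymp_pair:
  "\<exists>C\<ge>0. \<forall>x\<ge>1. norm (bessel_H (int k) x) \<le> C / sqrt x \<and> norm (bessel_H 0 x) \<le> C / sqrt x \<and> norm (bessel_H 1 x) \<le> C / sqrt x \<and>
     norm (bessel_H (int k + 1) x + \<i> * bessel_H (int k) x) \<le> C / (x * sqrt x) \<and>
     norm (bessel_H 1 x + \<i> * bessel_H 0 x) \<le> C / (x * sqrt x)"
proof -
  obtain C where C: "\<And>x. x \<ge> 1 \<Longrightarrow> norm (bessel_H (int k) x) \<le> C / sqrt x"
     "\<And>x. x \<ge> 1 \<Longrightarrow> norm (bessel_H (int k + 1) x + \<i> * bessel_H (int k) x) \<le> C / (x * sqrt x)"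
    using bessel_H_asymp[of k] by blast
  obtain A where A: "\<And>x. x \<ge> 1 \<Longrightarrow> norm (bessel_H 0 x) \<le> A / sqrt x"
     "\<And>x. x \<ge> 1 \<Longrightarrow> norm (bessel_H 1 x + \<i> * bessel_H 0 x) \<le> A / (x * sqrt x)"
    using bessel_H_asymp[of 0] by auto
  obtain B where B: "\<And>x. x \<ge> 1 \<Longrightarrow> norm (bessel_H 1 x) \<le> B / sqrt x"
    using bessel_H_asymp[of 1] by auto
  have nn: "0 \<le> A" "0 \<le> B" "0 \<le> C"
    using order_trans[OF norm_ge_zero A(1)[of 1]] order_trans[OF norm_ge_zero B[of 1]]
      order_trans[OF norm_ge_zero C(1)[of 1]] by simp_all
  define D where "D = A + B + C"
  have le: "A / y \<le> D / y" "B / y \<le> D / y" "C / y \<le> D / y" if "y > 0" for y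
    using that nn unfolding D_def by (auto intro!: divide_right_mono)
  show ?thesis
  proof (intro exI[of _ D] conjI allI impI)
    show "0 \<le> D" using nn by (simp add: D_def)
    fix x :: real assume x: "x \<ge> 1"
    hence s: "sqrt x > 0" "x * sqrt x > 0" by auto
    show "norm (bessel_H (int k) x) \<le> D / sqrt x" by (rule order_trans[OF C(1)[OF x] le(3)[OF s(1)]])
    show "norm (bessel_H 0 x) \<le> D / sqrt x" by (rule order_trans[OF A(1)[OF x] le(1)[OF s(1)]])
    show "norm (bessel_H 1 x) \<le> D / sqrt x" by (rule order_trans[OF B[OF x] le(2)[OF s(1)]])
    show "norm (bessel_H (int k + 1) x + \<i> * bessel_H (int k) x) \<le> D / (x * sqrt x)"
      by (rule order_trans[OF C(2)[OF x] le(3)[OF s(2)]])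
    show "norm (bessel_H 1 x + \<i> * bessel_H 0 x) \<le> D / (x * sqrt x)"
      by (rule order_trans[OF A(2)[OF x] le(1)[OF s(2)]])
  qed
qed

lemma JY_bound: "\<exists>C. \<forall>x\<ge>1. \<bar>JY (int k) 0 x\<bar> \<le> C / x \<and> \<bar>JY (int k) 1 x\<bar> \<le> C / x"
proof -
  obtain C where C: "C \<ge> 0" "\<And>x. x \<ge> 1 \<Longrightarrow> norm (bessel_H (int k) x) \<le> C / sqrt x"
    "\<And>x. x \<ge> 1 \<Longrightarrow> norm (bessel_H 0 x) \<le> C / sqrt x" "\<And>x. x \<ge> 1 \<Longrightarrow> norm (bessel_H 1 x) \<le> C / sqrt x"
    using bessel_H_asymp_pair[of k] by blast
  have "\<bar>JY (int k) l x\<bar> \<le> C * C / x" if x: "x \<ge> 1" and l: "l = 0 \<or> l = 1" for l x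
  proof -
    have "\<bar>JY (int k) l x\<bar> \<le> norm (bessel_H (int k) x) * norm (bessel_H l x)"
      unfolding JY_eq_Im by (metis abs_Im_le_cmod norm_mult)
    also have "\<dots> \<le> (C / sqrt x) * (C / sqrt x)"
      using C x l by (intro mult_mono) auto
    also have "\<dots> = C * C / x" using x by simp
    finally show ?thesis .
  qed
  thus ?thesis by blast
qed

lemma tendsto_0_at_top_inverse:
  fixes f :: "real \<Rightarrow> real"
  assumes "\<And>x. x \<ge> 1 \<Longrightarrow> \<bar>f x\<bar> \<le> C / x"
  shows "(f \<longlongrightarrow> 0) at_top"
proof (rule Lim_null_comparison)
  show "eventually (\<lambda>x. norm (f x) \<le> C / x) at_top"
    using eventually_ge_at_top[of 1] by eventually_elim (use assms in simp)
  show "((\<lambda>x. C / x) \<longlongrightarrow> 0) at_top"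
    by (intro tendsto_divide_0[OF tendsto_const] filterlim_at_top_imp_at_infinity filterlim_ident)
qed

lemma JY_tendsto_0: "(JY (int k) 0 \<longlongrightarrow> 0) at_top" "(JY (int k) 1 \<longlongrightarrow> 0) at_top"
  using JY_bound[of k] tendsto_0_at_top_inverse by blast+

text \<open>Since \<open>H\<^sub>k\<^sub>+\<^sub>1 \<sim> - \<i> H\<^sub>k\<close> at infinity, the leading terms cancel in the following combinations.\<close>

lemma JY_cancel:
  "((\<lambda>x. x * (JY (int k + 1) 1 x + JY (int k) 0 x)) \<longlongrightarrow> 0) at_top"
  "((\<lambda>x. x * (JY (int k + 1) 0 x - JY (int k) 1 x)) \<longlongrightarrow> 0) at_top"
proof -
  obtain C where C: "C \<ge> 0" "\<And>x. x \<ge> 1 \<Longrightarrow> norm (bessel_H (int k) x) \<le> C / sqrt x"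
    "\<And>x. x \<ge> 1 \<Longrightarrow> norm (bessel_H 0 x) \<le> C / sqrt x" "\<And>x. x \<ge> 1 \<Longrightarrow> norm (bessel_H 1 x) \<le> C / sqrt x"
    "\<And>x. x \<ge> 1 \<Longrightarrow> norm (bessel_H (int k + 1) x + \<i> * bessel_H (int k) x) \<le> C / (x * sqrt x)"
    "\<And>x. x \<ge> 1 \<Longrightarrow> norm (bessel_H 1 x + \<i> * bessel_H 0 x) \<le> C / (x * sqrt x)"
    using bessel_H_asymp_pair[of k] by blast
  have sq: "C / (x * sqrt x) * (C / sqrt x) + C / sqrt x * (C / (x * sqrt x)) = 2 * C * C / (x * x)" if "x \<ge> 1" for x
  proof -
    have "C / (x * s) * (C / s) + C / s * (C / (x * s)) = 2 * C * C / (x * (s * s))" for s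
      by (simp add: field_simps)
    from this[of "sqrt x"] show ?thesis using that by simp
  qed
  have "\<bar>x * (JY (int k + 1) 1 x + JY (int k) 0 x)\<bar> \<le> (2 * C * C) / x" if x: "x \<ge> 1" for x
  proof -
    let ?a = "bessel_H (int k + 1) x + \<i> * bessel_H (int k) x" and ?b = "bessel_H 1 x + \<i> * bessel_H 0 x"
    \<comment> \<open>Adding and subtracting i H_k H_1 gives every product one factor of size
      x^(-3/2), so the sum is O(x^(-2)) and survives multiplication by x.\<close>
    have "JY (int k + 1) 1 x + JY (int k) 0 x = Im (?a * bessel_H 1 x - \<i> * (bessel_H (int k) x * ?b))"
      unfolding JY_eq_Im plus_complex.sel(2)[symmetric] by (rule arg_cong[of _ _ Im]) (simp add: algebra_simps)
    hence "\<bar>JY (int k + 1) 1 x + JY (int k) 0 x\<bar> \<le> norm (?a * bessel_H 1 x - \<i> * (bessel_H (int k) x * ?b))"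
      by (simp only: abs_Im_le_cmod)
    also have "\<dots> \<le> norm ?a * norm (bessel_H 1 x) + norm (bessel_H (int k) x) * norm ?b"
      by (rule order_trans[OF norm_triangle_ineq4]) (simp add: norm_mult)
    also have "\<dots> \<le> C / (x * sqrt x) * (C / sqrt x) + C / sqrt x * (C / (x * sqrt x))"
      using x C(1) by (intro add_mono mult_mono C x) auto
    also note sq[OF x]
    finally have "x * \<bar>JY (int k + 1) 1 x + JY (int k) 0 x\<bar> \<le> x * (2 * C * C / (x * x))"
      using x by (intro mult_left_mono) auto
    thus ?thesis using x by (simp add: abs_mult)
  qed
  thus "((\<lambda>x. x * (JY (int k + 1) 1 x + JY (int k) 0 x)) \<longlongrightarrow> 0) at_top"
    by (rule tendsto_0_at_top_inverse)
  have "\<bar>x * (JY (int k + 1) 0 x - JY (int k) 1 x)\<bar> \<le> (2 * C * C) / x" if x: "x \<ge> 1" for x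
  proof -
    let ?a = "bessel_H (int k + 1) x + \<i> * bessel_H (int k) x" and ?b = "bessel_H 1 x + \<i> * bessel_H 0 x"
    have "JY (int k + 1) 0 x - JY (int k) 1 x = Im (?a * bessel_H 0 x - bessel_H (int k) x * ?b)"
      unfolding JY_eq_Im minus_complex.sel(2)[symmetric] by (rule arg_cong[of _ _ Im]) (simp add: algebra_simps)
    hence "\<bar>JY (int k + 1) 0 x - JY (int k) 1 x\<bar> \<le> norm (?a * bessel_H 0 x - bessel_H (int k) x * ?b)"
      by (simp only: abs_Im_le_cmod)
    also have "\<dots> \<le> norm ?a * norm (bessel_H 0 x) + norm (bessel_H (int k) x) * norm ?b"
      by (rule order_trans[OF norm_triangle_ineq4]) (simp add: norm_mult)
    also have "\<dots> \<le> C / (x * sqrt x) * (C / sqrt x) + C / sqrt x * (C / (x * sqrt x))"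
      using x C(1) by (intro add_mono mult_mono C x) auto
    also note sq[OF x]
    finally have "x * \<bar>JY (int k + 1) 0 x - JY (int k) 1 x\<bar> \<le> x * (2 * C * C / (x * x))"
      using x by (intro mult_left_mono) auto
    thus ?thesis using x by (simp add: abs_mult)
  qed
  thus "((\<lambda>x. x * (JY (int k + 1) 0 x - JY (int k) 1 x)) \<longlongrightarrow> 0) at_top"
    by (rule tendsto_0_at_top_inverse)
qed

subsection \<open>The integrals\<close>

lemma set_integrable_inverse_square: "set_integrable lborel {1..} (\<lambda>t::real. 1 / t\<^sup>2)"
  unfolding set_integrable_def
proof (rule integrableI_nonneg)
  show "(\<lambda>t::real. indicat_real {1..} t *\<^sub>R (1 / t\<^sup>2)) \<in> borel_measurable lborel" by measurable
  have "(\<integral>\<^sup>+t. ennreal (1 / t\<^sup>2) * indicator {1..} t \<partial>lborel) = ennreal (0 - (- 1 / 1))"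
  proof (rule nn_integral_FTC_atLeast[where F = "\<lambda>t. - 1 / t" and T = 0 and a = 1])
    show "((\<lambda>t::real. - 1 / t) \<longlongrightarrow> 0) at_top"
      by (intro tendsto_divide_0[OF tendsto_const] filterlim_at_top_imp_at_infinity filterlim_ident)
    fix t :: real assume "1 \<le> t"
    thus "((\<lambda>t. - 1 / t) has_real_derivative 1 / t\<^sup>2) (at t)"
      by (auto intro!: derivative_eq_intros simp: power2_eq_square)
  qed auto
  moreover have "ennreal (indicat_real {1..} t *\<^sub>R (1 / t\<^sup>2)) = ennreal (1 / t\<^sup>2) * indicator {1..} t" for t :: real
    by (auto simp: indicator_def)
  ultimately show "(\<integral>\<^sup>+t. ennreal (indicat_real {1..} t *\<^sub>R (1 / t\<^sup>2)) \<partial>lborel) < \<infinity>" by simp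
qed auto

lemma set_integrable_atLeast:
  fixes f :: "real \<Rightarrow> real"
  assumes cont: "continuous_on {0<..} f" and bd: "\<And>t. t \<ge> 1 \<Longrightarrow> \<bar>f t\<bar> \<le> C / t\<^sup>2" and x: "x > 0"
  shows "set_integrable lborel {x..} f"
proof -
  have "set_integrable lborel {1..} f"
  proof (rule set_integrable_dominated)
    show "set_integrable lborel {1..} (\<lambda>t. C * (1 / t\<^sup>2))"
      by (intro set_integrable_mult_right set_integrable_inverse_square)
    show "set_borel_measurable lborel {1..} f"
      by (intro set_borel_measurable_continuous_lborel continuous_on_subset[OF cont]) auto
  qed (use bd in auto)
  moreover have "set_integrable lborel {x..max 1 x} f"
    using x by (intro borel_integrable_atLeastAtMost' continuous_on_subset[OF cont]) auto
  ultimately have "set_integrable lborel ({1..} \<union> {x..max 1 x}) f"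
    by (intro set_integrable_Un) auto
  thus ?thesis by (rule set_integrable_subset) auto
qed

lemma LINT_atLeast_FTC:
  fixes f F :: "real \<Rightarrow> real"
  assumes int: "set_integrable lborel {x..} f" and cont: "continuous_on {0<..} f"
    and deriv: "\<And>t. t > 0 \<Longrightarrow> (F has_real_derivative f t) (at t)"
    and lim: "(F \<longlongrightarrow> 0) at_top" and x: "x > 0"
  shows "(LINT t:{x..}|lborel. f t) = - F x"
proof -
  have 1: "((\<lambda>b. LINT t:{x..b}|lborel. f t) \<longlongrightarrow> (LINT t:{x..}|lborel. f t)) at_top"
    using int by (intro tendsto_set_lebesgue_integral_at_top) auto
  have "(LINT t:{x..b}|lborel. f t) = F b - F x" if "b \<ge> x" for b
    unfolding set_lebesgue_integral_def
  proof (rule integral_FTC_atLeastAtMost[OF that])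
    show "continuous_on {x..b} f" using x by (intro continuous_on_subset[OF cont]) auto
    fix t assume "x \<le> t" "t \<le> b"
    hence "t > 0" using x by linarith
    from deriv[OF this] have "(F has_vector_derivative f t) (at t)"
      by (simp only: has_real_derivative_iff_has_vector_derivative)
    thus "(F has_vector_derivative f t) (at t within {x..b})"
      by (rule has_vector_derivative_at_within)
  qed
  hence "eventually (\<lambda>b. F b - F x = (LINT t:{x..b}|lborel. f t)) at_top"
    by (intro eventually_mono[OF eventually_ge_at_top[of x]]) simp
  moreover have "((\<lambda>b. F b - F x) \<longlongrightarrow> 0 - F x) at_top" by (intro tendsto_intros lim)
  ultimately have "((\<lambda>b. LINT t:{x..b}|lborel. f t) \<longlongrightarrow> 0 - F x) at_top"
    by (rule Lim_transform_eventually[rotated])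
  from tendsto_unique[OF _ 1 this] show ?thesis by simp
qed

section \<open>Antiderivatives of f/t and f/t^2\<close>

lemma bessel_f_eq: "bessel_f \<mu> x = pi / 4 * JY \<mu> 0 x"
  by (simp add: bessel_f_def JY_def J_int_def Y_int_def)

text \<open>By the recurrences these four brackets are closed under differentiation, with
  coefficients rational in t. The antiderivatives below are combinations of them.\<close>

lemma DERIV_JY_basis:
  assumes "t > 0"
  shows "(JY \<mu> 0 has_real_derivative JY (\<mu> - 1) 0 t - of_int \<mu> / t * JY \<mu> 0 t - JY \<mu> 1 t) (at t)"
    "(JY \<mu> 1 has_real_derivative JY (\<mu> - 1) 1 t - of_int \<mu> / t * JY \<mu> 1 t + JY \<mu> 0 t - JY \<mu> 1 t / t) (at t)"
    "(JY (\<mu> - 1) 0 has_real_derivative (of_int \<mu> - 1) / t * JY (\<mu> - 1) 0 t - JY \<mu> 0 t - JY (\<mu> - 1) 1 t) (at t)"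
    "(JY (\<mu> - 1) 1 has_real_derivative (of_int \<mu> - 1) / t * JY (\<mu> - 1) 1 t - JY \<mu> 1 t + JY (\<mu> - 1) 0 t - JY (\<mu> - 1) 1 t / t) (at t)"
proof -
  have r: "JY k 2 t = 2 / t * JY k 1 t - JY k 0 t" for k
    using JY_rec[OF assms, of 1 k] by (simp add: JY_sym[of k])
  show "(JY \<mu> 0 has_real_derivative JY (\<mu> - 1) 0 t - of_int \<mu> / t * JY \<mu> 0 t - JY \<mu> 1 t) (at t)"
    by (rule DERIV_cong[OF DERIV_JY[OF assms]]) (use JY_rec[OF assms, of \<mu> 0] in \<open>simp add: add_divide_distrib algebra_simps\<close>)
  show "(JY \<mu> 1 has_real_derivative JY (\<mu> - 1) 1 t - of_int \<mu> / t * JY \<mu> 1 t + JY \<mu> 0 t - JY \<mu> 1 t / t) (at t)"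
    by (rule DERIV_cong[OF DERIV_JY[OF assms]]) (use JY_rec[OF assms, of \<mu> 1] in \<open>simp add: r add_divide_distrib algebra_simps\<close>)
  show "(JY (\<mu> - 1) 0 has_real_derivative (of_int \<mu> - 1) / t * JY (\<mu> - 1) 0 t - JY \<mu> 0 t - JY (\<mu> - 1) 1 t) (at t)"
    by (rule DERIV_cong[OF DERIV_JY[OF assms]]) simp
  show "(JY (\<mu> - 1) 1 has_real_derivative (of_int \<mu> - 1) / t * JY (\<mu> - 1) 1 t - JY \<mu> 1 t + JY (\<mu> - 1) 0 t - JY (\<mu> - 1) 1 t / t) (at t)"
    by (rule DERIV_cong[OF DERIV_JY[OF assms]]) (simp add: r add_divide_distrib diff_divide_distrib algebra_simps)
qed

lemma continuous_on_bessel_f: "continuous_on {0<..} (bessel_f \<mu>)"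
proof -
  have "continuous_on {0<..} (JY \<mu> 0)"
    by (intro continuous_at_imp_continuous_on ballI DERIV_isCont[OF DERIV_JY_basis(1)]) auto
  thus ?thesis unfolding bessel_f_eq[abs_def] by (intro continuous_intros)
qed

lemma set_integrable_bessel_f:
  assumes "x > 0"
  shows "set_integrable lborel {x..} (\<lambda>t. bessel_f (int m) t / t)"
    "set_integrable lborel {x..} (\<lambda>t. bessel_f (int m) t / t\<^sup>2)"
proof -
  obtain C where C: "\<And>t. t \<ge> 1 \<Longrightarrow> \<bar>JY (int m) 0 t\<bar> \<le> C / t" using JY_bound[of m] by blast
  have f: "\<bar>bessel_f (int m) t\<bar> \<le> (pi / 4 * C) / t" if "t \<ge> 1" for t
    using mult_left_mono[OF C[OF that], of "pi / 4"] by (simp add: bessel_f_eq abs_mult)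
  have b1: "\<bar>bessel_f (int m) t / t\<bar> \<le> (pi / 4 * C) / t\<^sup>2" if "t \<ge> 1" for t
  proof -
    have "\<bar>bessel_f (int m) t / t\<bar> = \<bar>bessel_f (int m) t\<bar> / t" using that by (simp add: abs_divide)
    also have "\<dots> \<le> (pi / 4 * C) / t / t" using f[OF that] that by (intro divide_right_mono) auto
    finally show ?thesis by (simp add: power2_eq_square)
  qed
  show "set_integrable lborel {x..} (\<lambda>t. bessel_f (int m) t / t)"
    by (rule set_integrable_atLeast[OF _ b1 assms]) (intro continuous_intros continuous_on_bessel_f; auto)
  have b2: "\<bar>bessel_f (int m) t / t\<^sup>2\<bar> \<le> (pi / 4 * C) / t\<^sup>2" if t: "t \<ge> 1" for t
  proof -
    have "\<bar>bessel_f (int m) t / t\<^sup>2\<bar> = \<bar>bessel_f (int m) t / t\<bar> / t"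
      using t by (simp add: abs_divide power2_eq_square)
    also have "\<dots> \<le> \<bar>bessel_f (int m) t / t\<bar> / 1" using t by (intro divide_left_mono) auto
    finally show ?thesis using b1[OF t] by simp
  qed
  show "set_integrable lborel {x..} (\<lambda>t. bessel_f (int m) t / t\<^sup>2)"
    by (rule set_integrable_atLeast[OF _ b2 assms]) (intro continuous_intros continuous_on_bessel_f; auto)
qed

text \<open>The derivative of t (<m,1> + <m-1,0>) is m (<m-1,0> - <m,1>), and m <m,0>' is the same
  plus - m^2 <m,0> / t; the difference isolates f/t. The factor after t is a combination whose
  leading terms cancel, so the antiderivative vanishes at infinity.\<close>

lemma LINT_bessel_f_over_t:
  assumes "x > 0" "m \<ge> 1"
  shows "(real m)\<^sup>2 * (LINT t:{x..}|lborel. bessel_f (int m) t / t)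
    = pi / 4 * (real m * JY (int m) 0 x - x * (JY (int m) 1 x + JY (int m - 1) 0 x))"
proof -
  define F where "F t = - (pi / 4 * (real m * JY (int m) 0 t - t * (JY (int m) 1 t + JY (int m - 1) 0 t))) / (real m)\<^sup>2" for t
  have m: "real m > 0" using assms by simp
  obtain k where k: "m = Suc k" using assms by (metis Suc_le_D One_nat_def)
  have "(LINT t:{x..}|lborel. bessel_f (int m) t / t) = - F x"
  proof (rule LINT_atLeast_FTC[OF set_integrable_bessel_f(1)[OF assms(1)] _ _ _ assms(1)])
    show "continuous_on {0<..} (\<lambda>t. bessel_f (int m) t / t)"
      by (intro continuous_intros continuous_on_bessel_f) auto
    fix t :: real assume t: "t > 0"
    note d = DERIV_JY_basis[OF t, of "int m"]
    note D = DERIV_cdivide[OF DERIV_minus[OF DERIV_cmult[OF DERIV_diff[OF DERIV_cmult[OF d(1)]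
      DERIV_mult[OF DERIV_ident DERIV_add[OF d(2) d(3)]]], of "pi / 4" "real m"]], of "(real m)\<^sup>2"]
    show "(F has_real_derivative bessel_f (int m) t / t) (at t)"
      unfolding F_def[abs_def]
      by (rule DERIV_cong[OF D]) (use t m in \<open>simp add: bessel_f_eq field_simps power2_eq_square\<close>)
  next
    have "((\<lambda>t. - (pi / 4 * (real m * JY (int m) 0 t - t * (JY (int m) 1 t + JY (int m - 1) 0 t))) / (real m)\<^sup>2)
        \<longlongrightarrow> - (pi / 4 * (real m * 0 - 0)) / (real m)\<^sup>2) at_top"
      using m JY_cancel(1)[of k] by (intro tendsto_intros JY_tendsto_0) (auto simp: k add.commute)
    thus "(F \<longlongrightarrow> 0) at_top" by (simp add: F_def[abs_def])
  qed
  thus ?thesis using m by (simp add: F_def field_simps)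
qed

text \<open>With A, B, C, D the four brackets and r = m, t (A - D) has derivative (1 - r)(A + D).
  Its multiple together with (r - 1)/(r + 1) B' yields A + D, which C' cancels. The remaining terms
  of order 1/t are removed by the derivative of (1 - r) A/t, and -(1 - r^2) A/t^2 is left. Dividing
  by 1 - r^2 excludes m = 1.\<close>

lemma LINT_bessel_f_over_t_sq:
  assumes "x > 0" "m \<ge> 2"
  shows "(1 - (real m)\<^sup>2) * (LINT t:{x..}|lborel. bessel_f (int m) t / t\<^sup>2)
    = pi / 4 * (x * ((JY (int m) 0 x + JY (int m + 1) 1 x) / (real m + 1) - (JY (int m) 0 x - JY (int m - 1) 1 x) / (real m - 1))
       + JY (int m - 1) 0 x - real m / x * JY (int m) 0 x - JY (int m) 1 x + JY (int m) 0 x / x)"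
proof -
  define r where "r = real m"
  have r: "r > 1" "r + 1 \<noteq> 0" "r - 1 \<noteq> 0" "1 - r\<^sup>2 \<noteq> 0" "r\<^sup>2 - 1 \<noteq> 0"
  proof -
    show "r > 1" using assms unfolding r_def by simp
    hence "r\<^sup>2 > 1" by (simp add: one_less_power)
    with \<open>r > 1\<close> show "r + 1 \<noteq> 0" "r - 1 \<noteq> 0" "1 - r\<^sup>2 \<noteq> 0" "r\<^sup>2 - 1 \<noteq> 0" by linarith+
  qed
  define a where "a = 1 / (1 - r\<^sup>2)"
  define A B C D where "A = JY (int m) 0" and "B = JY (int m) 1" and "C = JY (int m - 1) 0" and "D = JY (int m - 1) 1"
  define F where "F t = - (a * (pi / 4 * (2 * a * (t * (A t - D t)) + (r - 1) / (r + 1) * B t + C t + (1 - r) * (A t / t))))" for t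
  obtain k where k: "m = Suc k" using assms by (cases m) auto
  have "(LINT t:{x..}|lborel. bessel_f (int m) t / t\<^sup>2) = - F x"
  proof (rule LINT_atLeast_FTC[OF set_integrable_bessel_f(2)[OF assms(1)] _ _ _ assms(1)])
    show "continuous_on {0<..} (\<lambda>t. bessel_f (int m) t / t\<^sup>2)"
      by (intro continuous_intros continuous_on_bessel_f) auto
    fix t :: real assume t: "t > 0"
    note d = DERIV_JY_basis[OF t, of "int m", unfolded of_int_of_nat_eq, folded A_def B_def C_def D_def r_def]
    have "(F has_real_derivative - (a * (pi / 4 * (2 * a * (1 * (A t - D t) + ((C t - r / t * A t - B t) - ((r - 1) / t * D t - B t + C t - D t / t)) * t)
       + (r - 1) / (r + 1) * (D t - r / t * B t + A t - B t / t) + ((r - 1) / t * C t - A t - D t)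
       + (1 - r) * (((C t - r / t * A t - B t) * t - A t * 1) / (t * t)))))) (at t)"
      unfolding F_def[abs_def]
      by (rule DERIV_minus[OF DERIV_cmult[OF DERIV_cmult[OF DERIV_add[OF DERIV_add[OF DERIV_add[OF
            DERIV_cmult[OF DERIV_mult[OF DERIV_ident DERIV_diff[OF d(1) d(4)]]] DERIV_cmult[OF d(2)]] d(3)]
            DERIV_cmult[OF DERIV_divide[OF d(1) DERIV_ident]]]]]]) (use t in simp)
    moreover have "- (a * (pi / 4 * (2 * a * (1 * (A t - D t) + ((C t - r / t * A t - B t) - ((r - 1) / t * D t - B t + C t - D t / t)) * t)
       + (r - 1) / (r + 1) * (D t - r / t * B t + A t - B t / t) + ((r - 1) / t * C t - A t - D t)
       + (1 - r) * (((C t - r / t * A t - B t) * t - A t * 1) / (t * t))))) = bessel_f (int m) t / t\<^sup>2"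
    proof -
      have 1: "2 * a * (1 * (A t - D t) + ((C t - r / t * A t - B t) - ((r - 1) / t * D t - B t + C t - D t / t)) * t)
         = 2 / (1 + r) * (A t + D t)"
      proof -
        have "1 * (A t - D t) + ((C t - r / t * A t - B t) - ((r - 1) / t * D t - B t + C t - D t / t)) * t = (1 - r) * (A t + D t)"
          using t by (simp add: field_simps)
        moreover have "2 * a * (1 - r) = 2 / (1 + r)"
          using r unfolding a_def by (simp add: divide_simps) (simp add: power2_eq_square algebra_simps)
        ultimately show ?thesis by (metis mult.assoc)
      qed
      have 2: "(r - 1) / (r + 1) * (D t - r / t * B t + A t - B t / t) = (r - 1) / (r + 1) * (A t + D t) - (r - 1) * B t / t"
        using r t by (simp add: divide_simps) (simp add: algebra_simps)
      have 3: "2 / (1 + r) * (A t + D t) + (r - 1) / (r + 1) * (A t + D t) = A t + D t"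
        using r by (simp add: divide_simps) (simp add: algebra_simps)
      have "2 / (1 + r) * (A t + D t) + ((r - 1) / (r + 1) * (A t + D t) - (r - 1) * B t / t)
          + ((r - 1) / t * C t - A t - D t) + (1 - r) * (((C t - r / t * A t - B t) * t - A t * 1) / (t * t))
         = - ((1 - r\<^sup>2) * (A t / t\<^sup>2))"
      proof -
        have "(1 - r) * (((C t - r / t * A t - B t) * t - A t * 1) / (t * t)) - (r - 1) * B t / t + (r - 1) / t * C t
           = - ((1 - r\<^sup>2) * (A t / t\<^sup>2))"
          using t by (simp add: field_simps power2_eq_square)
        with 3 show ?thesis by linarith
      qed
      hence "- (a * (pi / 4 * (2 / (1 + r) * (A t + D t) + ((r - 1) / (r + 1) * (A t + D t) - (r - 1) * B t / t)
          + ((r - 1) / t * C t - A t - D t) + (1 - r) * (((C t - r / t * A t - B t) * t - A t * 1) / (t * t)))))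
         = (a * (1 - r\<^sup>2)) * (pi / 4 * (A t / t\<^sup>2))"
        by simp
      also have "a * (1 - r\<^sup>2) = 1" using r by (simp add: a_def)
      finally show ?thesis unfolding 1 2 by (simp add: bessel_f_eq A_def)
    qed
    ultimately show "(F has_real_derivative bessel_f (int m) t / t\<^sup>2) (at t)" by (simp only:)
  next
    have lim: "((\<lambda>t. t * (A t - D t)) \<longlongrightarrow> 0) at_top"
      using JY_cancel(2)[of k] by (simp add: A_def D_def k add.commute)
    have lA: "(A \<longlongrightarrow> 0) at_top" "(B \<longlongrightarrow> 0) at_top" "(C \<longlongrightarrow> 0) at_top"
      using JY_tendsto_0[of m] JY_tendsto_0[of k] by (simp_all add: A_def B_def C_def k)
    have lt: "((\<lambda>t. A t / t) \<longlongrightarrow> 0) at_top"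
      by (rule tendsto_divide_0[OF lA(1) filterlim_at_top_imp_at_infinity[OF filterlim_ident]])
    have "(F \<longlongrightarrow> - (a * (pi / 4 * (2 * a * 0 + (r - 1) / (r + 1) * 0 + 0 + (1 - r) * 0)))) at_top"
      unfolding F_def[abs_def]
      by (intro tendsto_minus tendsto_mult tendsto_add tendsto_const) (fact lim lA lt)+
    thus "(F \<longlongrightarrow> 0) at_top" by simp
  qed
  hence "(1 - r\<^sup>2) * (LINT t:{x..}|lborel. bessel_f (int m) t / t\<^sup>2)
     = ((1 - r\<^sup>2) * a) * (pi / 4 * (2 * a * (x * (A x - D x)) + (r - 1) / (r + 1) * B x + C x + (1 - r) * (A x / x)))"
    by (simp add: F_def)
  also have "(1 - r\<^sup>2) * a = 1" using r by (simp add: a_def)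
  also have "2 * a * (x * (A x - D x)) + (r - 1) / (r + 1) * B x + C x + (1 - r) * (A x / x)
     = x * ((A x + (2 * r / x * B x - D x)) / (r + 1) - (A x - D x) / (r - 1)) + C x - r / x * A x - B x + A x / x"
  proof -
    \<comment> \<open>From here on the boundary value is brought to the shape of
      \<open>bessel_P_sums\<close>: partial fractions for 2/(1 - r^2), and D expressed through the
      bracket of orders m + 1 and 1.\<close>
    have u1: "2 * a = 1 / (r + 1) - 1 / (r - 1)"
      using r unfolding a_def by (simp add: divide_simps) (simp add: power2_eq_square algebra_simps)
    have u2: "(r - 1) / (r + 1) * B x = 2 * r / (r + 1) * B x - B x"
      using r by (simp add: divide_simps) (simp add: algebra_simps)
    have u3: "x * ((A x + (2 * r / x * B x - D x)) / (r + 1) - (A x - D x) / (r - 1))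
        = (1 / (r + 1) - 1 / (r - 1)) * (x * (A x - D x)) + 2 * r / (r + 1) * B x"
    proof -
      have "x * ((A x + (2 * r / x * B x - D x)) * p - (A x - D x) * q) = (p - q) * (x * (A x - D x)) + 2 * r * p * B x" for p q
        using assms(1) by (simp add: field_simps)
      from this[of "1 / (r + 1)" "1 / (r - 1)"] show ?thesis by simp
    qed
    have u4: "(1 - r) * (A x / x) = A x / x - r / x * A x" by (simp add: left_diff_distrib diff_divide_distrib)
    show ?thesis unfolding u1 u2 u3 u4 by simp
  qed
  also have "2 * r / x * B x - D x = JY (int m + 1) 1 x"
    using JY_rec[OF assms(1), of "int m" 1] by (simp add: B_def D_def r_def)
  finally show ?thesis unfolding A_def B_def C_def D_def r_def by simp
qed

section \<open>Assembling the formula\<close>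

definition P_formula :: "int \<Rightarrow> real \<Rightarrow> bool" where
  "P_formula \<mu> x \<longleftrightarrow> summable (\<lambda>n. bessel_P_term \<mu> x (Suc n))
    \<and> set_integrable lborel {x..} (\<lambda>t. bessel_f \<mu> t / t)
    \<and> set_integrable lborel {x..} (\<lambda>t. bessel_f \<mu> t / t\<^sup>2)
    \<and> bessel_P \<mu> x = (- 1) powi \<mu> *
        (- bessel_f \<mu> x
         + (of_int \<mu>)\<^sup>2 * (LINT t:{x..}|lborel. bessel_f \<mu> t / t)
         + (1 - (of_int \<mu>)\<^sup>2) * x * (LINT t:{x..}|lborel. bessel_f \<mu> t / t\<^sup>2))"

text \<open>For m = 1 the factor 1 - m^2 removes the second integral, matching the separate
  telescoping. For m >= 2 the brackets <m,0> and <m-1,0> outside \<open>G\<close> cancel between f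
  and the two integrals, and -2 <m,1> remains as in the sum of the series.\<close>

lemma P_formula_pos:
  assumes "x > 0" "m \<ge> 1"
  shows "P_formula (int m) x"
proof (cases "m = 1")
  case True
  have s: "(\<lambda>n. bessel_P_term 1 x (Suc n)) sums (pi * x / 4 * (JY 0 0 x + JY 1 1 x))"
    by (rule bessel_P_sums_1[OF assms(1)])
  have "(LINT t:{x..}|lborel. bessel_f 1 t / t) = pi / 4 * (JY 1 0 x - x * (JY 1 1 x + JY 0 0 x))"
    using LINT_bessel_f_over_t[OF assms] True by simp
  moreover have "bessel_P 1 x = pi * x / 4 * (JY 0 0 x + JY 1 1 x)"
    unfolding bessel_P_def using sums_unique[OF s] by simp
  ultimately have "bessel_P 1 x = (- 1) powi 1 * (- bessel_f 1 x + (of_int 1)\<^sup>2 * (LINT t:{x..}|lborel. bessel_f 1 t / t)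
      + (1 - (of_int 1)\<^sup>2) * x * (LINT t:{x..}|lborel. bessel_f 1 t / t\<^sup>2))"
    by (simp add: bessel_f_eq algebra_simps)
  thus ?thesis
    using set_integrable_bessel_f[OF assms(1), of 1] sums_summable[OF s] unfolding P_formula_def True by simp
next
  case False
  hence m: "m \<ge> 2" using assms by simp
  note s = bessel_P_sums[OF assms(1), of "int m"]
  have "int m \<noteq> 0" "int m \<noteq> 1" "int m \<noteq> - 1" using m by auto
  note s = s[OF this]
  define G where "G = x * ((JY (int m) 0 x + JY (int m + 1) 1 x) / (real m + 1) - (JY (int m) 0 x - JY (int m - 1) 1 x) / (real m - 1))"
  have P: "bessel_P (int m) x = (- 1) powi (int m) * (pi * x / 4 * (G - 2 * JY (int m) 1 x))"
    unfolding bessel_P_def G_def using sums_unique[OF s] by simp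
  have "- bessel_f (int m) x + (of_int (int m))\<^sup>2 * (LINT t:{x..}|lborel. bessel_f (int m) t / t)
      + (1 - (of_int (int m))\<^sup>2) * x * (LINT t:{x..}|lborel. bessel_f (int m) t / t\<^sup>2)
     = - bessel_f (int m) x + (real m)\<^sup>2 * (LINT t:{x..}|lborel. bessel_f (int m) t / t)
      + x * ((1 - (real m)\<^sup>2) * (LINT t:{x..}|lborel. bessel_f (int m) t / t\<^sup>2))"
    by (simp add: mult_ac)
  also have "\<dots> = pi * x / 4 * (G - 2 * JY (int m) 1 x)"
    unfolding LINT_bessel_f_over_t[OF assms] LINT_bessel_f_over_t_sq[OF assms(1) m] G_def[symmetric]
    unfolding bessel_f_eq using assms(1) by (simp add: field_simps)
  finally have "bessel_P (int m) x = (- 1) powi (int m) * (- bessel_f (int m) x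
      + (of_int (int m))\<^sup>2 * (LINT t:{x..}|lborel. bessel_f (int m) t / t)
      + (1 - (of_int (int m))\<^sup>2) * x * (LINT t:{x..}|lborel. bessel_f (int m) t / t\<^sup>2))"
    using P by (simp only:)
  thus ?thesis
    using set_integrable_bessel_f[OF assms(1), of m] sums_summable[OF s] unfolding P_formula_def by blast
qed

text \<open>Changing the sign of mu swaps the two halves of each term of the series, which
  multiplies it by (-1)^mu. By the reflection of J and Y, f also acquires this factor.\<close>

lemma P_formula_neg:
  assumes x: "x > 0" and P: "P_formula \<mu> x"
  shows "P_formula (- \<mu>) x"
proof -
  define c where "c = ((-1::real) powi \<mu>)"
  have c: "(- 1) powi (- \<mu>) = c" "c * c = 1" unfolding c_def by (auto simp: minus_one_powi)
  have f: "bessel_f (- \<mu>) t = c * bessel_f \<mu> t" if "t > 0" for t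
    using that by (simp add: bessel_f_eq JY_def J_int_neg Y_int_neg c_def algebra_simps)
  have t: "bessel_P_term (- \<mu>) x n = c * bessel_P_term \<mu> x n" for n
    using c x unfolding bessel_P_term_eq[OF x] c(1) c_def[symmetric]
    by (simp add: algebra_simps flip: mult.assoc) 
  have I: "set_integrable lborel {x..} (\<lambda>t. bessel_f (- \<mu>) t / t ^ k)"
     "(LINT t:{x..}|lborel. bessel_f (- \<mu>) t / t ^ k) = c * (LINT t:{x..}|lborel. bessel_f \<mu> t / t ^ k)"
    if "set_integrable lborel {x..} (\<lambda>t. bessel_f \<mu> t / t ^ k)" for k :: nat
  proof -
    have "set_integrable lborel {x..} (\<lambda>t. c * (bessel_f \<mu> t / t ^ k))"
      using that by (rule set_integrable_mult_right)
    moreover have "set_integrable lborel {x..} (\<lambda>t. c * (bessel_f \<mu> t / t ^ k))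
      = set_integrable lborel {x..} (\<lambda>t. bessel_f (- \<mu>) t / t ^ k)"
      using x by (intro set_integrable_cong) (auto simp: f)
    ultimately show "set_integrable lborel {x..} (\<lambda>t. bessel_f (- \<mu>) t / t ^ k)" by simp
    have "(LINT t:{x..}|lborel. bessel_f (- \<mu>) t / t ^ k) = (LINT t:{x..}|lborel. c * (bessel_f \<mu> t / t ^ k))"
      using x by (intro set_lebesgue_integral_cong) (auto simp: f)
    thus "(LINT t:{x..}|lborel. bessel_f (- \<mu>) t / t ^ k) = c * (LINT t:{x..}|lborel. bessel_f \<mu> t / t ^ k)"
      by (simp only: set_integral_mult_right)
  qed
  note I1 = I[of 1, simplified] note I2 = I[of 2]
  from P have s: "summable (\<lambda>n. bessel_P_term \<mu> x (Suc n))" by (simp add: P_formula_def)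
  have "bessel_P (- \<mu>) x = c * bessel_P \<mu> x"
    unfolding bessel_P_def t by (rule suminf_mult[OF s])
  thus ?thesis
    using P I1 I2 x summable_mult[OF s, of c] unfolding P_formula_def t c(1) c_def[symmetric]
    by (simp add: f algebra_simps)
qed

text \<open>Infinite sums and Lebesgue integrals are total in HOL, so the identity alone would not
  say that they converge; the first three conjuncts do.\<close>

theorem mainTheorem2:
  fixes \<mu> :: int and x :: real
  assumes "\<mu> \<noteq> 0" and "x > 0"
  shows "summable (\<lambda>n. bessel_P_term \<mu> x (Suc n))
    \<and> set_integrable lborel {x..} (\<lambda>t. bessel_f \<mu> t / t)
    \<and> set_integrable lborel {x..} (\<lambda>t. bessel_f \<mu> t / t\<^sup>2)
    \<and> bessel_P \<mu> x = (- 1) powi \<mu> *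
        (- bessel_f \<mu> x
         + (of_int \<mu>)\<^sup>2 * (LINT t:{x..}|lborel. bessel_f \<mu> t / t)
         + (1 - (of_int \<mu>)\<^sup>2) * x * (LINT t:{x..}|lborel. bessel_f \<mu> t / t\<^sup>2))"
proof -
  have "P_formula \<mu> x"
  proof (cases "\<mu> > 0")
    case True
    then obtain m where "\<mu> = int m" "m \<ge> 1" using zero_less_imp_eq_int by force
    thus ?thesis using P_formula_pos assms by simp
  next
    case False
    hence "- \<mu> > 0" using assms by simp
    then obtain m where "- \<mu> = int m" "m \<ge> 1" using zero_less_imp_eq_int by force
    hence "P_formula (- \<mu>) x" using P_formula_pos assms by simp
    thus ?thesis using P_formula_neg[OF assms(2), of "- \<mu>"] by simp
  qed
  thus ?thesis unfolding P_formula_def .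
qed

end
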